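(* Let $n\ge1$ and let $f\in L^2(\mathbb{R}^n,dm)$ with $\nabla f\in L^2(dm)$ be normalized, i.e. $\int|f|^2\,dm=1$. Then $$2\pi\int|x|^2\,dm-2\pi\int|x|^2|f|^2\,dm+\frac{1}{2\pi}\int|\nabla f|^2\,dm\le 2\sqrt{\pi n}\,\delta_c(f)^{\frac12}+\delta_c(f).$$
   Context: On $\mathbb{R}^n$, $dm=2^{n/2}e^{-2\pi|x|^2}dx$, a Gaussian probability measure. For $f\in L^2(dm)$ with $\int|f|^2dm=1$ and $\nabla f\in L^2(dm)$ (weak gradient), $\delta_c(f)=\frac{1}{2\pi}\int|\nabla f|^2\,dm-\int|f|^2\log|f|^2\,dm$, which is nonnegative. *)

theory Defs
  imports "HOL-Analysis.Analysis"
begin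

definition gauss :: "(real ^ 'n) measure" where
  "gauss = density lborel
     (\<lambda>x. ennreal (2 powr (real CARD('n) / 2) * exp (- 2 * pi * (norm x)\<^sup>2)))"

definition square_integrable ::
    "'a measure \<Rightarrow> ('a \<Rightarrow> 'b :: real_normed_vector) \<Rightarrow> bool" where
  "square_integrable M f \<longleftrightarrow>
     f \<in> borel_measurable M \<and> integrable M (\<lambda>x. (norm (f x))\<^sup>2)"

definition partial_deriv :: "'n \<Rightarrow> (real ^ 'n \<Rightarrow> real) \<Rightarrow> real ^ 'n \<Rightarrow> real" where
  "partial_deriv i \<phi> x = frechet_derivative \<phi> (at x) (axis i 1)"

primrec C_k :: "nat \<Rightarrow> (real ^ 'n \<Rightarrow> real) \<Rightarrow> bool" where
  "C_k 0 \<phi> \<longleftrightarrow> continuous_on UNIV \<phi>"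
| "C_k (Suc k) \<phi> \<longleftrightarrow>
     (\<forall>x. \<phi> differentiable at x) \<and> (\<forall>i. C_k k (partial_deriv i \<phi>))"

definition test_function :: "(real ^ 'n \<Rightarrow> real) \<Rightarrow> bool" where
  "test_function \<phi> \<longleftrightarrow> (\<forall>k. C_k k \<phi>) \<and> compact (closure {x. \<phi> x \<noteq> 0})"

definition locally_integrable ::
    "(real ^ 'n \<Rightarrow> 'b :: {banach, second_countable_topology}) \<Rightarrow> bool" where
  "locally_integrable f \<longleftrightarrow> (\<forall>K. compact K \<longrightarrow> set_integrable lborel K f)"

text \<open>The weak gradient is determined only up to a null set, so it is a relation between
  \<open>f\<close> and a representative \<open>G\<close>. Real test functions suffice for complex-valued \<open>f\<close>,
  as the identity is complex-linear in \<open>\<phi>\<close>. Integration is against Lebesgue measure,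
  not \<open>gauss\<close>.\<close>

definition has_weak_gradient ::
    "(real ^ 'n \<Rightarrow> complex) \<Rightarrow> (real ^ 'n \<Rightarrow> complex ^ 'n) \<Rightarrow> bool" where
  "has_weak_gradient f G \<longleftrightarrow>
     locally_integrable f \<and> locally_integrable G \<and>
     (\<forall>\<phi> i. test_function \<phi> \<longrightarrow>
        (LINT x|lborel. f x * complex_of_real (partial_deriv i \<phi> x))
          = - (LINT x|lborel. G x $ i * complex_of_real (\<phi> x)))"

text \<open>The deficit of \<open>f\<close>, where \<open>G\<close> is a weak gradient of \<open>f\<close>; any other choice of \<open>G\<close>
  gives the same value. Since \<open>ln 0 = 0\<close>, the entropy integrand vanishes where \<open>f\<close> does,
  which is the convention \<open>0 log 0 = 0\<close>.\<close>

definition deficit :: "(real ^ 'n \<Rightarrow> complex) \<Rightarrow> (real ^ 'n \<Rightarrow> complex ^ 'n) \<Rightarrow> real" where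
  "deficit f G =
     1 / (2 * pi) * (LINT x|gauss. (norm (G x))\<^sup>2)
       - (LINT x|gauss. (norm (f x))\<^sup>2 * ln ((norm (f x))\<^sup>2))"

end

theory Submission imports Defs "HOL-Probability.Distributions" begin

text \<open>
  Write \<open>\<gamma>\<close> for the density of the Gauss measure, \<open>n\<close> for the dimension, \<open>F = |f|\<^sup>2\<close>,
  \<open>X = \<integral>|x|\<^sup>2 F\<close>, \<open>I = \<integral>|\<nabla>f|\<^sup>2\<close> and \<open>H = \<integral>F ln F\<close>, all integrals against \<open>\<gamma>\<close>. The theorem follows from the
  logarithmic Sobolev inequality in its dilation invariant form: for every \<open>\<kappa> > 0\<close>,
  \<open>H \<le> 2\<pi>X - n (1 + ln \<kappa>) + \<kappa>\<^sup>2 / (2\<pi>) \<cdot> (I + 2\<pi>n - 4\<pi>\<^sup>2X)\<close>.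
  For \<open>\<kappa> = 1\<close> it says that the deficit is nonnegative. If the left side \<open>y\<close> of the theorem is positive, the optimal
  \<open>\<kappa>\<close> turns it into \<open>\<delta> \<ge> y - n/2 \<cdot> ln (1 + 2y/n)\<close>, and \<open>e\<^sup>L \<ge> 1 + L + L\<^sup>2/2\<close> finishes the argument
  (\<open>log_sobolev_numerical\<close>).

  The Sobolev inequality is proved by monotone transport, one coordinate at a time. Let \<open>h\<close> be continuous and bounded
  between positive constants, and divide it by its Gaussian average over the coordinate \<open>x\<^sub>i\<close>. The quotient \<open>r\<close> is a
  probability density with respect to the one-dimensional Gauss measure on each line parallel to the i-th axis, so there
  is a map \<open>T\<close>, increasing in \<open>x\<^sub>i\<close>, that transports \<open>r\<close> to the Gauss measure on each of these lines. Comparing densities,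
  \<open>ln r = 2\<pi> (x\<^sub>i\<^sup>2 - T\<^sup>2) + ln (\<partial>\<^sub>iT)\<close>, and \<open>ln (\<partial>\<^sub>iT) \<le> \<kappa> \<partial>\<^sub>iT - 1 - ln \<kappa>\<close>. Integrating against \<open>F\<close> and moving
  the derivative from \<open>T\<close> to \<open>F\<close>, a completed square removes \<open>T\<close> altogether, and the contribution of the i-th
  coordinate to the right side above remains (\<open>conditional_transport\<close>, \<open>conditional_entropy_bound\<close>). Averaging over all
  coordinates in turn makes \<open>h\<close> constant, so the contributions add up to a bound for
  \<open>\<integral>F ln h - ln (\<integral>h)\<close> (\<open>entropy_continuous\<close>). Approximating \<open>F\<close> itself by such \<open>h\<close> gives \<open>H\<close>
  (\<open>entropy_measurable\<close>, \<open>entropy_le\<close>).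

  Because the inequality is tested with \<open>h\<close> instead of being proved for smooth \<open>f\<close> first, the function \<open>f\<close> is never
  regularized. Its weak derivative enters only through the integration by parts
  \<open>\<integral>g\<^sup>2 \<partial>\<^sub>iT = - 2 \<integral>g (\<partial>\<^sub>ig) T\<close> for a real square integrable \<open>g\<close> of compact support
  (\<open>integral_sq_directional_derivative\<close>), where \<open>g\<close> is the real or imaginary part of \<open>f\<close> times a cutoff and
  \<open>\<surd>\<gamma>\<close>. This in turn holds since difference quotients converge to the weak derivative in the square mean
  (\<open>difference_quotient_tendsto\<close>).
\<close>

section \<open>Smooth functions of compact support\<close>

text \<open>The classical smooth function \<open>exp (- 1 / s)\<close>, flat at zero. The powers of \<open>s\<close> in the denominator make
  the family closed under derivatives, up to linear combinations (\<open>DERIV_bump\<close>).\<close>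

definition bump :: "nat \<Rightarrow> real \<Rightarrow> real" where
  "bump k s = (if 0 < s then exp (- 1 / s) / s ^ k else 0)"

lemma bump_nonneg: "0 \<le> bump k s"
  by (simp add: bump_def)

lemma bump_eq_0: "s \<le> 0 \<Longrightarrow> bump k s = 0"
  by (simp add: bump_def)

lemma power_le_fact_exp:
  fixes y :: real
  assumes "0 \<le> y"
  shows "y ^ m \<le> fact m * exp y"
proof -
  have "y ^ m /\<^sub>R fact m = (\<Sum>n\<in>{m}. y ^ n /\<^sub>R fact n)" by simp
  also have "\<dots> \<le> exp y"
    unfolding exp_def
    by (rule sum_le_suminf[OF summable_exp_generic]) (use assms in auto)
  finally show ?thesis by (simp add: field_simps)
qed

lemma bump_le_power: "0 < s \<Longrightarrow> bump k s \<le> fact (k + m) * s ^ m"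
  using power_le_fact_exp[of "1 / s" "k + m"]
  by (simp add: bump_def field_simps power_add exp_minus)

lemma DERIV_bump: "(bump k has_real_derivative bump (k + 2) s - k * bump (k + 1) s) (at s)"
proof (cases "s = 0")
  case False
  show ?thesis
  proof (cases "0 < s")
    case True
    have "((\<lambda>s. exp (- 1 / s) / s ^ k) has_real_derivative bump (k + 2) s - k * bump (k + 1) s) (at s)"
      using True
      by (auto intro!: derivative_eq_intros simp: bump_def field_simps power2_eq_square)
         (cases k; simp add: field_simps)
    then show ?thesis
      by (rule DERIV_cong_ev[THEN iffD1, rotated -1])
         (auto simp: bump_def eventually_nhds intro!: exI[of _ "{0<..}"] True)
  next
    case False
    with \<open>s \<noteq> 0\<close> have "s < 0" by simp
    then have "((\<lambda>s. 0) has_real_derivative bump (k + 2) s - k * bump (k + 1) s) (at s)"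
      by (auto simp: bump_def)
    then show ?thesis
      by (rule DERIV_cong_ev[THEN iffD1, rotated -1])
         (auto simp: bump_def eventually_nhds intro!: exI[of _ "{..<0}"] \<open>s < 0\<close>)
  qed
next
  case True
  have bd: "norm (bump k h / h) \<le> fact (k + 2) * \<bar>h\<bar>" for h :: real
  proof (cases "0 < h")
    case True
    then show ?thesis
      using bump_le_power[OF True, of k 2] bump_nonneg[of k h]
      by (simp add: divide_le_eq power2_eq_square mult.assoc)
  next
    case False
    then have "bump k h = 0" by (simp add: bump_def)
    then show ?thesis by (simp del: fact_Suc)
  qed
  have "((\<lambda>h. bump k h / h) \<longlongrightarrow> 0) (at 0)"
  proof (rule Lim_null_comparison[where g="\<lambda>h. fact (k + 2) * \<bar>h\<bar>"])
    show "((\<lambda>h :: real. fact (k + 2) * \<bar>h\<bar>) \<longlongrightarrow> 0) (at 0)"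
      by (auto intro!: tendsto_eq_intros simp del: fact_Suc)
  qed (intro always_eventually allI bd)
  then show ?thesis
    by (simp add: True DERIV_def bump_def)
qed

lemma bump_le: "bump k s \<le> fact k"
  using bump_le_power[of s k 0] by (cases "0 < s") (auto simp: bump_def)

lemma bump_0_at_top:
  assumes "filterlim g at_top F"
  shows "((\<lambda>n. bump 0 (g n)) \<longlongrightarrow> 1) F"
proof -
  have "((\<lambda>n. exp (- (1 / g n))) \<longlongrightarrow> exp (- 0)) F"
    by (intro tendsto_intros tendsto_divide_0[OF tendsto_const] filterlim_at_top_imp_at_infinity assms)
  moreover have "eventually (\<lambda>n. 0 < g n) F"
    using assms by (simp add: filterlim_at_top_dense)
  ultimately show ?thesis
    by (simp add: bump_def) (erule tendsto_cong[THEN iffD1, rotated], auto elim: eventually_mono)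
qed

text \<open>A class of functions that contains cutoffs, polynomials and Gaussians and is closed under partial
  derivatives by construction. Membership therefore gives smoothness of all orders at once.\<close>

inductive elementary_smooth :: "(real ^ 'n \<Rightarrow> real) \<Rightarrow> bool" where
  const: "elementary_smooth (\<lambda>_. c)"
| coord: "elementary_smooth (\<lambda>x. x $ i)"
| add: "elementary_smooth f \<Longrightarrow> elementary_smooth g \<Longrightarrow> elementary_smooth (\<lambda>x. f x + g x)"
| mult: "elementary_smooth f \<Longrightarrow> elementary_smooth g \<Longrightarrow> elementary_smooth (\<lambda>x. f x * g x)"
| exp: "elementary_smooth f \<Longrightarrow> elementary_smooth (\<lambda>x. exp (f x))"
| bump: "elementary_smooth f \<Longrightarrow> elementary_smooth (\<lambda>x. bump k (f x))"

lemma elementary_smooth_diff: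
  "elementary_smooth f \<Longrightarrow> elementary_smooth g \<Longrightarrow> elementary_smooth (\<lambda>x. f x - g x)"
  using elementary_smooth.add[OF _ elementary_smooth.mult[OF elementary_smooth.const[of "-1"]], of f g]
  by simp

lemma elementary_smooth_sum:
  "(\<And>j. j \<in> J \<Longrightarrow> elementary_smooth (f j)) \<Longrightarrow> elementary_smooth (\<lambda>x. \<Sum>j\<in>J. f j x)"
  by (induction J rule: infinite_finite_induct) (auto intro: elementary_smooth.intros)

lemma norm_sq_vec: "(norm x)\<^sup>2 = (\<Sum>j\<in>UNIV. (x $ j)\<^sup>2)" for x :: "real ^ 'n"
  unfolding power2_norm_eq_inner inner_vec_def by (simp add: power2_eq_square)

lemma elementary_smooth_norm_sq: "elementary_smooth (\<lambda>x :: real ^ 'n. (norm x)\<^sup>2)"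
  unfolding norm_sq_vec unfolding power2_eq_square
  by (intro elementary_smooth_sum elementary_smooth.intros)

text \<open>The partial derivatives \<open>D i\<close> lie in the class again, which is what makes the induction on the order of
  differentiability in \<open>elementary_smooth_C_k\<close> work.\<close>

lemma elementary_smooth_has_derivative:
  fixes f :: "real ^ 'n \<Rightarrow> real"
  assumes "elementary_smooth f"
  shows "\<exists>D. (\<forall>i. elementary_smooth (D i)) \<and>
    (\<forall>x. (f has_derivative (\<lambda>v. \<Sum>i\<in>UNIV. v $ i * D i x)) (at x))"
  using assms
proof induction
  case (const c)
  then show ?case
    by (intro exI[of _ "\<lambda>_ _. 0"]) (auto intro: elementary_smooth.intros)
next
  case (coord i)
  have eq: "(\<lambda>v. \<Sum>j\<in>UNIV. v $ j * (if j = i then 1 else 0)) = (\<lambda>v :: real ^ 'n. v $ i)"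
    by (simp add: if_distrib sum.delta cong: if_cong)
  show ?case
    by (rule exI[of _ "\<lambda>j _. if j = i then 1 else 0"], simp only: eq)
      (auto intro: elementary_smooth.intros bounded_linear.has_derivative[OF bounded_linear_vec_nth])
next
  case (add f g)
  then obtain D E where
    D: "\<forall>i. elementary_smooth (D i)" "\<And>x. (f has_derivative (\<lambda>v. \<Sum>i\<in>UNIV. v $ i * D i x)) (at x)" and
    E: "\<forall>i. elementary_smooth (E i)" "\<And>x. (g has_derivative (\<lambda>v. \<Sum>i\<in>UNIV. v $ i * E i x)) (at x)"
    by auto
  show ?case
  proof (rule exI[of _ "\<lambda>i x. D i x + E i x"], intro conjI allI)
    show "((\<lambda>x. f x + g x) has_derivative (\<lambda>v. \<Sum>i\<in>UNIV. v $ i * (D i x + E i x))) (at x)" for x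
      by (rule has_derivative_eq_rhs[OF has_derivative_add[OF D(2) E(2)]])
         (simp add: fun_eq_iff sum.distrib algebra_simps)
  qed (use D E in \<open>auto intro: elementary_smooth.intros\<close>)
next
  case (mult f g)
  then obtain D E where
    D: "\<forall>i. elementary_smooth (D i)" "\<And>x. (f has_derivative (\<lambda>v. \<Sum>i\<in>UNIV. v $ i * D i x)) (at x)" and
    E: "\<forall>i. elementary_smooth (E i)" "\<And>x. (g has_derivative (\<lambda>v. \<Sum>i\<in>UNIV. v $ i * E i x)) (at x)"
    by auto
  show ?case
  proof (rule exI[of _ "\<lambda>i x. f x * E i x + D i x * g x"], intro conjI allI)
    show "((\<lambda>x. f x * g x) has_derivative (\<lambda>v. \<Sum>i\<in>UNIV. v $ i * (f x * E i x + D i x * g x))) (at x)" for x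
      by (rule has_derivative_eq_rhs[OF has_derivative_mult[OF D(2) E(2)]])
         (simp add: fun_eq_iff sum.distrib sum_distrib_left sum_distrib_right algebra_simps)
    show "elementary_smooth (\<lambda>x. f x * E i x + D i x * g x)" for i
      using D E mult.hyps by (intro elementary_smooth.add elementary_smooth.mult) auto
  qed
next
  case (exp f)
  then obtain D where
    D: "\<forall>i. elementary_smooth (D i)" "\<And>x. (f has_derivative (\<lambda>v. \<Sum>i\<in>UNIV. v $ i * D i x)) (at x)"
    by auto
  show ?case
  proof (rule exI[of _ "\<lambda>i x. exp (f x) * D i x"], intro conjI allI)
    show "((\<lambda>x. exp (f x)) has_derivative (\<lambda>v. \<Sum>i\<in>UNIV. v $ i * (exp (f x) * D i x))) (at x)" for x
      by (rule has_derivative_eq_rhs[OF has_derivative_exp[OF D(2)]])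
         (simp add: fun_eq_iff sum_distrib_left algebra_simps)
    show "elementary_smooth (\<lambda>x. exp (f x) * D i x)" for i
      using D exp.hyps by (intro elementary_smooth.mult elementary_smooth.exp) auto
  qed
next
  case (bump f k)
  then obtain D where
    D: "\<forall>i. elementary_smooth (D i)" "\<And>x. (f has_derivative (\<lambda>v. \<Sum>i\<in>UNIV. v $ i * D i x)) (at x)"
    by auto
  let ?b = "\<lambda>x. bump (k + 2) (f x) - k * bump (k + 1) (f x)"
  show ?case
  proof (rule exI[of _ "\<lambda>i x. ?b x * D i x"], intro conjI allI)
    show "((\<lambda>x. bump k (f x)) has_derivative (\<lambda>v. \<Sum>i\<in>UNIV. v $ i * (?b x * D i x))) (at x)" for x
      by (rule has_derivative_eq_rhs[OF
            has_derivative_compose[OF D(2) DERIV_bump[unfolded has_field_derivative_def]]])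
         (simp add: fun_eq_iff sum_distrib_left sum_subtractf algebra_simps)
    show "elementary_smooth (\<lambda>x. ?b x * D i x)" for i
      using D bump.hyps
      by (intro elementary_smooth.mult elementary_smooth_diff elementary_smooth.const
          elementary_smooth.bump) auto
  qed
qed

lemma partial_deriv_eq:
  assumes "(\<phi> has_derivative d) (at x)"
  shows "partial_deriv i \<phi> x = d (axis i 1)"
  using frechet_derivative_at[OF assms] by (simp add: partial_deriv_def)

lemma elementary_smooth_differentiable:
  assumes "elementary_smooth \<phi>"
  shows "\<phi> differentiable at x" and "elementary_smooth (partial_deriv i \<phi>)"
proof -
  obtain D where D: "\<forall>i. elementary_smooth (D i)"
      "\<And>x. (\<phi> has_derivative (\<lambda>v. \<Sum>i\<in>UNIV. v $ i * D i x)) (at x)"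
    using elementary_smooth_has_derivative[OF assms] by auto
  show "\<phi> differentiable at x"
    using D(2) differentiableI by blast
  have "partial_deriv i \<phi> = D i"
    by (simp add: fun_eq_iff partial_deriv_eq[OF D(2)] axis_def if_distrib[of "\<lambda>t. t * _"] cong: if_cong)
  then show "elementary_smooth (partial_deriv i \<phi>)"
    using D by simp
qed

lemma elementary_smooth_continuous: "elementary_smooth \<phi> \<Longrightarrow> continuous_on UNIV \<phi>"
  by (simp add: continuous_at_imp_continuous_on differentiable_imp_continuous_within
      elementary_smooth_differentiable)

lemma elementary_smooth_measurable: "elementary_smooth \<phi> \<Longrightarrow> \<phi> \<in> borel_measurable borel"
  by (rule borel_measurable_continuous_onI[OF elementary_smooth_continuous])

lemma elementary_smooth_C_k: "elementary_smooth \<phi> \<Longrightarrow> C_k k \<phi>"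
proof (induction k arbitrary: \<phi>)
  case 0
  then show ?case
    by (simp add: elementary_smooth_continuous)
qed (simp add: elementary_smooth_differentiable)

lemma test_functionI:
  assumes "elementary_smooth \<phi>" and "\<And>x. R \<le> norm x \<Longrightarrow> \<phi> x = 0"
  shows "test_function \<phi>"
proof -
  have "{x. \<phi> x \<noteq> 0} \<subseteq> cball 0 R"
    using assms(2) by (force simp: not_le[symmetric])
  then have "bounded {x. \<phi> x \<noteq> 0}"
    using bounded_cball bounded_subset by blast
  then show ?thesis
    using assms(1) by (simp add: test_function_def elementary_smooth_C_k compact_closure)
qed

section \<open>Density in the square integrable functions\<close>

lemma square_integrable_real:
  "square_integrable M k \<longleftrightarrow> k \<in> borel_measurable M \<and> integrable M (\<lambda>x. (k x)\<^sup>2)"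
  for k :: "'a \<Rightarrow> real"
  by (simp add: square_integrable_def)

lemma abs_mult_le_sum_squares: "\<bar>a * b\<bar> \<le> a\<^sup>2 + b\<^sup>2" for a b :: real
proof -
  have "0 \<le> \<bar>a\<bar> * \<bar>b\<bar>" by simp
  moreover have "2 * \<bar>a\<bar> * \<bar>b\<bar> \<le> a\<^sup>2 + b\<^sup>2"
    using sum_squares_bound[of "\<bar>a\<bar>" "\<bar>b\<bar>"] by simp
  ultimately show ?thesis unfolding abs_mult by linarith
qed

lemma square_integrable_mult:
  fixes f g :: "'a \<Rightarrow> real"
  assumes "square_integrable M f" "square_integrable M g"
  shows "integrable M (\<lambda>x. f x * g x)"
proof (rule Bochner_Integration.integrable_bound)
  show "integrable M (\<lambda>x. (f x)\<^sup>2 + (g x)\<^sup>2)"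
    using assms by (simp add: square_integrable_real)
  show "(\<lambda>x. f x * g x) \<in> borel_measurable M"
    using assms by (auto simp: square_integrable_real)
  show "AE x in M. norm (f x * g x) \<le> norm ((f x)\<^sup>2 + (g x)\<^sup>2)"
    using abs_mult_le_sum_squares by simp
qed

lemma square_integrable_add:
  fixes f g :: "'a \<Rightarrow> real"
  assumes "square_integrable M f" "square_integrable M g"
  shows "square_integrable M (\<lambda>x. f x + g x)"
proof -
  have "integrable M (\<lambda>x. (f x)\<^sup>2 + (g x)\<^sup>2 + 2 * (f x * g x))"
    using assms square_integrable_mult[OF assms] by (simp add: square_integrable_real)
  then show ?thesis
    using assms by (auto simp: square_integrable_real power2_sum mult.assoc)
qed

lemma square_integrable_cmult:
  fixes f :: "'a \<Rightarrow> real"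
  shows "square_integrable M f \<Longrightarrow> square_integrable M (\<lambda>x. c * f x)"
  by (auto simp: square_integrable_real power_mult_distrib)

lemma square_integrable_diff:
  fixes f g :: "'a \<Rightarrow> real"
  assumes "square_integrable M f" "square_integrable M g"
  shows "square_integrable M (\<lambda>x. f x - g x)"
  using square_integrable_add[OF assms(1) square_integrable_cmult[OF assms(2), of "-1"]] by simp

lemma square_integrable_bounded_mult:
  fixes f g :: "'a \<Rightarrow> real"
  assumes "square_integrable M f" "g \<in> borel_measurable M" "\<And>x. f x \<noteq> 0 \<Longrightarrow> \<bar>g x\<bar> \<le> B"
  shows "square_integrable M (\<lambda>x. g x * f x)"
  unfolding square_integrable_real
proof
  have le: "(g x * f x)\<^sup>2 \<le> B\<^sup>2 * (f x)\<^sup>2" for x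
  proof (cases "f x = 0")
    case False
    then have "\<bar>g x\<bar>\<^sup>2 \<le> B\<^sup>2"
      using assms(3) by (intro power_mono) auto
    then show ?thesis
      by (auto simp: power_mult_distrib intro!: mult_right_mono)
  qed simp
  show "integrable M (\<lambda>x. (g x * f x)\<^sup>2)"
    by (rule Bochner_Integration.integrable_bound[of _ "\<lambda>x. B\<^sup>2 * (f x)\<^sup>2"])
      (use assms le in \<open>auto simp: square_integrable_real\<close>)
  show "(\<lambda>x. g x * f x) \<in> borel_measurable M"
    using assms by (auto simp: square_integrable_real)
qed

lemma integrable_lborel_shift_iff:
  fixes f :: "real ^ 'n \<Rightarrow> real"
  shows "integrable lborel (\<lambda>x. f (x + c)) \<longleftrightarrow> integrable lborel f"
proof -
  have *: "integrable lborel (\<lambda>x. f (x + c))" if "integrable lborel f" for f :: "real ^ 'n \<Rightarrow> real" and c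
    using that integrable_distr[of "(+) c" lborel lborel f] lborel_distr_plus[of c]
    by (simp add: add.commute cong: distr_cong)
  show ?thesis
    using *[of f c] *[of "\<lambda>x. f (x + c)" "- c"] by auto
qed

lemma integral_lborel_shift:
  fixes f :: "real ^ 'n \<Rightarrow> real"
  assumes [measurable]: "f \<in> borel_measurable borel"
  shows "(LINT x|lborel. f (x + c)) = (LINT x|lborel. f x)"
proof -
  have "(LINT x|lborel. f x) = (LINT x|distr lborel borel ((+) c). f x)"
    by (simp add: lborel_distr_plus)
  also have "\<dots> = (LINT x|lborel. f (c + x))"
    by (rule integral_distr) auto
  finally show ?thesis
    by (simp add: add.commute)
qed

lemma square_integrable_shift:
  fixes f :: "real ^ 'n \<Rightarrow> real"
  assumes "square_integrable lborel f"
  shows "square_integrable lborel (\<lambda>x. f (x + c))"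
  using assms integrable_lborel_shift_iff[of "\<lambda>x. (f x)\<^sup>2" c]
  by (auto simp: square_integrable_real)

text \<open>Continuous functions are enough to test the entropy and to approximate in the square mean, because a
  Borel function is measurable in the sense of Lusin.\<close>

lemma AE_limit_of_continuous:
  fixes k :: "real ^ 'n \<Rightarrow> real"
  assumes "k \<in> borel_measurable borel"
  obtains g where "\<And>n. continuous_on UNIV (g n)" "AE x in lborel. (\<lambda>n. g n x) \<longlonglongrightarrow> k x"
proof -
  have "k measurable_on UNIV"
    using assms by (subst measurable_on_iff_borel_measurable)
      (auto simp: borel_measurable_subalgebra lebesgue_on_UNIV_eq intro: measurable_completion)
  then obtain N g where "negligible N" "\<And>n. continuous_on UNIV (g n :: _ \<Rightarrow> real)"
    "\<And>x. x \<notin> N \<Longrightarrow> (\<lambda>n. g n x) \<longlonglongrightarrow> k x"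
    by (auto simp: measurable_on_def)
  moreover from this have "AE x in lebesgue. (\<lambda>n. g n x) \<longlonglongrightarrow> k x"
    by (intro AE_I'[of N]) (auto simp: negligible_iff_null_sets)
  ultimately show ?thesis
    using that[of g] by (simp add: AE_completion_iff)
qed

lemma elementary_smooth_polynomial:
  fixes p :: "real ^ 'n \<Rightarrow> real"
  assumes "real_polynomial_function p"
  shows "elementary_smooth p"
  using assms
proof induction
  case (linear f)
  have "f = (\<lambda>x. \<Sum>i\<in>UNIV. f (axis i 1) * x $ i)"
  proof
    fix x :: "real ^ 'n"
    have "f x = f (\<Sum>i\<in>UNIV. x $ i *\<^sub>R axis i 1)"
      by (simp add: basis_expansion flip: scalar_mult_eq_scaleR)
    also have "\<dots> = (\<Sum>i\<in>UNIV. f (axis i 1) * x $ i)"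
      using linear by (simp add: linear_sum linear_cmul bounded_linear.linear mult.commute)
    finally show "f x = (\<Sum>i\<in>UNIV. f (axis i 1) * x $ i)" .
  qed
  moreover have "elementary_smooth (\<lambda>x. \<Sum>i\<in>UNIV. f (axis i 1) * x $ i)"
    by (intro elementary_smooth_sum elementary_smooth.intros)
  ultimately show ?case by simp
qed (auto intro: elementary_smooth.intros)

lemma integrable_cball_const:
  fixes r C :: real
  shows "integrable lborel (\<lambda>x. C * indicator (cball (0 :: 'a :: euclidean_space) r) x)"
  by (intro integrable_mult_right integrable_real_indicator)
    (use emeasure_lborel_cball_finite[of 0 r] in \<open>auto simp: less_top\<close>)

lemma compactly_supported_bounded:
  fixes \<phi> :: "real ^ 'n \<Rightarrow> real"
  assumes "elementary_smooth \<phi>" and zero: "\<And>x. R \<le> norm x \<Longrightarrow> \<phi> x = 0"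
  obtains B where "0 \<le> B" "\<And>x. \<bar>\<phi> x\<bar> \<le> B"
proof -
  have "compact (\<phi> ` cball 0 R)"
    by (intro compact_continuous_image compact_cball
        continuous_on_subset[OF elementary_smooth_continuous[OF assms(1)]]) auto
  then have "bounded (\<phi> ` cball 0 R)"
    by (rule compact_imp_bounded)
  then obtain B where "0 < B" and B: "\<And>x. norm x \<le> R \<Longrightarrow> \<bar>\<phi> x\<bar> \<le> B"
    by (fastforce simp: bounded_pos)
  have "\<bar>\<phi> x\<bar> \<le> B" for x
    using B[of x] zero[of x] \<open>0 < B\<close> by (cases "norm x \<le> R") auto
  then show ?thesis
    using that[of B] \<open>0 < B\<close> by simp
qed

lemma square_integrable_compactly_supported_smooth:
  fixes \<phi> :: "real ^ 'n \<Rightarrow> real"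
  assumes smooth: "elementary_smooth \<phi>" and zero: "\<And>x. R \<le> norm x \<Longrightarrow> \<phi> x = 0"
  shows "square_integrable lborel \<phi>"
proof -
  obtain B where "0 \<le> B" and B: "\<And>x. \<bar>\<phi> x\<bar> \<le> B"
    using compactly_supported_bounded[OF smooth zero] by metis
  have [measurable]: "\<phi> \<in> borel_measurable borel"
    by (intro elementary_smooth_measurable smooth)
  have "(\<phi> x)\<^sup>2 \<le> B\<^sup>2 * indicator (cball 0 R) x" for x
    using power_mono[OF B[of x], of 2] zero[of x] by (auto simp: indicator_def)
  then show ?thesis
    unfolding square_integrable_real
    by (intro conjI Bochner_Integration.integrable_bound[OF integrable_cball_const[of "B\<^sup>2" R]]) auto
qed

text \<open>Truncate the function in space and in size, approximate it almost everywhere by continuous functions,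
  replace these by polynomials on the ball of radius \<open>N\<close>, and multiply by smooth functions that increase to the
  indicator of this ball. The products are uniformly bounded on a fixed ball, so dominated convergence applies.\<close>

lemma compactly_supported_smooth_dense:
  fixes k :: "real ^ 'n \<Rightarrow> real"
  assumes k: "square_integrable lborel k" and "0 < e"
  obtains \<phi> R where "elementary_smooth \<phi>" "\<And>x. R \<le> norm x \<Longrightarrow> \<phi> x = 0"
    "square_integrable lborel \<phi>" "(LINT x|lborel. (k x - \<phi> x)\<^sup>2) < e"
proof -
  have [measurable]: "k \<in> borel_measurable borel" and ik: "integrable lborel (\<lambda>x. (k x)\<^sup>2)"
    using k by (auto simp: square_integrable_real)
  define K where "K N x = (if norm x < real N \<and> \<bar>k x\<bar> \<le> real N then k x else 0)" for N x
  have K_meas [measurable]: "K N \<in> borel_measurable borel" for N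
    unfolding K_def by measurable
  have "(\<lambda>N. LINT x|lborel. (k x - K N x)\<^sup>2) \<longlonglongrightarrow> (LINT x|(lborel :: (real ^ 'n) measure). (0 :: real))"
  proof (rule integral_dominated_convergence[where w="\<lambda>x. (k x)\<^sup>2"])
    have "(\<lambda>N. (k x - K N x)\<^sup>2) \<longlonglongrightarrow> 0" for x
    proof (rule tendsto_eventually)
      obtain N0 :: nat where "max (norm x) \<bar>k x\<bar> < real N0"
        using reals_Archimedean2 by blast
      then show "\<forall>\<^sub>F N in sequentially. (k x - K N x)\<^sup>2 = 0"
        by (intro eventually_sequentiallyI[of N0]) (auto simp: K_def)
    qed
    then show "AE x in lborel. (\<lambda>N. (k x - K N x)\<^sup>2) \<longlonglongrightarrow> 0" by simp
    show "AE x in lborel. norm ((k x - K N x)\<^sup>2) \<le> (k x)\<^sup>2" for N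
      by (simp add: K_def)
  qed (use ik in auto)
  then have "\<forall>\<^sub>F N in sequentially. (LINT x|lborel. (k x - K N x)\<^sup>2) < e / 4"
    by (rule order_tendstoD(2)) (use \<open>0 < e\<close> in simp)
  then obtain N where N: "(LINT x|lborel. (k x - K N x)\<^sup>2) < e / 4"
    by (auto simp: eventually_sequentially)
  obtain g where g: "\<And>n. continuous_on UNIV (g n)" "AE x in lborel. (\<lambda>n. g n x) \<longlonglongrightarrow> K N x"
    using AE_limit_of_continuous[OF K_meas] by blast
  define c where "c n x = max (- real N) (min (real N) (g n x))" for n x
  have "\<exists>p. real_polynomial_function p \<and> (\<forall>x\<in>cball 0 (real N). \<bar>c n x - p x\<bar> < 1 / Suc n)" for n
  proof -
    have "continuous_on (cball 0 (real N)) (c n)"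
      unfolding c_def by (intro continuous_intros continuous_on_subset[OF g(1)]) auto
    then show ?thesis
      using Stone_Weierstrass_real_polynomial_function[of "cball 0 (real N)" "c n" "1 / Suc n"]
      by (metis compact_cball of_nat_0_less_iff zero_less_Suc zero_less_divide_1_iff)
  qed
  then obtain p where p: "\<And>n. real_polynomial_function (p n)"
      "\<And>n x. norm x \<le> real N \<Longrightarrow> \<bar>c n x - p n x\<bar> < 1 / Suc n"
    by (metis mem_cball_0)
  define \<phi> where "\<phi> n x = p n x * bump 0 (((real N)\<^sup>2 - (norm x)\<^sup>2) * real n)" for n x
  have smooth: "elementary_smooth (\<phi> n)" for n
    unfolding \<phi>_def
    by (intro elementary_smooth.mult elementary_smooth.bump elementary_smooth_polynomial[OF p(1)]
        elementary_smooth_diff elementary_smooth.const elementary_smooth_norm_sq)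
  have [measurable]: "\<phi> n \<in> borel_measurable borel" for n
    by (intro elementary_smooth_measurable smooth)
  have zero: "\<phi> n x = 0" if "real N \<le> norm x" for n x
  proof -
    have "((real N)\<^sup>2 - (norm x)\<^sup>2) * real n \<le> 0"
      using that by (intro mult_nonpos_nonneg) (auto intro: power_mono)
    then show ?thesis by (simp add: \<phi>_def bump_def)
  qed
  have bound: "\<bar>\<phi> n x\<bar> \<le> (real N + 1) * indicator (cball 0 (real N)) x" for n x
  proof (cases "norm x < real N")
    case True
    have "1 / real (Suc n) \<le> 1" by simp
    moreover have "\<bar>c n x\<bar> \<le> real N"
      by (auto simp: c_def)
    ultimately have "\<bar>p n x\<bar> \<le> real N + 1"
      using p(2)[of x n] True by linarith
    then have "\<bar>p n x\<bar> * \<bar>bump 0 (((real N)\<^sup>2 - (norm x)\<^sup>2) * real n)\<bar> \<le> (real N + 1) * 1"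
      by (intro mult_mono) (use bump_le[of 0] bump_nonneg[of 0] in auto)
    then show ?thesis using True by (simp add: \<phi>_def abs_mult)
  qed (simp add: zero)
  have lim: "(\<lambda>n. LINT x|lborel. (K N x - \<phi> n x)\<^sup>2) \<longlonglongrightarrow> (LINT x|(lborel :: (real ^ 'n) measure). (0 :: real))"
  proof (rule integral_dominated_convergence[where
        w="\<lambda>x :: real ^ 'n. (2 * real N + 1)\<^sup>2 * indicator (cball 0 (real N)) x"])
    show "AE x in lborel. (\<lambda>n. (K N x - \<phi> n x)\<^sup>2) \<longlonglongrightarrow> 0"
      using g(2)
    proof eventually_elim
      fix x assume lim: "(\<lambda>n. g n x) \<longlonglongrightarrow> K N x"
      show "(\<lambda>n. (K N x - \<phi> n x)\<^sup>2) \<longlonglongrightarrow> 0"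
      proof (cases "norm x < real N")
        case True
        have "(\<lambda>n. c n x) \<longlonglongrightarrow> max (- real N) (min (real N) (K N x))"
          unfolding c_def by (intro tendsto_intros lim)
        also have "max (- real N) (min (real N) (K N x)) = K N x"
          by (auto simp: K_def)
        finally have "(\<lambda>n. c n x) \<longlonglongrightarrow> K N x" .
        moreover have "(\<lambda>n. c n x - p n x) \<longlonglongrightarrow> 0"
          by (rule Lim_null_comparison[OF _ LIMSEQ_inverse_real_of_nat])
            (use p(2)[of x] True in \<open>auto intro!: always_eventually less_imp_le simp: inverse_eq_divide\<close>)
        ultimately have "(\<lambda>n. p n x) \<longlonglongrightarrow> K N x"
          using tendsto_diff[of "\<lambda>n. c n x" "K N x" sequentially "\<lambda>n. c n x - p n x" 0] by simp
        moreover have "(\<lambda>n. bump 0 (((real N)\<^sup>2 - (norm x)\<^sup>2) * real n)) \<longlonglongrightarrow> 1"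
          by (intro bump_0_at_top filterlim_tendsto_pos_mult_at_top[OF tendsto_const _ filterlim_real_sequentially])
            (use True in \<open>simp add: power_strict_mono\<close>)
        ultimately have "(\<lambda>n. \<phi> n x) \<longlonglongrightarrow> K N x * 1"
          unfolding \<phi>_def by (rule tendsto_mult)
        then have "(\<lambda>n. (K N x - \<phi> n x)\<^sup>2) \<longlonglongrightarrow> (K N x - K N x * 1)\<^sup>2"
          by (intro tendsto_intros)
        then show ?thesis by simp
      qed (simp add: zero K_def)
    qed
    show "AE x in lborel. norm ((K N x - \<phi> n x)\<^sup>2)
        \<le> (2 * real N + 1)\<^sup>2 * indicator (cball 0 (real N)) x" for n
    proof (rule AE_I2)
      fix x :: "real ^ 'n"
      show "norm ((K N x - \<phi> n x)\<^sup>2) \<le> (2 * real N + 1)\<^sup>2 * indicator (cball 0 (real N)) x"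
      proof (cases "norm x < real N")
        case True
        have "\<bar>K N x - \<phi> n x\<bar> \<le> 2 * real N + 1"
          using bound[of n x] True by (auto simp: K_def)
        then have "\<bar>K N x - \<phi> n x\<bar>\<^sup>2 \<le> (2 * real N + 1)\<^sup>2"
          by (intro power_mono) auto
        then show ?thesis using True by simp
      qed (simp add: zero K_def)
    qed
  qed (use integrable_cball_const in auto)
  then have "\<forall>\<^sub>F n in sequentially. (LINT x|lborel. (K N x - \<phi> n x)\<^sup>2) < e / 4"
    by (intro order_tendstoD(2)[OF lim]) (use \<open>0 < e\<close> in simp)
  then obtain n where n: "(LINT x|lborel. (K N x - \<phi> n x)\<^sup>2) < e / 4"
    by (auto simp: eventually_sequentially)
  have si\<phi>: "square_integrable lborel (\<phi> n)"
    by (rule square_integrable_compactly_supported_smooth[OF smooth zero])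
  have siK: "square_integrable lborel (K N)"
    unfolding square_integrable_real
    by (intro conjI Bochner_Integration.integrable_bound[OF ik]) (auto simp: K_def)
  note d1 = square_integrable_diff[OF k siK] and d2 = square_integrable_diff[OF siK si\<phi>]
  have "(LINT x|lborel. (k x - \<phi> n x)\<^sup>2) \<le> (LINT x|lborel. 2 * (k x - K N x)\<^sup>2 + 2 * (K N x - \<phi> n x)\<^sup>2)"
  proof (rule integral_mono)
    show "(k x - \<phi> n x)\<^sup>2 \<le> 2 * (k x - K N x)\<^sup>2 + 2 * (K N x - \<phi> n x)\<^sup>2" for x
      using sum_squares_bound[of "k x - K N x" "K N x - \<phi> n x"] power2_sum[of "k x - K N x" "K N x - \<phi> n x"]
      by simp
  qed (use d1 d2 square_integrable_diff[OF k si\<phi>] in \<open>auto simp: square_integrable_real\<close>)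
  also have "\<dots> < e"
    using n N d1 d2 by (simp add: square_integrable_real)
  finally show ?thesis
    using that[of "\<phi> n" "real N"] smooth zero si\<phi> by blast
qed

section \<open>Translations and difference quotients\<close>

lemma integral_Cauchy_Schwarz:
  fixes f g :: "'a \<Rightarrow> real"
  assumes f: "square_integrable M f" and g: "square_integrable M g"
  shows "\<bar>LINT x|M. f x * g x\<bar> \<le> sqrt (LINT x|M. (f x)\<^sup>2) * sqrt (LINT x|M. (g x)\<^sup>2)"
proof -
  define A P C where "A = (LINT x|M. (f x)\<^sup>2)" and "P = (LINT x|M. f x * g x)"
    and "C = (LINT x|M. (g x)\<^sup>2)"
  note int = square_integrable_mult[OF f g] f[unfolded square_integrable_real] g[unfolded square_integrable_real]
  have nonneg: "0 \<le> A - 2 * t * P + t\<^sup>2 * C" for t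
  proof -
    have "0 \<le> (LINT x|M. (f x - t * g x)\<^sup>2)"
      by simp
    also have "\<dots> = (LINT x|M. (f x)\<^sup>2 - 2 * t * (f x * g x) + t\<^sup>2 * (g x)\<^sup>2)"
      by (intro Bochner_Integration.integral_cong) (auto simp: power2_eq_square algebra_simps)
    also have "\<dots> = A - 2 * t * P + t\<^sup>2 * C"
      using int by (simp add: A_def P_def C_def)
    finally show ?thesis .
  qed
  have "0 \<le> A" "0 \<le> C"
    by (auto simp: A_def C_def)
  have "P\<^sup>2 \<le> A * C"
  proof (cases "C = 0")
    case True
    have "P = 0"
    proof (rule ccontr)
      assume "P \<noteq> 0"
      then show False
        using nonneg[of "(A + 1) / (2 * P)"] True by simp
    qed
    then show ?thesis using True by simp
  next
    case False
    then show ?thesis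
      using nonneg[of "P / C"] \<open>0 \<le> C\<close> by (simp add: field_simps power2_eq_square)
  qed
  then have "sqrt (P\<^sup>2) \<le> sqrt (A * C)"
    by (rule real_sqrt_le_mono)
  then show ?thesis
    by (simp add: A_def P_def C_def real_sqrt_mult)
qed

lemma integral_sq_add_le:
  fixes f g :: "'a \<Rightarrow> real"
  assumes f: "square_integrable M f" and g: "square_integrable M g"
  shows "(LINT x|M. (f x + g x)\<^sup>2) \<le> 2 * (LINT x|M. (f x)\<^sup>2) + 2 * (LINT x|M. (g x)\<^sup>2)"
proof -
  have "(LINT x|M. (f x + g x)\<^sup>2) \<le> (LINT x|M. 2 * (f x)\<^sup>2 + 2 * (g x)\<^sup>2)"
  proof (rule integral_mono)
    show "(f x + g x)\<^sup>2 \<le> 2 * (f x)\<^sup>2 + 2 * (g x)\<^sup>2" for x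
      using sum_squares_bound[of "f x" "g x"] power2_sum[of "f x" "g x"] by simp
  qed (use f g square_integrable_add[OF f g] in \<open>auto simp: square_integrable_real\<close>)
  then show ?thesis
    using f g by (simp add: square_integrable_real)
qed

text \<open>Translation is continuous in the square mean: this is clear for continuous functions of compact support,
  and translations are isometries, so it passes to the closure.\<close>

lemma integral_translation_tendsto:
  fixes k :: "real ^ 'n \<Rightarrow> real"
  assumes k: "square_integrable lborel k"
  shows "((\<lambda>c. LINT x|lborel. (k (x + c) - k x)\<^sup>2) \<longlongrightarrow> 0) (at 0)"
proof (rule order_tendstoI)
  fix e :: real assume "0 < e"
  then have "0 < e / 12" by simp
  then obtain \<phi> R where \<phi>: "elementary_smooth \<phi>" "\<And>x. R \<le> norm x \<Longrightarrow> \<phi> x = 0"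
    "square_integrable lborel \<phi>" "(LINT x|lborel. (k x - \<phi> x)\<^sup>2) < e / 12"
    using compactly_supported_smooth_dense[OF k] by blast
  obtain B where "0 \<le> B" and B: "\<And>x. \<bar>\<phi> x\<bar> \<le> B"
    using compactly_supported_bounded[OF \<phi>(1,2)] by metis
  note k\<phi> = square_integrable_diff[OF k \<phi>(3)]
  have [measurable]: "\<phi> \<in> borel_measurable borel" "k \<in> borel_measurable borel"
    using \<phi>(3) k by (auto simp: square_integrable_real)
  have "((\<lambda>c. LINT x|lborel. (\<phi> (x + c) - \<phi> x)\<^sup>2) \<longlongrightarrow> 0) (at 0)"
    unfolding tendsto_at_iff_sequentially comp_def
  proof (intro allI impI)
    fix c :: "nat \<Rightarrow> real ^ 'n"
    assume c: "c \<longlonglongrightarrow> 0"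
    then have "(\<lambda>n. norm (c n)) \<longlonglongrightarrow> 0"
      by (rule tendsto_norm_zero)
    then have "\<forall>\<^sub>F n in sequentially. norm (c n) < 1"
      by (rule order_tendstoD) simp
    then obtain N where N: "\<And>n. N \<le> n \<Longrightarrow> norm (c n) < 1"
      by (auto simp: eventually_sequentially)
    have "(\<lambda>n. LINT x|lborel. (\<phi> (x + c (n + N)) - \<phi> x)\<^sup>2) \<longlonglongrightarrow> (LINT x|(lborel :: (real ^ 'n) measure). (0 :: real))"
    proof (rule integral_dominated_convergence[where w="\<lambda>x :: real ^ 'n. (2 * B)\<^sup>2 * indicator (cball 0 (R + 1)) x"])
      show "AE x in lborel. (\<lambda>n. (\<phi> (x + c (n + N)) - \<phi> x)\<^sup>2) \<longlonglongrightarrow> 0"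
      proof (rule AE_I2)
        fix x
        have "(\<lambda>n. x + c (n + N)) \<longlonglongrightarrow> x + 0"
          by (intro tendsto_intros LIMSEQ_ignore_initial_segment c)
        then have "(\<lambda>n. \<phi> (x + c (n + N))) \<longlonglongrightarrow> \<phi> (x + 0)"
          by (rule continuous_on_tendsto_compose[OF elementary_smooth_continuous[OF \<phi>(1)]]) auto
        then have "(\<lambda>n. (\<phi> (x + c (n + N)) - \<phi> x)\<^sup>2) \<longlonglongrightarrow> (\<phi> (x + 0) - \<phi> x)\<^sup>2"
          by (intro tendsto_intros)
        then show "(\<lambda>n. (\<phi> (x + c (n + N)) - \<phi> x)\<^sup>2) \<longlonglongrightarrow> 0"
          by simp
      qed
      show "AE x in lborel. norm ((\<phi> (x + c (n + N)) - \<phi> x)\<^sup>2) \<le> (2 * B)\<^sup>2 * indicator (cball 0 (R + 1)) x" for n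
      proof (rule AE_I2)
        fix x
        show "norm ((\<phi> (x + c (n + N)) - \<phi> x)\<^sup>2) \<le> (2 * B)\<^sup>2 * indicator (cball 0 (R + 1)) x"
        proof (cases "norm x \<le> R + 1")
          case True
          have "\<bar>\<phi> (x + c (n + N)) - \<phi> x\<bar>\<^sup>2 \<le> (2 * B)\<^sup>2"
            using B[of "x + c (n + N)"] B[of x] by (intro power_mono) auto
          then show ?thesis
            using True by simp
        next
          case False
          then have "R \<le> norm (x + c (n + N))"
            using norm_triangle_ineq4[of "x + c (n + N)" "c (n + N)"] N[of "n + N"] by simp
          then show ?thesis
            using False \<phi>(2)[of x] \<phi>(2)[of "x + c (n + N)"] by simp
        qed
      qed
    qed (use integrable_cball_const in auto)
    then show "(\<lambda>n. LINT x|lborel. (\<phi> (x + c n) - \<phi> x)\<^sup>2) \<longlonglongrightarrow> 0"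
      by (simp add: LIMSEQ_offset)
  qed
  then have "\<forall>\<^sub>F c in at 0. (LINT x|lborel. (\<phi> (x + c) - \<phi> x)\<^sup>2) < e / 12"
    by (rule order_tendstoD) (use \<open>0 < e\<close> in simp)
  then show "\<forall>\<^sub>F c in at 0. (LINT x|lborel. (k (x + c) - k x)\<^sup>2) < e"
  proof eventually_elim
    fix c
    assume c: "(LINT x|lborel. (\<phi> (x + c) - \<phi> x)\<^sup>2) < e / 12"
    note 1 = square_integrable_shift[OF k\<phi>, of c]
    note 2 = square_integrable_diff[OF square_integrable_shift[OF \<phi>(3), of c] \<phi>(3)]
    note 3 = square_integrable_diff[OF \<phi>(3) k]
    have "(LINT x|lborel. (k (x + c) - k x)\<^sup>2)
        = (LINT x|lborel. ((k (x + c) - \<phi> (x + c)) + ((\<phi> (x + c) - \<phi> x) + (\<phi> x - k x)))\<^sup>2)"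
      by simp
    also have "\<dots> \<le> 2 * (LINT x|lborel. (k (x + c) - \<phi> (x + c))\<^sup>2)
        + 2 * (2 * (LINT x|lborel. (\<phi> (x + c) - \<phi> x)\<^sup>2) + 2 * (LINT x|lborel. (\<phi> x - k x)\<^sup>2))"
      using integral_sq_add_le[OF 1 square_integrable_add[OF 2 3]] integral_sq_add_le[OF 2 3] by simp
    also have "(LINT x|lborel. (k (x + c) - \<phi> (x + c))\<^sup>2) = (LINT x|lborel. (k x - \<phi> x)\<^sup>2)"
      by (rule integral_lborel_shift[of "\<lambda>x. (k x - \<phi> x)\<^sup>2"]) simp
    also have "(LINT x|lborel. (\<phi> x - k x)\<^sup>2) = (LINT x|lborel. (k x - \<phi> x)\<^sup>2)"
      by (simp add: power2_commute)
    finally have "(LINT x|lborel. (k (x + c) - k x)\<^sup>2)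
        \<le> 6 * (LINT x|lborel. (k x - \<phi> x)\<^sup>2) + 4 * (LINT x|lborel. (\<phi> (x + c) - \<phi> x)\<^sup>2)"
      by simp
    also have "\<dots> < 6 * (e / 12) + 4 * (e / 12)"
      using c \<phi>(4) by (intro add_strict_mono mult_strict_left_mono) auto
    also have "\<dots> < e"
      using \<open>0 < e\<close> by simp
    finally show "(LINT x|lborel. (k (x + c) - k x)\<^sup>2) < e" .
  qed
next
  fix a :: real assume "a < 0"
  then show "\<forall>\<^sub>F c in at 0. a < (LINT x|lborel. (k (x + c) - k x)\<^sup>2)"
    by (intro always_eventually allI) (simp add: less_le_trans)
qed

lemma elementary_smooth_shift:
  "elementary_smooth \<phi> \<Longrightarrow> elementary_smooth (\<lambda>x. \<phi> (x + c))"
  by (induction rule: elementary_smooth.induct) (auto intro: elementary_smooth.intros)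

lemma norm_axis: "norm (axis i t :: real ^ 'n) = \<bar>t\<bar>" for t :: real
proof -
  have "(axis i t :: real ^ 'n) = t *\<^sub>R axis i 1"
    by (simp add: vec_eq_iff axis_def)
  then show ?thesis by simp
qed

lemma axis_zero [simp]: "axis i (0 :: real) = 0"
  by (simp add: vec_eq_iff axis_def)

lemma DERIV_line:
  fixes \<phi> :: "real ^ 'n \<Rightarrow> real"
  assumes "elementary_smooth \<phi>"
  shows "((\<lambda>s. \<phi> (x + axis i s)) has_real_derivative partial_deriv i \<phi> (x + axis i s)) (at s)"
proof -
  obtain d where d: "(\<phi> has_derivative d) (at (x + axis i s))"
    using elementary_smooth_differentiable(1)[OF assms] by (auto simp: differentiable_def)
  have "(\<lambda>s. x + axis i s) = (\<lambda>s. x + s *\<^sub>R axis i 1)"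
    by (simp add: fun_eq_iff vec_eq_iff axis_def)
  moreover have "((\<lambda>s. x + s *\<^sub>R axis i 1) has_derivative (\<lambda>t. t *\<^sub>R axis i 1)) (at s)"
    by (auto intro!: derivative_eq_intros)
  ultimately have "((\<lambda>s. x + axis i s) has_derivative (\<lambda>t. t *\<^sub>R axis i 1)) (at s)"
    by simp
  from has_derivative_compose[OF this d]
  have "((\<lambda>s. \<phi> (x + axis i s)) has_derivative (\<lambda>t. d (t *\<^sub>R axis i 1))) (at s)" .
  moreover have "(\<lambda>t. d (t *\<^sub>R axis i 1)) = (*) (d (axis i 1))"
    using linear_cmul[OF has_derivative_linear[OF d]] by (simp add: fun_eq_iff)
  ultimately show ?thesis
    by (simp add: has_field_derivative_def partial_deriv_eq[OF d])
qed

lemma partial_deriv_shift: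
  assumes "elementary_smooth \<phi>"
  shows "partial_deriv i (\<lambda>x. \<phi> (x + c)) x = partial_deriv i \<phi> (x + c)"
proof -
  have "((\<lambda>s. \<phi> (x + c + axis i s)) has_real_derivative partial_deriv i (\<lambda>x. \<phi> (x + c)) x) (at 0)"
    using DERIV_line[OF elementary_smooth_shift[OF assms], of x i c 0] by (simp add: add_ac)
  then show ?thesis
    using DERIV_unique DERIV_line[OF assms, of "x + c" i 0] by fastforce
qed

lemma partial_deriv_zero_outside:
  assumes "elementary_smooth \<phi>" and zero: "\<And>x. R \<le> norm x \<Longrightarrow> \<phi> x = 0" and "R < norm x"
  shows "partial_deriv i \<phi> x = 0"
proof -
  have "((\<lambda>_. 0) has_derivative (\<lambda>_. 0)) (at x)"
    by simp
  moreover have "open {x :: real ^ 'b. R < norm x}"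
    by (intro open_Collect_less continuous_intros)
  ultimately have "(\<phi> has_derivative (\<lambda>_. 0)) (at x)"
    by (rule has_derivative_transform_within_open) (use assms in auto)
  then show ?thesis
    by (simp add: partial_deriv_eq)
qed

lemma DERIV_under_integral:
  fixes k k' :: "real \<Rightarrow> 'a \<Rightarrow> real"
  assumes deriv: "\<And>s x. ((\<lambda>s. k s x) has_real_derivative k' s x) (at s)"
    and int: "\<And>s. integrable M (k s)" and meas: "k' s \<in> borel_measurable M"
    and bound: "\<And>s x. \<bar>k' s x\<bar> \<le> b x" and b: "integrable M b"
  shows "((\<lambda>s. LINT x|M. k s x) has_real_derivative (LINT x|M. k' s x)) (at s)"
  unfolding has_field_derivative_iff tendsto_at_iff_sequentially comp_def
proof (intro allI impI)
  fix h :: "nat \<Rightarrow> real"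
  assume h0: "\<forall>n. h n \<in> UNIV - {s}" and h: "h \<longlonglongrightarrow> s"
  have "(\<lambda>n. LINT x|M. (k (h n) x - k s x) / (h n - s)) \<longlonglongrightarrow> (LINT x|M. k' s x)"
  proof (rule integral_dominated_convergence[where w=b])
    show "AE x in M. (\<lambda>n. (k (h n) x - k s x) / (h n - s)) \<longlonglongrightarrow> k' s x"
      using deriv[of _ s] h h0
      unfolding has_field_derivative_iff tendsto_at_iff_sequentially comp_def by auto
    show "AE x in M. norm ((k (h n) x - k s x) / (h n - s)) \<le> b x" for n
    proof (rule AE_I2)
      fix x
      have "\<bar>k (h n) x - k s x\<bar> \<le> b x * \<bar>h n - s\<bar>"
        using field_differentiable_bound[of UNIV "\<lambda>s. k s x" "\<lambda>s. k' s x" "b x" "h n" s] deriv bound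
        by (auto simp: has_field_derivative_at_within)
      then show "norm ((k (h n) x - k s x) / (h n - s)) \<le> b x"
        using h0 by (simp add: divide_le_eq)
    qed
  qed (use int meas b in auto)
  then show "(\<lambda>n. ((LINT x|M. k (h n) x) - (LINT x|M. k s x)) / (h n - s)) \<longlonglongrightarrow> (LINT x|M. k' s x)"
    using int by simp
qed

text \<open>Testing with elementary smooth functions determines the weak derivative, since they are dense in the square
  integrable functions, and the class is closed under translations and products.\<close>

definition weak_partial :: "'n \<Rightarrow> (real ^ 'n \<Rightarrow> real) \<Rightarrow> (real ^ 'n \<Rightarrow> real) \<Rightarrow> bool" where
  "weak_partial i g w \<longleftrightarrow> (\<forall>\<phi> R. elementary_smooth \<phi> \<longrightarrow> (\<forall>x. R \<le> norm x \<longrightarrow> \<phi> x = 0) \<longrightarrow>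
     (LINT x|lborel. g x * partial_deriv i \<phi> x) = - (LINT x|lborel. w x * \<phi> x))"

lemma indicator_power: "(indicator A x :: real)\<^sup>2 = indicator A x"
  by (simp add: indicator_def)

lemma square_integrable_compact_support_integrable:
  fixes g :: "real ^ 'n \<Rightarrow> real"
  assumes g: "square_integrable lborel g" and zero: "\<And>x. r \<le> norm x \<Longrightarrow> g x = 0"
  shows "integrable lborel g"
proof -
  have "square_integrable lborel (\<lambda>x :: real ^ 'n. indicator (cball 0 r) x :: real)"
    using integrable_cball_const[of 1 r]
    by (auto simp: square_integrable_real indicator_power)
  from square_integrable_mult[OF this g] show ?thesis
    by (rule Bochner_Integration.integrable_cong[THEN iffD1, rotated -1])
      (auto simp: indicator_def zero)
qed

text \<open>For a test function \<open>\<phi>\<close>, the function \<open>\<beta> s = \<integral>g(x) \<phi>(x - s e\<^sub>i)\<close> is differentiable with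
  derivative \<open>\<integral>w(x) \<phi>(x - s e\<^sub>i)\<close>, so the mean value theorem replaces the difference quotient of \<open>g\<close>, paired with
  \<open>\<phi>\<close>, by a translate of \<open>w\<close>. Taking \<open>\<phi>\<close> close to the error \<open>k\<close> bounds the norm of \<open>k\<close>.\<close>

lemma difference_quotient_le:
  fixes g w :: "real ^ 'n \<Rightarrow> real"
  assumes g: "square_integrable lborel g" and w: "square_integrable lborel w"
    and weak: "weak_partial i g w" and zero: "\<And>x. r \<le> norm x \<Longrightarrow> g x = 0"
    and "0 < h" and \<omega>: "\<And>s. 0 < s \<Longrightarrow> s < h \<Longrightarrow> (LINT x|lborel. (w (x + axis i s) - w x)\<^sup>2) \<le> \<omega>"
  shows "(LINT x|lborel. ((g (x + axis i h) - g x) / h - w x)\<^sup>2) \<le> \<omega>"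
proof (rule field_le_epsilon)
  fix e :: real assume "0 < e"
  define k where "k x = (g (x + axis i h) - g x) / h - w x" for x
  have g_int: "integrable lborel g"
    using square_integrable_compact_support_integrable[OF g zero] .
  have [measurable]: "g \<in> borel_measurable borel" "w \<in> borel_measurable borel"
    using g w by (auto simp: square_integrable_real)
  note dg = square_integrable_diff[OF square_integrable_shift[OF g, of "axis i h"] g]
  have k: "square_integrable lborel k"
    using square_integrable_diff[OF square_integrable_cmult[OF dg, of "1 / h"] w]
    by (simp add: k_def[abs_def])
  obtain \<phi> R where smooth: "elementary_smooth \<phi>" and \<phi>_zero: "\<And>x. R \<le> norm x \<Longrightarrow> \<phi> x = 0"
    and \<phi>: "square_integrable lborel \<phi>" and close: "(LINT x|lborel. (k x - \<phi> x)\<^sup>2) < e"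
    using compactly_supported_smooth_dense[OF k \<open>0 < e\<close>] by blast
  have [measurable]: "\<phi> \<in> borel_measurable borel"
    using \<phi> by (auto simp: square_integrable_real)
  let ?D = "partial_deriv i \<phi>"
  have D_smooth: "elementary_smooth ?D"
    by (rule elementary_smooth_differentiable(2)[OF smooth])
  have [measurable]: "?D \<in> borel_measurable borel"
    by (intro elementary_smooth_measurable D_smooth)
  have "?D x = 0" if "R + 1 \<le> norm x" for x
    using that by (intro partial_deriv_zero_outside[OF smooth \<phi>_zero]) auto
  then obtain B where "0 \<le> B" and B: "\<And>x. \<bar>?D x\<bar> \<le> B"
    using compactly_supported_bounded[OF D_smooth] by metis
  let ?\<beta> = "\<lambda>s. LINT x|lborel. g x * \<phi> (x + axis i (- s))"
  have \<beta>_deriv: "(?\<beta> has_real_derivative (LINT x|lborel. w x * \<phi> (x + axis i (- s)))) (at s)" for s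
  proof -
    have "(?\<beta> has_real_derivative (LINT x|lborel. g x * (- ?D (x + axis i (- s))))) (at s)"
    proof (rule DERIV_under_integral[where b="\<lambda>x. B * \<bar>g x\<bar>"])
      show "((\<lambda>s. g x * \<phi> (x + axis i (- s))) has_real_derivative g x * (- ?D (x + axis i (- s)))) (at s)" for s x
      proof (rule DERIV_cmult)
        have "((\<lambda>s :: real. - s) has_real_derivative - 1) (at s)"
          by (auto intro!: derivative_eq_intros)
        then show "((\<lambda>s. \<phi> (x + axis i (- s))) has_real_derivative - ?D (x + axis i (- s))) (at s)"
          using DERIV_chain2[OF DERIV_line[OF smooth], of "\<lambda>s. - s" "- 1" s UNIV x i] by simp
      qed
      show "integrable lborel (\<lambda>x. g x * \<phi> (x + axis i (- s)))" for s
        by (intro square_integrable_mult g square_integrable_shift \<phi>)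
      show "\<bar>g x * - ?D (x + axis i (- s))\<bar> \<le> B * \<bar>g x\<bar>" for s x
        using mult_left_mono[OF B[of "x + axis i (- s)"], of "\<bar>g x\<bar>"] by (simp add: abs_mult mult.commute)
    qed (use g_int in auto)
    moreover have "(LINT x|lborel. g x * ?D (x + axis i (- s))) = - (LINT x|lborel. w x * \<phi> (x + axis i (- s)))"
    proof -
      have "\<phi> (x + axis i (- s)) = 0" if "R + \<bar>s\<bar> \<le> norm x" for x
        using that norm_triangle_ineq4[of "x + axis i (- s)" "axis i (- s)"]
        by (intro \<phi>_zero) (simp add: norm_axis)
      then show ?thesis
        using weak[unfolded weak_partial_def, rule_format, OF elementary_smooth_shift[OF smooth], of "R + \<bar>s\<bar>" "axis i (- s)"]
        by (simp add: partial_deriv_shift[OF smooth])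
    qed
    ultimately show ?thesis by simp
  qed
  obtain s where s: "0 < s" "s < h" and \<beta>s: "?\<beta> h - ?\<beta> 0 = (h - 0) * (LINT x|lborel. w x * \<phi> (x + axis i (- s)))"
    using MVT2[OF \<open>0 < h\<close>, of ?\<beta> "\<lambda>s. LINT x|lborel. w x * \<phi> (x + axis i (- s))"] \<beta>_deriv by blast
  then have \<beta>s': "(LINT x|lborel. g x * \<phi> (x + axis i (- h))) - (LINT x|lborel. g x * \<phi> x)
      = h * (LINT x|lborel. w x * \<phi> (x + axis i (- s)))"
    by simp
  have inv: "axis i t + axis i (- t) = (0 :: real ^ 'n)" for t :: real
    by (simp add: vec_eq_iff axis_def)
  have move: "(LINT x|lborel. f (x + axis i t) * \<phi> x) = (LINT x|lborel. f x * \<phi> (x + axis i (- t)))"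
    if "f \<in> borel_measurable borel" for f :: "real ^ 'n \<Rightarrow> real" and t
    using integral_lborel_shift[of "\<lambda>x. f x * \<phi> (x + axis i (- t))" "axis i t"] that
    by (simp add: add.assoc inv)
  let ?d = "\<lambda>x. w (x + axis i s) - w x"
  have d: "square_integrable lborel ?d"
    by (intro square_integrable_diff square_integrable_shift w)
  note ints = square_integrable_mult[OF square_integrable_shift[OF g] \<phi>] square_integrable_mult[OF g \<phi>]
    square_integrable_mult[OF w \<phi>] square_integrable_mult[OF square_integrable_shift[OF w] \<phi>]
  have "(LINT x|lborel. k x * \<phi> x) = (LINT x|lborel. (g (x + axis i h) * \<phi> x - g x * \<phi> x) / h - w x * \<phi> x)"
    by (intro Bochner_Integration.integral_cong) (auto simp: k_def field_simps)
  also have "\<dots> = (?\<beta> h - ?\<beta> 0) / h - (LINT x|lborel. w x * \<phi> x)"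
    using ints by (simp add: move)
  also have "\<dots> = (LINT x|lborel. ?d x * \<phi> x)"
    using ints \<open>0 < h\<close> by (simp add: \<beta>s' move left_diff_distrib)
  finally have k\<phi>: "(LINT x|lborel. k x * \<phi> x) = (LINT x|lborel. ?d x * \<phi> x)" .
  note sq = square_integrable_diff[OF k \<phi>] square_integrable_diff[OF d \<phi>] k d \<phi>
  \<comment> \<open>expand \<open>(k - \<phi>)\<^sup>2\<close> to pass from the pairing with \<open>\<phi>\<close> to the norm of \<open>k\<close>\<close>
  have "(LINT x|lborel. (k x)\<^sup>2) - (LINT x|lborel. (k x - \<phi> x)\<^sup>2)
      = (LINT x|lborel. (k x)\<^sup>2 - (k x - \<phi> x)\<^sup>2)"
    using sq by (simp add: square_integrable_real)
  also have "\<dots> = (LINT x|lborel. 2 * (k x * \<phi> x) - (\<phi> x)\<^sup>2)"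
    by (intro Bochner_Integration.integral_cong) (auto simp: power2_eq_square algebra_simps)
  also have "\<dots> = (LINT x|lborel. 2 * (?d x * \<phi> x) - (\<phi> x)\<^sup>2)"
    using sq square_integrable_mult[OF k \<phi>] square_integrable_mult[OF d \<phi>] k\<phi>
    by (simp add: square_integrable_real)
  also have "\<dots> \<le> (LINT x|lborel. (?d x)\<^sup>2)"
  proof (rule integral_mono)
    show "2 * (?d x * \<phi> x) - (\<phi> x)\<^sup>2 \<le> (?d x)\<^sup>2" for x
      using sum_squares_bound[of "?d x" "\<phi> x"] by (simp only: mult.assoc diff_le_eq)
  qed (use sq square_integrable_mult[OF d \<phi>] in \<open>auto simp: square_integrable_real\<close>)
  also have "\<dots> \<le> \<omega>"
    by (rule \<omega>[OF s])
  finally have "(LINT x|lborel. (k x)\<^sup>2) \<le> \<omega> + e"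
    using close by simp
  then show "(LINT x|lborel. ((g (x + axis i h) - g x) / h - w x)\<^sup>2) \<le> \<omega> + e"
    by (simp add: k_def)
qed

lemma difference_quotient_tendsto:
  fixes g w :: "real ^ 'n \<Rightarrow> real"
  assumes "square_integrable lborel g" and w: "square_integrable lborel w"
    and "weak_partial i g w" and "\<And>x. r \<le> norm x \<Longrightarrow> g x = 0"
  shows "((\<lambda>h. LINT x|lborel. ((g (x + axis i h) - g x) / h - w x)\<^sup>2) \<longlongrightarrow> 0) (at_right 0)"
proof (rule order_tendstoI)
  fix e :: real assume "0 < e"
  then obtain d where "0 < d" and d: "\<And>c. c \<noteq> 0 \<Longrightarrow> norm c < d \<Longrightarrow>
      (LINT x|lborel. (w (x + c) - w x)\<^sup>2) < e / 2"
    using order_tendstoD(2)[OF integral_translation_tendsto[OF w], of "e / 2"]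
    by (auto simp: eventually_at dist_norm)
  show "\<forall>\<^sub>F h in at_right 0. (LINT x|lborel. ((g (x + axis i h) - g x) / h - w x)\<^sup>2) < e"
    unfolding eventually_at_right_field
  proof (intro exI[of _ d] conjI allI impI \<open>0 < d\<close>)
    fix h assume "0 < h" "h < d"
    have "(LINT x|lborel. ((g (x + axis i h) - g x) / h - w x)\<^sup>2) \<le> e / 2"
    proof (rule difference_quotient_le[OF assms \<open>0 < h\<close>])
      fix s assume "0 < s" "s < h"
      then show "(LINT x|lborel. (w (x + axis i s) - w x)\<^sup>2) \<le> e / 2"
        using d[of "axis i s"] \<open>h < d\<close> by (simp add: axis_eq_0_iff norm_axis)
    qed
    then show "(LINT x|lborel. ((g (x + axis i h) - g x) / h - w x)\<^sup>2) < e"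
      using \<open>0 < e\<close> by simp
  qed
next
  fix a :: real assume "a < 0"
  then show "\<forall>\<^sub>F h in at_right 0. a < (LINT x|lborel. ((g (x + axis i h) - g x) / h - w x)\<^sup>2)"
    by (intro always_eventually allI) (simp add: less_le_trans)
qed

section \<open>The product rule for squares\<close>

text \<open>The product rule for \<open>g\<^sup>2\<close>, in integrated form. Only the derivative of \<open>T\<close> along the i-th axis is involved,
  so that \<open>T\<close> may be a monotone rearrangement in one coordinate, which can fail to be differentiable in the others. The difference quotient is moved from \<open>T\<close> to \<open>g\<^sup>2\<close> by translation
  invariance, and there it factors as \<open>(g(x + h) - g(x)) / h \<cdot> (g(x + h) + g(x))\<close>.\<close>

lemma integral_sq_directional_derivative:
  fixes g w T T' :: "real ^ 'n \<Rightarrow> real"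
  assumes g: "square_integrable lborel g" and w: "square_integrable lborel w"
    and weak: "weak_partial i g w"
    and g_zero: "\<And>x. r \<le> norm x \<Longrightarrow> g x = 0" and w_zero: "\<And>x. r \<le> norm x \<Longrightarrow> w x = 0"
    and T_meas: "T \<in> borel_measurable borel" and T'_meas: "T' \<in> borel_measurable borel"
    and deriv: "\<And>x. ((\<lambda>s. T (x + axis i s)) has_real_derivative T' x) (at 0)"
    and T_bound: "\<And>x. norm x \<le> r + 1 \<Longrightarrow> \<bar>T x\<bar> \<le> B"
    and T'_bound: "\<And>x. norm x \<le> r + 1 \<Longrightarrow> \<bar>T' x\<bar> \<le> B"
  shows "(LINT x|lborel. (g x)\<^sup>2 * T' x) = - 2 * (LINT x|lborel. g x * w x * T x)"
proof -
  note [measurable] = T_meas T'_meas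
  have [measurable]: "g \<in> borel_measurable borel" "w \<in> borel_measurable borel"
    and g2: "integrable lborel (\<lambda>x. (g x)\<^sup>2)"
    using g w by (auto simp: square_integrable_real)
  define h where "h n = 1 / real (n + 2)" for n
  have h: "0 < h n" "h n < 1" for n
    by (auto simp: h_def)
  have h_lim: "filterlim h (at_right 0) sequentially"
  proof -
    have "h \<longlonglongrightarrow> 0"
      using LIMSEQ_ignore_initial_segment[OF lim_1_over_n, of 2] by (simp add: h_def[abs_def])
    then show ?thesis
      unfolding at_within_def using h by (auto simp: filterlim_inf filterlim_principal)
  qed
  \<comment> \<open>bounded everywhere and equal to \<open>T\<close> wherever a translate of \<open>g\<close> can be nonzero\<close>
  define T0 where "T0 x = indicator (cball 0 (r + 1)) x * T x" for x
  have [measurable]: "T0 \<in> borel_measurable borel"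
    unfolding T0_def[abs_def]
    by (intro borel_measurable_times borel_measurable_indicator T_meas) auto
  have T0_bound: "\<bar>T0 x\<bar> \<le> \<bar>B\<bar>" for x
    using T_bound[of x] by (auto simp: T0_def indicator_def)
  have inv: "axis i t + axis i (- t) = (0 :: real ^ 'n)" for t :: real
    by (simp add: vec_eq_iff axis_def)
  have deriv': "((\<lambda>s. T (x + axis i s)) has_real_derivative T' (x + axis i s)) (at s)" for x s
  proof -
    have eq: "axis i s + axis i (t - s) = (axis i t :: real ^ 'n)" for t
      by (simp add: vec_eq_iff axis_def)
    show ?thesis
      using DERIV_shift[of "\<lambda>t. T (x + axis i s + axis i (t - s))" "T' (x + axis i s)" 0 s] deriv[of "x + axis i s"]
      by (simp add: add.assoc eq)
  qed
  \<comment> \<open>\<open>(g(x + h)\<^sup>2 - g(x)\<^sup>2) / h = (w + d) p\<close> and \<open>p = 2g + e\<close>, where \<open>d\<close> and \<open>e\<close> tend to zero\<close>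
  define d where "d n x = (g (x + axis i (h n)) - g x) / h n - w x" for n x
  define e where "e n x = g (x + axis i (h n)) - g x" for n x
  define p where "p n x = g (x + axis i (h n)) + g x" for n x
  have e: "square_integrable lborel (e n)" and p: "square_integrable lborel (p n)" for n
    unfolding e_def[abs_def] p_def[abs_def]
    by (intro square_integrable_diff square_integrable_add square_integrable_shift g)+
  have d: "square_integrable lborel (d n)" for n
    using square_integrable_diff[OF square_integrable_cmult[OF e, of "1 / h n"] w]
    by (simp add: d_def[abs_def] e_def)
  have d_lim: "(\<lambda>n. LINT x|lborel. (d n x)\<^sup>2) \<longlonglongrightarrow> 0"
    using filterlim_compose[OF difference_quotient_tendsto[OF g w weak g_zero] h_lim]
    by (simp add: d_def)
  have "filterlim (\<lambda>n. axis i (h n) :: real ^ 'n) (at 0) sequentially"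
    unfolding filterlim_at
  proof
    show "\<forall>\<^sub>F n in sequentially. axis i (h n) \<in> UNIV \<and> axis i (h n) \<noteq> (0 :: real ^ 'n)"
      using h(1) by (auto simp: axis_eq_0_iff less_le)
    have "h \<longlonglongrightarrow> 0"
      using h_lim by (simp add: filterlim_at)
    then show "(\<lambda>n. axis i (h n) :: real ^ 'n) \<longlonglongrightarrow> 0"
      by (subst tendsto_norm_zero_iff[symmetric]) (simp add: norm_axis tendsto_rabs_zero)
  qed
  then have e_lim: "(\<lambda>n. LINT x|lborel. (e n x)\<^sup>2) \<longlonglongrightarrow> 0"
    using filterlim_compose[OF integral_translation_tendsto[OF g]] by (simp add: e_def)
  have T0w: "square_integrable lborel (\<lambda>x. T0 x * w x)" and T0p: "square_integrable lborel (\<lambda>x. T0 x * p n x)" for n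
    by (intro square_integrable_bounded_mult[where B="\<bar>B\<bar>"] w p T0_bound; simp)+
  let ?K = "B\<^sup>2 * (4 * (LINT x|lborel. (g x)\<^sup>2))"
  have p_norm: "(LINT x|lborel. (T0 x * p n x)\<^sup>2) \<le> ?K" for n
  proof -
    have "(LINT x|lborel. (T0 x * p n x)\<^sup>2) \<le> (LINT x|lborel. B\<^sup>2 * (p n x)\<^sup>2)"
    proof (rule integral_mono)
      show "(T0 x * p n x)\<^sup>2 \<le> B\<^sup>2 * (p n x)\<^sup>2" for x
        using power_mono[OF T0_bound[of x], of 2] by (auto simp: power_mult_distrib intro!: mult_right_mono)
    qed (use T0p[of n] p[of n] in \<open>auto simp: square_integrable_real\<close>)
    also have "\<dots> = B\<^sup>2 * (LINT x|lborel. (p n x)\<^sup>2)"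
      by simp
    also have "(LINT x|lborel. (p n x)\<^sup>2) \<le> 4 * (LINT x|lborel. (g x)\<^sup>2)"
      using integral_sq_add_le[OF square_integrable_shift[OF g] g, of "axis i (h n)"]
        integral_lborel_shift[of "\<lambda>x. (g x)\<^sup>2" "axis i (h n)"] by (simp add: p_def)
    finally show ?thesis
      by (simp add: mult_left_mono)
  qed
  have err: "(\<lambda>n. (LINT x|lborel. (T0 x * w x) * e n x) + (LINT x|lborel. (T0 x * p n x) * d n x)) \<longlonglongrightarrow> 0"
  proof (rule tendsto_add_zero)
    show "(\<lambda>n. LINT x|lborel. (T0 x * w x) * e n x) \<longlonglongrightarrow> 0"
    proof (rule Lim_null_comparison)
      show "\<forall>\<^sub>F n in sequentially. norm (LINT x|lborel. (T0 x * w x) * e n x)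
          \<le> sqrt (LINT x|lborel. (T0 x * w x)\<^sup>2) * sqrt (LINT x|lborel. (e n x)\<^sup>2)"
        using integral_Cauchy_Schwarz[OF T0w e] by simp
      show "(\<lambda>n. sqrt (LINT x|lborel. (T0 x * w x)\<^sup>2) * sqrt (LINT x|lborel. (e n x)\<^sup>2)) \<longlonglongrightarrow> 0"
        using tendsto_real_sqrt[OF e_lim] by (intro tendsto_mult_right_zero) simp
    qed
    show "(\<lambda>n. LINT x|lborel. (T0 x * p n x) * d n x) \<longlonglongrightarrow> 0"
    proof (rule Lim_null_comparison)
      show "\<forall>\<^sub>F n in sequentially. norm (LINT x|lborel. (T0 x * p n x) * d n x)
          \<le> sqrt ?K * sqrt (LINT x|lborel. (d n x)\<^sup>2)"
      proof (rule always_eventually, rule allI)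
        fix n
        have "norm (LINT x|lborel. (T0 x * p n x) * d n x)
            \<le> sqrt (LINT x|lborel. (T0 x * p n x)\<^sup>2) * sqrt (LINT x|lborel. (d n x)\<^sup>2)"
          using integral_Cauchy_Schwarz[OF T0p d] by simp
        also have "\<dots> \<le> sqrt ?K * sqrt (LINT x|lborel. (d n x)\<^sup>2)"
          by (intro mult_right_mono real_sqrt_le_mono p_norm) simp
        finally show "norm (LINT x|lborel. (T0 x * p n x) * d n x)
            \<le> sqrt ?K * sqrt (LINT x|lborel. (d n x)\<^sup>2)" .
      qed
      show "(\<lambda>n. sqrt ?K * sqrt (LINT x|lborel. (d n x)\<^sup>2)) \<longlonglongrightarrow> 0"
        using tendsto_real_sqrt[OF d_lim] by (intro tendsto_mult_right_zero) simp
    qed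
  qed
  have near: "norm (x + axis i (- s)) \<le> r + 1" if "norm x \<le> r" "0 \<le> s" "s \<le> 1" for x :: "real ^ 'n" and s
    using that norm_triangle_ineq[of x "axis i (- s)"] by (simp add: norm_axis)
  have int0: "integrable lborel (\<lambda>x. (g x)\<^sup>2 * T x)"
    and int1: "integrable lborel (\<lambda>x. (g x)\<^sup>2 * T (x + axis i (- h n)))" for n
  proof -
    have le: "\<bar>(g x)\<^sup>2 * T (x + axis i (- s))\<bar> \<le> \<bar>B\<bar> * (g x)\<^sup>2" if "0 \<le> s" "s \<le> 1" for s x
    proof (cases "norm x \<le> r")
      case True
      then show ?thesis
        using mult_left_mono[OF T_bound[OF near[OF True that]], of "(g x)\<^sup>2"]
        by (simp add: abs_mult) (smt (verit) mult.commute mult_left_mono zero_le_power2 abs_ge_self)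
    qed (simp add: g_zero)
    have "integrable lborel (\<lambda>x. (g x)\<^sup>2 * T (x + axis i (- s)))" if "0 \<le> s" "s \<le> 1" for s
      by (rule Bochner_Integration.integrable_bound[of _ "\<lambda>x. \<bar>B\<bar> * (g x)\<^sup>2"])
        (use g2 le[OF that] in auto)
    from this[of 0] this[of "h n"] show "integrable lborel (\<lambda>x. (g x)\<^sup>2 * T x)"
      "integrable lborel (\<lambda>x. (g x)\<^sup>2 * T (x + axis i (- h n)))"
      using h[of n] by auto
  qed
  let ?q = "\<lambda>n x. (T x - T (x + axis i (- h n))) / h n"
  have lim: "(\<lambda>n. LINT x|lborel. (g x)\<^sup>2 * ?q n x) \<longlonglongrightarrow> (LINT x|lborel. (g x)\<^sup>2 * T' x)"
  proof (rule integral_dominated_convergence[where w="\<lambda>x. \<bar>B\<bar> * (g x)\<^sup>2"])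
    show "AE x in lborel. (\<lambda>n. (g x)\<^sup>2 * ?q n x) \<longlonglongrightarrow> (g x)\<^sup>2 * T' x"
    proof (intro AE_I2 tendsto_mult tendsto_const)
      fix x
      have "((\<lambda>s. (T (x + axis i s) - T x) / s) \<longlongrightarrow> T' x) (at 0)"
        using deriv[of x] by (simp add: DERIV_def)
      moreover have "filterlim (\<lambda>n. - h n) (at 0) sequentially"
        using h(1) h_lim tendsto_minus[of h 0 sequentially] by (auto simp: filterlim_at less_le)
      ultimately have "(\<lambda>n. (T (x + axis i (- h n)) - T x) / (- h n)) \<longlonglongrightarrow> T' x"
        by (rule filterlim_compose)
      then show "(\<lambda>n. (T x - T (x + axis i (- h n))) / h n) \<longlonglongrightarrow> T' x"
        by (simp add: minus_divide_left[symmetric] diff_divide_distrib)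
    qed
    show "AE x in lborel. norm ((g x)\<^sup>2 * ?q n x) \<le> \<bar>B\<bar> * (g x)\<^sup>2" for n
    proof (rule AE_I2)
      fix x
      show "norm ((g x)\<^sup>2 * ?q n x) \<le> \<bar>B\<bar> * (g x)\<^sup>2"
      proof (cases "norm x \<le> r")
        case True
        obtain s where "- h n < s" "s < 0" and s: "T (x + axis i 0) - T (x + axis i (- h n)) = (0 - - h n) * T' (x + axis i s)"
          using MVT2[of "- h n" 0 "\<lambda>s. T (x + axis i s)" "\<lambda>s. T' (x + axis i s)"] deriv' h(1) by auto
        then have "norm (x + axis i s) \<le> r + 1"
          using near[OF True, of "- s"] h(2)[of n] by simp
        then have "\<bar>T' (x + axis i s)\<bar> \<le> \<bar>B\<bar>"
          using T'_bound by fastforce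
        moreover have "(T x - T (x + axis i (- h n))) / h n = T' (x + axis i s)"
          using s h(1)[of n] by simp
        ultimately show ?thesis
          using mult_left_mono[of "\<bar>T' (x + axis i s)\<bar>" "\<bar>B\<bar>" "(g x)\<^sup>2"]
          by (simp add: abs_mult mult.commute[of "\<bar>B\<bar>"])
      qed (simp add: g_zero)
    qed
  qed (use g2 in auto)
  have step: "(LINT x|lborel. (g x)\<^sup>2 * ?q n x)
      = - 2 * (LINT x|lborel. g x * w x * T x)
        - ((LINT x|lborel. (T0 x * w x) * e n x) + (LINT x|lborel. (T0 x * p n x) * d n x))" for n
  proof -
    have gs: "integrable lborel (\<lambda>x. (g (x + axis i (h n)))\<^sup>2 * T x)"
      using int1[of n] integrable_lborel_shift_iff[of "\<lambda>x. (g x)\<^sup>2 * T (x + axis i (- h n))" "axis i (h n)"]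
      by (simp add: add.assoc inv)
    have "(LINT x|lborel. (g x)\<^sup>2 * ?q n x)
        = ((LINT x|lborel. (g x)\<^sup>2 * T x) - (LINT x|lborel. (g x)\<^sup>2 * T (x + axis i (- h n)))) / h n"
      using int0 int1[of n] by (simp add: right_diff_distrib diff_divide_distrib)
    also have "(LINT x|lborel. (g x)\<^sup>2 * T (x + axis i (- h n))) = (LINT x|lborel. (g (x + axis i (h n)))\<^sup>2 * T x)"
      using integral_lborel_shift[of "\<lambda>x. (g x)\<^sup>2 * T (x + axis i (- h n))" "axis i (h n)"]
      by (simp add: add.assoc inv)
    also have "((LINT x|lborel. (g x)\<^sup>2 * T x) - (LINT x|lborel. (g (x + axis i (h n)))\<^sup>2 * T x)) / h n
        = (LINT x|lborel. ((g x)\<^sup>2 * T x - (g (x + axis i (h n)))\<^sup>2 * T x) / h n)"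
      using int0 gs by simp
    also have "\<dots> = (LINT x|lborel. - 2 * (g x * w x * T0 x) - ((T0 x * w x) * e n x + (T0 x * p n x) * d n x))"
    proof (intro Bochner_Integration.integral_cong refl)
      fix x
      show "((g x)\<^sup>2 * T x - (g (x + axis i (h n)))\<^sup>2 * T x) / h n
          = - 2 * (g x * w x * T0 x) - ((T0 x * w x) * e n x + (T0 x * p n x) * d n x)"
      proof (cases "norm x \<le> r + 1")
        case True
        then show ?thesis
          using h(1)[of n] by (simp add: T0_def p_def d_def e_def field_simps power2_eq_square)
      next
        case False
        then have "norm (x + axis i (h n)) \<ge> r"
          using norm_triangle_ineq4[of "x + axis i (h n)" "axis i (h n)"] h[of n] by (simp add: norm_axis)
        with False show ?thesis
          by (simp add: T0_def g_zero)
      qed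
    qed
    also have "\<dots> = - 2 * (LINT x|lborel. g x * w x * T0 x)
        - ((LINT x|lborel. (T0 x * w x) * e n x) + (LINT x|lborel. (T0 x * p n x) * d n x))"
    proof -
      have "integrable lborel (\<lambda>x. g x * w x * T0 x)"
        using square_integrable_mult[OF g T0w] by (simp add: mult_ac)
      then show ?thesis
        using square_integrable_mult[OF T0w e, of n] square_integrable_mult[OF T0p d, of n n] by simp
    qed
    also have "(LINT x|lborel. g x * w x * T0 x) = (LINT x|lborel. g x * w x * T x)"
      by (intro Bochner_Integration.integral_cong) (auto simp: T0_def g_zero indicator_def)
    finally show ?thesis .
  qed
  have "(\<lambda>n. LINT x|lborel. (g x)\<^sup>2 * ?q n x) \<longlonglongrightarrow> - 2 * (LINT x|lborel. g x * w x * T x) - 0"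
    unfolding step by (intro tendsto_diff tendsto_const err)
  with lim show ?thesis
    using LIMSEQ_unique by fastforce
qed

section \<open>Distribution functions on the line\<close>

text \<open>The one-dimensional factor of the Gauss density, a normal density of variance \<open>1 / (4\<pi>)\<close>.\<close>

definition gdens :: "real \<Rightarrow> real" where
  "gdens s = sqrt 2 * exp (- 2 * pi * s\<^sup>2)"

lemma gdens_pos [simp]: "0 < gdens s" and gdens_nonneg [simp]: "0 \<le> gdens s"
  by (simp_all add: gdens_def)

lemma gdens_le: "gdens s \<le> sqrt 2"
  by (simp add: gdens_def mult_le_cancel_left1)

lemma gdens_continuous: "continuous_on S gdens"
  unfolding gdens_def[abs_def] by (intro continuous_intros)

lemma gdens_measurable [measurable]: "gdens \<in> borel_measurable borel"
  by (intro borel_measurable_continuous_onI gdens_continuous)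

lemma gdens_eq_normal_density: "gdens = normal_density 0 (1 / (2 * sqrt pi))"
proof
  fix s
  have "2 * pi * (1 / (2 * sqrt pi))\<^sup>2 = 1 / 2"
    by (simp add: power_divide power_mult_distrib)
  moreover have "2 * (1 / (2 * sqrt pi))\<^sup>2 = 1 / (2 * pi)"
    by (simp add: power_divide power_mult_distrib)
  ultimately show "gdens s = normal_density 0 (1 / (2 * sqrt pi)) s"
    unfolding normal_density_def gdens_def by (simp only:) (simp add: real_sqrt_divide mult_ac)
qed

lemma gdens_integrable: "integrable lborel gdens"
  and gdens_integral: "(LINT s|lborel. gdens s) = 1"
  unfolding gdens_eq_normal_density by (simp_all add: integral_normal_density)

lemma gdens_second_moment: "has_bochner_integral lborel (\<lambda>s. gdens s * s\<^sup>2) (1 / (4 * pi))"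
  using normal_moment_even[of "1 / (2 * sqrt pi)" 0 1]
  by (simp add: gdens_eq_normal_density power_divide power_mult_distrib)

definition cum :: "(real \<Rightarrow> real) \<Rightarrow> real \<Rightarrow> real" where
  "cum k t = (LINT s|lborel. indicator {..t} s * k s)"

lemma integrable_indicator_mult:
  fixes k :: "real \<Rightarrow> real"
  assumes "integrable lborel k" "A \<in> sets borel"
  shows "integrable lborel (\<lambda>s. indicator A s * k s)"
  using integrable_mult_indicator[OF _ assms(1), of A] assms(2) by simp

lemma cum_diff:
  assumes k: "continuous_on UNIV k" "integrable lborel k" and "a \<le> t"
  shows "cum k t = cum k a + integral {a..t} k"
proof -
  have "set_integrable lborel {a..t} k"
    using integrable_indicator_mult[OF k(2), of "{a..t}"] by (simp add: set_integrable_def)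
  then have "integral {a..t} k = (LINT s|lborel. indicator {a..t} s * k s)"
    using set_borel_integral_eq_integral(2) by (fastforce simp: set_lebesgue_integral_def)
  also have "\<dots> = (LINT s|lborel. indicator {..t} s * k s - indicator {..a} s * k s)"
  proof (rule integral_cong_AE)
    show "AE s in lborel. indicator {a..t} s * k s = indicator {..t} s * k s - indicator {..a} s * k s"
      using AE_lborel_singleton[of a] by eventually_elim (use \<open>a \<le> t\<close> in \<open>auto simp: indicator_def\<close>)
  qed (use borel_measurable_continuous_onI[OF k(1)] in auto)
  also have "\<dots> = cum k t - cum k a"
    using k(2) by (simp add: cum_def integrable_indicator_mult)
  finally show ?thesis by simp
qed

lemma DERIV_cum:
  assumes k: "continuous_on UNIV k" "integrable lborel k"
  shows "(cum k has_real_derivative k t) (at t)"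
proof -
  have "((\<lambda>x. integral {t - 1..x} k) has_real_derivative k t) (at t within {t - 1..t + 1})"
    by (rule integral_has_real_derivative) (use k(1) continuous_on_subset in auto)
  then have "((\<lambda>x. cum k (t - 1) + integral {t - 1..x} k) has_real_derivative k t) (at t)"
    by (auto simp: at_within_Icc_at intro!: derivative_eq_intros)
  then show ?thesis
    by (rule DERIV_cong_ev[THEN iffD1, rotated -1])
      (auto simp: eventually_nhds intro!: exI[of _ "{t - 1<..}"] cum_diff[OF k, symmetric])
qed

lemma cum_at_top:
  "integrable lborel k \<Longrightarrow> (cum k \<longlongrightarrow> (LINT s|lborel. k s)) at_top"
  unfolding cum_def[abs_def] using tendsto_integral_at_top[of lborel k] by simp

lemma cum_at_bot:
  assumes k: "integrable lborel k"
  shows "(cum k \<longlongrightarrow> 0) at_bot"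
proof (rule tendsto_at_botI_sequentially)
  fix X :: "nat \<Rightarrow> real"
  assume X: "filterlim X at_bot sequentially"
  have [measurable]: "k \<in> borel_measurable borel"
    using k by auto
  have "(\<lambda>n. LINT s|lborel. indicator {..X n} s * k s) \<longlonglongrightarrow> (LINT s|(lborel :: real measure). 0 :: real)"
  proof (rule integral_dominated_convergence[where w="\<lambda>s. \<bar>k s\<bar>"])
    show "AE s in lborel. (\<lambda>n. indicator {..X n} s * k s) \<longlonglongrightarrow> 0"
    proof (intro AE_I2 tendsto_eventually)
      fix s
      have "\<forall>\<^sub>F n in sequentially. X n < s"
        using X by (simp add: filterlim_at_bot_dense)
      then show "\<forall>\<^sub>F n in sequentially. indicator {..X n} s * k s = 0"
        by eventually_elim simp
    qed
  qed (use k in \<open>auto simp: indicator_def\<close>)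
  then show "(\<lambda>n. cum k (X n)) \<longlonglongrightarrow> 0"
    by (simp add: cum_def)
qed

abbreviation gcdf :: "real \<Rightarrow> real" where
  "gcdf \<equiv> cum gdens"

lemmas DERIV_gcdf = DERIV_cum[OF gdens_continuous gdens_integrable]

lemma gcdf_strict_mono: "s < t \<Longrightarrow> gcdf s < gcdf t"
  by (rule DERIV_pos_imp_increasing) (use DERIV_gcdf gdens_pos in blast)+

lemma gcdf_mono: "s \<le> t \<Longrightarrow> gcdf s \<le> gcdf t"
  using gcdf_strict_mono[of s t] by (cases "s = t") auto

lemma gcdf_bounds: "0 < gcdf t" "gcdf t < 1"
proof -
  have "0 \<le> gcdf (t - 1)"
    by (intro tendsto_upperbound[OF cum_at_bot[OF gdens_integrable]])
      (auto simp: eventually_at_bot_linorder intro: gcdf_mono)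
  then show "0 < gcdf t"
    using gcdf_strict_mono[of "t - 1" t] by simp
  have "gcdf (t + 1) \<le> 1"
    by (intro tendsto_lowerbound[OF cum_at_top[OF gdens_integrable, unfolded gdens_integral]])
      (auto simp: eventually_at_top_linorder intro: gcdf_mono)
  then show "gcdf t < 1"
    using gcdf_strict_mono[of t "t + 1"] by simp
qed

lemma gcdf_surj:
  assumes "0 < p" "p < 1"
  obtains t where "gcdf t = p"
proof -
  obtain a where a: "gcdf a < p"
    using order_tendstoD(2)[OF cum_at_bot[OF gdens_integrable] \<open>0 < p\<close>] eventually_at_bot_linorder
    by (metis order_refl)
  obtain b where b: "p < gcdf b"
    using order_tendstoD(1)[OF cum_at_top[OF gdens_integrable, unfolded gdens_integral] \<open>p < 1\<close>]
      eventually_at_top_linorder by (metis order_refl)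
  have "a \<le> b"
    using a b gcdf_strict_mono[of b a] by linarith
  then show ?thesis
    using IVT[of gcdf a p b] a b that DERIV_isCont[OF DERIV_gcdf] by auto
qed

definition gquantile :: "real \<Rightarrow> real" where
  "gquantile p = (THE t. gcdf t = p)"

lemma gquantile_gcdf [simp]: "gquantile (gcdf t) = t"
  unfolding gquantile_def using gcdf_strict_mono by (intro the_equality) (metis linorder_neqE_linordered_idom less_irrefl)+

lemma gcdf_gquantile: "0 < p \<Longrightarrow> p < 1 \<Longrightarrow> gcdf (gquantile p) = p"
  by (metis gcdf_surj gquantile_gcdf)

lemma gquantile_mono:
  assumes "0 < p" "p \<le> q" "q < 1"
  shows "gquantile p \<le> gquantile q"
  using gcdf_strict_mono[of "gquantile q" "gquantile p"] assms
  by (simp add: gcdf_gquantile) (meson not_le)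

lemma DERIV_gquantile:
  assumes "0 < p" "p < 1"
  shows "(gquantile has_real_derivative inverse (gdens (gquantile p))) (at p)"
proof (rule DERIV_inverse_function[where a=0 and b=1])
  have "isCont gquantile (gcdf (gquantile p))"
    by (rule isCont_inverse_function[where d=1]) (auto intro: DERIV_isCont[OF DERIV_gcdf])
  then show "isCont gquantile p"
    using assms by (simp add: gcdf_gquantile)
qed (use assms gcdf_gquantile DERIV_gcdf gdens_pos[of "gquantile p"] in \<open>auto simp del: gdens_pos\<close>)

section \<open>The Gauss measure and averages over one coordinate\<close>

lemma measurable_vec_nth [measurable]: "(\<lambda>x :: 'a :: real_normed_vector ^ 'n. x $ i) \<in> borel_measurable borel"
  by (intro borel_measurable_continuous_onI continuous_intros)

definition gauss_density :: "real ^ 'n \<Rightarrow> real" where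
  "gauss_density x = 2 powr (real CARD('n) / 2) * exp (- 2 * pi * (norm x)\<^sup>2)"

lemma gauss_density_pos [simp]: "0 < gauss_density x" and gauss_density_nonneg [simp]: "0 \<le> gauss_density x"
  by (simp_all add: gauss_density_def)

lemma gauss_density_continuous: "continuous_on S gauss_density"
  unfolding gauss_density_def[abs_def] by (intro continuous_intros)

lemma gauss_density_measurable [measurable]: "gauss_density \<in> borel_measurable borel"
  by (intro borel_measurable_continuous_onI gauss_density_continuous)

lemma gauss_density_prod: "gauss_density (x :: real ^ 'n) = (\<Prod>j\<in>UNIV. gdens (x $ j))"
proof -
  have "(\<Prod>j\<in>(UNIV :: 'n set). sqrt 2) = (2 powr (1 / 2)) powr real CARD('n)"
    by (simp add: powr_half_sqrt powr_realpow)
  also have "\<dots> = 2 powr (real CARD('n) / 2)"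
    by (simp add: powr_powr)
  finally show ?thesis
    by (simp add: gauss_density_def gdens_def prod.distrib norm_sq_vec sum_distrib_left exp_sum
        flip: exp_sum)
qed

lemma gauss_eq: "gauss = density lborel (\<lambda>x. ennreal (gauss_density x))"
  by (simp add: gauss_def gauss_density_def)

lemma sets_gauss [measurable_cong, simp]: "sets gauss = sets borel"
  and space_gauss [simp]: "space gauss = UNIV"
  by (simp_all add: gauss_def)

lemma integral_gauss:
  fixes f :: "real ^ 'n \<Rightarrow> real"
  assumes "f \<in> borel_measurable borel"
  shows "(LINT x|gauss. f x) = (LINT x|lborel. gauss_density x * f x)"
  unfolding gauss_eq using assms by (subst integral_density) auto

lemma integrable_gauss:
  fixes f :: "real ^ 'n \<Rightarrow> real"
  assumes "f \<in> borel_measurable borel"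
  shows "integrable gauss f \<longleftrightarrow> integrable lborel (\<lambda>x. gauss_density x * f x)"
  unfolding gauss_eq using assms by (subst integrable_density) auto

definition gauss1 :: "real measure" where
  "gauss1 = density lborel (\<lambda>s. ennreal (gdens s))"

lemma sets_gauss1 [measurable_cong, simp]: "sets gauss1 = sets borel"
  by (simp add: gauss1_def)

lemma prob_space_gauss1: "prob_space gauss1"
  unfolding gauss1_def gdens_eq_normal_density by (rule prob_space_normal_density) simp

lemma integral_gauss1:
  fixes f :: "real \<Rightarrow> real"
  assumes "f \<in> borel_measurable borel"
  shows "(LINT s|gauss1. f s) = (LINT s|lborel. gdens s * f s)"
  unfolding gauss1_def using assms by (subst integral_density) auto

lemma nn_integral_gauss_prod:
  fixes f :: "'n :: finite \<Rightarrow> real \<Rightarrow> real"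
  assumes [measurable]: "\<And>j. f j \<in> borel_measurable borel" and nonneg: "\<And>j s. 0 \<le> f j s"
  shows "(\<integral>\<^sup>+x. ennreal (\<Prod>j\<in>UNIV. f j (x $ j)) \<partial>gauss) = (\<Prod>j\<in>UNIV. \<integral>\<^sup>+s. ennreal (f j s) \<partial>gauss1)"
proof -
  define idx where "idx b = (THE j. b = axis j (1 :: real))" for b :: "real ^ 'n"
  have idx: "idx (axis j 1) = j" for j
    unfolding idx_def by (rule the_equality) (auto simp: axis_eq_axis)
  have Basis: "(Basis :: (real ^ 'n) set) = (\<lambda>j. axis j 1) ` UNIV"
    by (auto simp: Basis_vec_def)
  have inj: "inj (\<lambda>j. axis j (1 :: real) :: real ^ 'n)"
    by (auto simp: inj_def axis_eq_axis)
  have [measurable]: "(\<lambda>x :: real ^ 'n. \<Prod>j\<in>UNIV. f j (x $ j)) \<in> borel_measurable borel"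
    by (intro borel_measurable_prod measurable_compose[OF _ assms(1)] borel_measurable_continuous_onI continuous_intros)
  have "(\<integral>\<^sup>+x. ennreal (\<Prod>j\<in>UNIV. f j (x $ j)) \<partial>gauss)
      = (\<integral>\<^sup>+x. ennreal (gauss_density x) * ennreal (\<Prod>j\<in>UNIV. f j (x $ j)) \<partial>lborel)"
    unfolding gauss_eq by (subst nn_integral_density) auto
  also have "\<dots> = (\<integral>\<^sup>+x. (\<Prod>b\<in>Basis. ennreal (gdens (x \<bullet> b) * f (idx b) (x \<bullet> b))) \<partial>(lborel :: (real ^ 'n) measure))"
  proof (rule nn_integral_cong)
    fix x :: "real ^ 'n"
    have "(\<Prod>b\<in>Basis. ennreal (gdens (x \<bullet> b) * f (idx b) (x \<bullet> b)))
        = (\<Prod>j\<in>UNIV. ennreal (gdens (x $ j) * f j (x $ j)))"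
      unfolding Basis by (subst prod.reindex[OF inj]) (simp add: idx inner_axis)
    also have "\<dots> = ennreal (gauss_density x) * ennreal (\<Prod>j\<in>UNIV. f j (x $ j))"
      by (simp add: gauss_density_prod prod_ennreal nonneg prod_nonneg prod.distrib ennreal_mult flip: ennreal_mult)
    finally show "ennreal (gauss_density x) * ennreal (\<Prod>j\<in>UNIV. f j (x $ j))
        = (\<Prod>b\<in>Basis. ennreal (gdens (x \<bullet> b) * f (idx b) (x \<bullet> b)))" by simp
  qed
  also have "\<dots> = (\<Prod>b\<in>(Basis :: (real ^ 'n) set). \<integral>\<^sup>+s. ennreal (gdens s * f (idx b) s) \<partial>lborel)"
    by (rule nn_integral_lborel_prod) (auto simp: nonneg)
  also have "\<dots> = (\<Prod>j\<in>UNIV. \<integral>\<^sup>+s. ennreal (gdens s * f j s) \<partial>lborel)"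
    unfolding Basis by (subst prod.reindex[OF inj]) (simp add: idx)
  also have "\<dots> = (\<Prod>j\<in>UNIV. \<integral>\<^sup>+s. ennreal (f j s) \<partial>gauss1)"
    unfolding gauss1_def by (intro prod.cong refl) (subst nn_integral_density; simp add: ennreal_mult nonneg)
  finally show ?thesis .
qed

lemma nn_integral_gauss1_1: "(\<integral>\<^sup>+s. 1 \<partial>gauss1) = 1"
  using prob_space.emeasure_space_1[OF prob_space_gauss1] by simp

lemma prob_space_gauss: "prob_space gauss"
proof
  show "emeasure gauss (space gauss) = 1"
    using nn_integral_gauss_prod[of "\<lambda>_ _. 1"] nn_integral_gauss1_1 by simp
qed

lemma gauss_coordinate_moment:
  "integrable gauss (\<lambda>x :: real ^ 'n. (x $ i)\<^sup>2)" "(LINT x|(gauss :: (real ^ 'n) measure). (x $ i)\<^sup>2) = 1 / (4 * pi)"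
proof -
  have "(\<integral>\<^sup>+x. ennreal ((x $ i)\<^sup>2) \<partial>(gauss :: (real ^ 'n) measure))
      = (\<integral>\<^sup>+x. ennreal (\<Prod>j\<in>UNIV. (if j = i then (x $ j)\<^sup>2 else 1)) \<partial>(gauss :: (real ^ 'n) measure))"
    by (simp add: prod.delta)
  also have "\<dots> = (\<Prod>j\<in>UNIV. \<integral>\<^sup>+s. ennreal (if j = i then s\<^sup>2 else 1) \<partial>gauss1)"
    by (rule nn_integral_gauss_prod) auto
  also have "\<dots> = (\<Prod>j\<in>UNIV. if j = i then \<integral>\<^sup>+s. ennreal (s\<^sup>2) \<partial>gauss1 else 1)"
    using nn_integral_gauss1_1 by (intro prod.cong) auto
  also have "\<dots> = (\<integral>\<^sup>+s. ennreal (s\<^sup>2) \<partial>gauss1)"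
    by (simp add: prod.delta)
  also have "\<dots> = (\<integral>\<^sup>+s. ennreal (gdens s * s\<^sup>2) \<partial>lborel)"
    unfolding gauss1_def by (subst nn_integral_density) (auto simp: ennreal_mult)
  also have "\<dots> = ennreal (1 / (4 * pi))"
    using gdens_second_moment by (subst nn_integral_eq_integral) (auto simp: has_bochner_integral_iff)
  finally have "has_bochner_integral gauss (\<lambda>x :: real ^ 'n. (x $ i)\<^sup>2) (1 / (4 * pi))"
    by (intro has_bochner_integral_nn_integral) auto
  then show "integrable gauss (\<lambda>x :: real ^ 'n. (x $ i)\<^sup>2)" "(LINT x|(gauss :: (real ^ 'n) measure). (x $ i)\<^sup>2) = 1 / (4 * pi)"
    by (auto simp: has_bochner_integral_iff)
qed

definition upd :: "'n \<Rightarrow> real ^ 'n \<Rightarrow> real \<Rightarrow> real ^ 'n" where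
  "upd i y s = (\<chi> j. if j = i then s else y $ j)"

lemma upd_nth [simp]: "upd i y s $ j = (if j = i then s else y $ j)"
  by (simp add: upd_def)

lemma upd_upd [simp]: "upd i (upd i y s) t = upd i y t"
  by (simp add: vec_eq_iff)

lemma upd_same [simp]: "upd i y (y $ i) = y"
  by (simp add: vec_eq_iff)

lemma upd_commute: "i \<noteq> j \<Longrightarrow> upd i (upd j y s) t = upd j (upd i y t) s"
  by (simp add: vec_eq_iff)

lemma upd_continuous: "continuous_on S (\<lambda>(y, s). upd i y s)"
  unfolding upd_def split_beta
proof (intro continuous_on_vec_lambda)
  show "continuous_on S (\<lambda>p. if j = i then snd p else fst p $ j)" for j
    by (cases "j = i") (auto intro!: continuous_intros)
qed

lemma upd_measurable [measurable]: "(\<lambda>(y, s). upd i y s) \<in> borel_measurable (borel \<Otimes>\<^sub>M borel)"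
  using borel_measurable_continuous_onI[OF upd_continuous] by (simp add: borel_prod)

text \<open>Replacing the i-th coordinate by an independent Gaussian variable preserves the Gauss measure, because it is a
  product measure. Comparing the two sides on boxes suffices.\<close>

lemma gauss_resample:
  "distr (gauss \<Otimes>\<^sub>M gauss1) borel (\<lambda>(y, s). upd i y s) = (gauss :: (real ^ 'n) measure)" (is "?D = _")
proof -
  interpret G: prob_space "gauss :: (real ^ 'n) measure" by (rule prob_space_gauss)
  interpret G1: prob_space gauss1 by (rule prob_space_gauss1)
  interpret P: pair_prob_space "gauss :: (real ^ 'n) measure" gauss1 ..
  have box: "emeasure (gauss :: (real ^ 'n) measure) (box a b)
      = (\<Prod>j\<in>UNIV. \<integral>\<^sup>+s. ennreal (indicator {a $ j<..<b $ j} s) \<partial>gauss1)" for a b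
  proof -
    have ind: "indicator (box a b) x = ennreal (\<Prod>j\<in>UNIV. indicator {a $ j<..<b $ j} (x $ j))" for x :: "real ^ 'n"
    proof (cases "x \<in> box a b")
      case True
      then show ?thesis by (simp add: mem_box_cart)
    next
      case False
      then obtain j where "x $ j \<notin> {a $ j<..<b $ j}"
        by (auto simp: mem_box_cart)
      then have zero: "(\<Prod>j\<in>UNIV. indicator {a $ j<..<b $ j} (x $ j) :: real) = 0"
        by (intro prod_zero bexI[of _ j]) auto
      show ?thesis
        unfolding zero using False by simp
    qed
    have "emeasure (gauss :: (real ^ 'n) measure) (box a b) = (\<integral>\<^sup>+x. indicator (box a b) x \<partial>gauss)"
      by (rule nn_integral_indicator[symmetric]) simp
    also have "\<dots> = (\<integral>\<^sup>+x. ennreal (\<Prod>j\<in>UNIV. indicator {a $ j<..<b $ j} (x $ j)) \<partial>gauss)"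
      unfolding ind ..
    also have "\<dots> = (\<Prod>j\<in>UNIV. \<integral>\<^sup>+s. ennreal (indicator {a $ j<..<b $ j} s) \<partial>gauss1)"
      by (rule nn_integral_gauss_prod) auto
    finally show ?thesis .
  qed
  have boxD: "emeasure ?D (box a b) = emeasure gauss (box a b)" for a b
  proof -
    let ?I = "\<lambda>j s. indicator {a $ j<..<b $ j} s :: real"
    have eq: "indicator (box a b) (upd i y s)
        = ennreal (?I i s) * ennreal (\<Prod>j\<in>UNIV. (if j = i then 1 else ?I j (y $ j)))" for y s
    proof (cases "upd i y s \<in> box a b")
      case True
      then have "s \<in> {a $ i<..<b $ i}" "\<And>j. j \<noteq> i \<Longrightarrow> y $ j \<in> {a $ j<..<b $ j}"
        by (auto simp: mem_box_cart split: if_splits)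
      with True show ?thesis by (simp add: cong: if_cong)
    next
      case False
      then obtain j where j: "upd i y s $ j \<notin> {a $ j<..<b $ j}"
        by (auto simp: mem_box_cart)
      show ?thesis
      proof (cases "j = i")
        case True
        with j False show ?thesis by simp
      next
        assume "j \<noteq> i"
        with j have zero: "(\<Prod>j\<in>UNIV. (if j = i then 1 else ?I j (y $ j))) = 0"
          by (intro prod_zero bexI[of _ j]) auto
        show ?thesis
          unfolding zero using False by simp
      qed
    qed
    have "emeasure ?D (box a b) = (\<integral>\<^sup>+x. indicator (box a b) x \<partial>?D)"
      by (rule nn_integral_indicator[symmetric]) simp
    also have "\<dots> = (\<integral>\<^sup>+z. indicator (box a b) (case z of (y, s) \<Rightarrow> upd i y s) \<partial>(gauss \<Otimes>\<^sub>M gauss1))"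
      by (rule nn_integral_distr) auto
    also have "\<dots> = (\<integral>\<^sup>+y. \<integral>\<^sup>+s. indicator (box a b) (upd i y s) \<partial>gauss1 \<partial>gauss)"
      by (subst G1.nn_integral_fst[symmetric]) auto
    also have "\<dots> = (\<integral>\<^sup>+y. (\<integral>\<^sup>+s. ennreal (?I i s) \<partial>gauss1)
        * ennreal (\<Prod>j\<in>UNIV. (if j = i then 1 else ?I j (y $ j))) \<partial>gauss)"
      unfolding eq by (intro nn_integral_cong nn_integral_multc) auto
    also have "\<dots> = (\<integral>\<^sup>+s. ennreal (?I i s) \<partial>gauss1)
        * (\<integral>\<^sup>+y. ennreal (\<Prod>j\<in>UNIV. (if j = i then 1 else ?I j (y $ j))) \<partial>(gauss :: (real ^ 'n) measure))"
      by (intro nn_integral_cmult) auto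
    also have "(\<integral>\<^sup>+y. ennreal (\<Prod>j\<in>UNIV. (if j = i then 1 else ?I j (y $ j))) \<partial>(gauss :: (real ^ 'n) measure))
        = (\<Prod>j\<in>UNIV. \<integral>\<^sup>+s. ennreal (if j = i then 1 else ?I j s) \<partial>gauss1)"
      by (rule nn_integral_gauss_prod) auto
    also have "\<dots> = (\<Prod>j\<in>UNIV - {i}. \<integral>\<^sup>+s. ennreal (?I j s) \<partial>gauss1)"
      by (subst prod.remove[of _ i]) (use nn_integral_gauss1_1 in \<open>auto intro!: prod.cong\<close>)
    also have "(\<integral>\<^sup>+s. ennreal (?I i s) \<partial>gauss1) * \<dots> = (\<Prod>j\<in>UNIV. \<integral>\<^sup>+s. ennreal (?I j s) \<partial>gauss1)"
      by (rule prod.remove[symmetric]) auto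
    finally show ?thesis
      by (simp add: box)
  qed
  let ?E = "range (\<lambda>(a, b). box a b :: (real ^ 'n) set)"
  show ?thesis
  proof (rule measure_eqI_generator_eq[where E="?E" and \<Omega>=UNIV and A="\<lambda>n. box (- (real n *\<^sub>R One)) (real n *\<^sub>R One)"])
    show "Int_stable ?E"
      by (auto simp: Int_stable_def box_Int_box)
    show "sets ?D = sigma_sets UNIV ?E" "sets (gauss :: (real ^ 'n) measure) = sigma_sets UNIV ?E"
      by (simp_all add: borel_eq_box)
    show "(\<Union>n::nat. box (- (real n *\<^sub>R One)) (real n *\<^sub>R One)) = (UNIV :: (real ^ 'n) set)"
      by (rule UN_box_eq_UNIV)
    show "emeasure ?D (box (- (real n *\<^sub>R One)) (real n *\<^sub>R One)) \<noteq> \<infinity>" for n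
      unfolding boxD by simp
  qed (auto simp: boxD)
qed

definition average :: "'n \<Rightarrow> (real ^ 'n \<Rightarrow> real) \<Rightarrow> real ^ 'n \<Rightarrow> real" where
  "average i h x = (LINT s|gauss1. h (upd i x s))"

lemma integral_average:
  fixes h :: "real ^ 'n \<Rightarrow> real"
  assumes [measurable]: "h \<in> borel_measurable borel" and bound: "\<And>x. \<bar>h x\<bar> \<le> B"
  shows "(LINT x|gauss. average i h x) = (LINT x|gauss. h x)"
proof -
  interpret G: prob_space "gauss :: (real ^ 'n) measure" by (rule prob_space_gauss)
  interpret G1: prob_space gauss1 by (rule prob_space_gauss1)
  interpret P: pair_prob_space "gauss :: (real ^ 'n) measure" gauss1 ..
  have "integrable (gauss \<Otimes>\<^sub>M gauss1) (\<lambda>(y, s). h (upd i y s))"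
    by (rule P.integrable_const_bound[where B=B]) (use bound in \<open>auto simp: split_beta\<close>)
  then have "(LINT x|gauss. average i h x) = (LINT z|(gauss \<Otimes>\<^sub>M gauss1). (\<lambda>(y, s). h (upd i y s)) z)"
    using P.integral_fst'[of "\<lambda>(y, s). h (upd i y s)"] by (simp add: average_def)
  also have "\<dots> = (LINT z|(gauss \<Otimes>\<^sub>M gauss1). h ((\<lambda>(y, s). upd i y s) z))"
    by (simp add: split_beta)
  also have "\<dots> = (LINT x|distr (gauss \<Otimes>\<^sub>M gauss1) borel (\<lambda>(y, s). upd i y s). h x)"
    by (rule integral_distr[symmetric]) auto
  finally show ?thesis
    by (simp add: gauss_resample)
qed

section \<open>Monotone transport in one coordinate\<close>

text \<open>On each line parallel to the i-th axis, \<open>T\<close> is the increasing map that takes the probability measure with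
  density \<open>r\<close> relative to the Gauss measure to the Gauss measure itself: \<open>gcdf (T x)\<close> is the mass that \<open>r\<close> puts on the part
  of the line up to \<open>x\<close>. Differentiating this relation gives \<open>T'\<close>, and its logarithm is the equation for \<open>ln r\<close>. Both
  tails have at least \<open>c\<close> times their Gaussian mass, so \<open>gcdf (T x)\<close> stays away from \<open>0\<close> and \<open>1\<close> locally uniformly, and
  \<open>T\<close> is locally bounded.\<close>

lemma conditional_transport:
  fixes r :: "real ^ 'n \<Rightarrow> real"
  assumes cont: "continuous_on UNIV r" and "0 < c" and c: "\<And>x. c \<le> r x" and C: "\<And>x. r x \<le> C"
    and avg: "\<And>x. average i r x = 1"
  obtains T T' where "T \<in> borel_measurable borel" "T' \<in> borel_measurable borel"
    "\<And>x. ((\<lambda>s. T (x + axis i s)) has_real_derivative T' x) (at 0)" "\<And>x. 0 < T' x"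
    "\<And>x. ln (r x) = 2 * pi * ((x $ i)\<^sup>2 - (T x)\<^sup>2) + ln (T' x)"
    "\<And>R. \<exists>B. \<forall>x. norm x \<le> R \<longrightarrow> \<bar>T x\<bar> \<le> B \<and> \<bar>T' x\<bar> \<le> B"
proof -
  have [measurable]: "r \<in> borel_measurable borel"
    by (intro borel_measurable_continuous_onI cont)
  define k where "k x s = gdens s * r (upd i x s)" for x s
  define \<Psi> where "\<Psi> x = cum (k x) (x $ i)" for x
  define T where "T x = gquantile (\<Psi> x)" for x
  define T' where "T' x = gdens (x $ i) * r x / gdens (T x)" for x
  have r_pos: "0 < r x" for x
    using \<open>0 < c\<close> c[of x] by simp
  have upd_cont: "continuous_on UNIV (\<lambda>s. upd i x s)" for x :: "real ^ 'n"
  proof -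
    have "continuous_on UNIV (\<lambda>s :: real. (x, s))"
      by (intro continuous_intros)
    then show ?thesis
      using continuous_on_compose2[OF upd_continuous[of UNIV i], of UNIV "\<lambda>s. (x, s)"] by simp
  qed
  have k_cont: "continuous_on UNIV (k x)" for x
    unfolding k_def by (intro continuous_intros gdens_continuous continuous_on_compose2[OF cont upd_cont]) auto
  have k_int: "integrable lborel (k x)" for x
  proof (rule Bochner_Integration.integrable_bound)
    show "integrable lborel (\<lambda>s. C * gdens s)"
      using gdens_integrable by simp
    show "k x \<in> borel_measurable lborel"
      using borel_measurable_continuous_onI[OF k_cont] by simp
    have "\<bar>k x s\<bar> \<le> \<bar>C * gdens s\<bar>" for s
      using r_pos[of "upd i x s"] C[of "upd i x s"] mult_left_mono[of "r (upd i x s)" C "gdens s"]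
      by (simp add: k_def abs_mult mult.commute[of C])
    then show "AE s in lborel. norm (k x s) \<le> norm (C * gdens s)"
      by simp
  qed
  have k_total: "(LINT s|lborel. k x s) = 1" for x
  proof -
    have "(\<lambda>s. r (upd i x s)) \<in> borel_measurable borel"
      by (intro borel_measurable_continuous_onI continuous_on_compose2[OF cont upd_cont]) auto
    then show ?thesis
      using avg[of x] by (simp add: average_def integral_gauss1 k_def)
  qed
  have k_ge: "c * gdens s \<le> k x s" for x s
    using c[of "upd i x s"] by (simp add: k_def mult.commute mult_left_mono)
  note int_diff = Bochner_Integration.integrable_diff[OF k_int integrable_mult_right[OF gdens_integrable, of c]]
  have split: "cum (k x) t = c * gcdf t + cum (\<lambda>s. k x s - c * gdens s) t" for x t
  proof -
    have "cum (\<lambda>s. k x s - c * gdens s) t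
        = (LINT s|lborel. indicator {..t} s * k x s - c * (indicator {..t} s * gdens s))"
      by (simp add: cum_def algebra_simps)
    also have "\<dots> = cum (k x) t - c * gcdf t"
      unfolding cum_def
      using integrable_indicator_mult[OF k_int] integrable_indicator_mult[OF gdens_integrable] by simp
    finally show ?thesis by simp
  qed
  have \<Psi>_lower: "c * gcdf t \<le> cum (k x) t" for x t
  proof -
    have "0 \<le> cum (\<lambda>s. k x s - c * gdens s) t"
      unfolding cum_def using k_ge by (intro integral_nonneg_AE) simp
    then show ?thesis by (simp add: split)
  qed
  have \<Psi>_upper: "cum (k x) t \<le> 1 - c * (1 - gcdf t)" for x t
  proof -
    have "cum (\<lambda>s. k x s - c * gdens s) t \<le> (LINT s|lborel. k x s - c * gdens s)"
      unfolding cum_def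
      by (intro integral_mono int_diff integrable_indicator_mult) (use k_ge in \<open>auto simp: indicator_def\<close>)
    also have "\<dots> = 1 - c"
      using k_int gdens_integrable by (simp add: k_total gdens_integral)
    finally show ?thesis by (simp add: split algebra_simps)
  qed
  have \<Psi>_bounds: "0 < cum (k x) t" "cum (k x) t < 1" for x t
  proof -
    show "0 < cum (k x) t"
      using \<Psi>_lower[of t x] gcdf_bounds(1)[of t] \<open>0 < c\<close> by (meson less_le_trans mult_pos_pos)
    show "cum (k x) t < 1"
      using \<Psi>_upper[of x t] gcdf_bounds(2)[of t] \<open>0 < c\<close>
        mult_pos_pos[of c "1 - gcdf t"] by linarith
  qed
  have \<Psi>_meas [measurable]: "\<Psi> \<in> borel_measurable borel"
  proof -
    have "(\<lambda>(x, s). if s \<le> x $ i then gdens s * r ((\<lambda>(x, s). upd i x s) (x, s)) else 0) \<in> borel_measurable (borel \<Otimes>\<^sub>M lborel)"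
      by measurable
    from lborel.borel_measurable_lebesgue_integral[OF this]
    have "(\<lambda>x. LINT s|lborel. (if s \<le> x $ i then gdens s * r (upd i x s) else 0)) \<in> borel_measurable borel"
      by simp
    also have "(\<lambda>x. LINT s|lborel. (if s \<le> x $ i then gdens s * r (upd i x s) else 0)) = \<Psi>"
      by (intro ext) (auto simp: \<Psi>_def cum_def k_def intro!: Bochner_Integration.integral_cong)
    finally show ?thesis .
  qed
  have gcdf_T: "gcdf (T x) = \<Psi> x" for x
    using \<Psi>_bounds by (simp add: T_def \<Psi>_def gcdf_gquantile)
  have T_meas [measurable]: "T \<in> borel_measurable borel"
  proof (subst borel_measurable_iff_le, intro allI)
    fix a
    have "T x \<le> a \<longleftrightarrow> \<Psi> x \<le> gcdf a" for x
      using gcdf_strict_mono[of "T x" a] gcdf_strict_mono[of a "T x"] unfolding gcdf_T[symmetric]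
      by (cases "T x" a rule: linorder_cases) auto
    then show "{x \<in> space borel. T x \<le> a} \<in> sets borel"
      by simp
  qed
  have T'_meas: "T' \<in> borel_measurable borel"
    unfolding T'_def[abs_def] by measurable
  have deriv: "((\<lambda>s. T (x + axis i s)) has_real_derivative T' x) (at 0)" for x
  proof -
    have "upd i (x + axis i s) = upd i x" for s
      by (simp add: fun_eq_iff vec_eq_iff axis_def)
    then have eq: "T (x + axis i s) = gquantile (cum (k x) (x $ i + s))" for s
      by (simp add: T_def \<Psi>_def k_def[abs_def] axis_def)
    have "((\<lambda>s. x $ i + s) has_real_derivative 1) (at 0)"
      by (auto intro!: derivative_eq_intros)
    then have "((\<lambda>s. cum (k x) (x $ i + s)) has_real_derivative k x (x $ i)) (at 0)"
      using DERIV_chain2[OF DERIV_cum[OF k_cont k_int], of "\<lambda>s. x $ i + s" 1 0 UNIV x] by simp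
    moreover have "(gquantile has_real_derivative inverse (gdens (T x))) (at (cum (k x) (x $ i + 0)))"
      using DERIV_gquantile[OF \<Psi>_bounds[of x "x $ i"]] by (simp add: T_def \<Psi>_def)
    ultimately have "((\<lambda>s. gquantile (cum (k x) (x $ i + s))) has_real_derivative inverse (gdens (T x)) * k x (x $ i)) (at 0)"
      by (rule DERIV_chain2[rotated])
    then show ?thesis
      by (simp add: eq T'_def k_def field_simps)
  qed
  have T'_pos: "0 < T' x" for x
    using r_pos by (simp add: T'_def)
  have log: "ln (r x) = 2 * pi * ((x $ i)\<^sup>2 - (T x)\<^sup>2) + ln (T' x)" for x
    using r_pos[of x] gdens_pos[of "x $ i"] gdens_pos[of "T x"]
    by (simp add: T'_def ln_mult ln_div gdens_def del: gdens_pos) (simp add: algebra_simps)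
  have local_bound: "\<exists>B. \<forall>x. norm x \<le> R \<longrightarrow> \<bar>T x\<bar> \<le> B \<and> \<bar>T' x\<bar> \<le> B" for R
  proof -
    define a b where "a = gquantile (c * gcdf (- R))" and "b = gquantile (1 - c * (1 - gcdf R))"
    have c1: "c \<le> 1"
    proof -
      have "c * (LINT s|lborel. gdens s) \<le> (LINT s|lborel. k 0 s)"
        unfolding integral_mult_right_zero[symmetric]
        by (intro integral_mono k_ge k_int integrable_mult_right gdens_integrable)
      then show ?thesis by (simp add: gdens_integral k_total)
    qed
    have T: "\<bar>T x\<bar> \<le> \<bar>a\<bar> + \<bar>b\<bar>" if "norm x \<le> R" for x
    proof -
      have "\<bar>x $ i\<bar> \<le> R"
        using component_le_norm_cart[of x i] that by simp
      then have "gcdf (- R) \<le> gcdf (x $ i)" "gcdf (x $ i) \<le> gcdf R"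
        by (auto intro: gcdf_mono)
      then have "c * gcdf (- R) \<le> c * gcdf (x $ i)" "c * (1 - gcdf R) \<le> c * (1 - gcdf (x $ i))"
        using \<open>0 < c\<close> by simp_all
      then have 1: "c * gcdf (- R) \<le> \<Psi> x" and 2: "\<Psi> x \<le> 1 - c * (1 - gcdf R)"
        using \<Psi>_lower[of "x $ i" x] \<Psi>_upper[of x "x $ i"] by (auto simp: \<Psi>_def)
      have "a \<le> T x"
        unfolding a_def T_def
        using \<open>0 < c\<close> gcdf_bounds[of "- R"] \<Psi>_bounds[of x "x $ i"] by (intro gquantile_mono 1) (auto simp: \<Psi>_def)
      moreover have "T x \<le> b"
        unfolding b_def T_def
        using \<open>0 < c\<close> gcdf_bounds[of R] \<Psi>_bounds[of x "x $ i"] by (intro gquantile_mono 2) (auto simp: \<Psi>_def)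
      ultimately show ?thesis by linarith
    qed
    have T': "\<bar>T' x\<bar> \<le> sqrt 2 * C / gdens (\<bar>a\<bar> + \<bar>b\<bar>)" if "norm x \<le> R" for x
    proof -
      have "(T x)\<^sup>2 \<le> (\<bar>a\<bar> + \<bar>b\<bar>)\<^sup>2"
        using power_mono[OF T[OF that], of 2] by simp
      then have "gdens (\<bar>a\<bar> + \<bar>b\<bar>) \<le> gdens (T x)"
        unfolding gdens_def by (intro mult_left_mono) (auto simp: mult_left_mono)
      then have "gdens (x $ i) * r x / gdens (T x) \<le> sqrt 2 * C / gdens (\<bar>a\<bar> + \<bar>b\<bar>)"
        using r_pos[of x] C[of x] gdens_le by (intro frac_le mult_mono) (auto simp: less_imp_le)
      then show ?thesis
        using T'_pos[of x] by (simp add: T'_def)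
    qed
    show ?thesis
      using T T' by (intro exI[of _ "max (\<bar>a\<bar> + \<bar>b\<bar>) (sqrt 2 * C / gdens (\<bar>a\<bar> + \<bar>b\<bar>))"]) (auto simp: le_max_iff_disj)
  qed
  show ?thesis
    by (rule that[OF T_meas T'_meas deriv T'_pos log local_bound])
qed

section \<open>Localization of weak derivatives\<close>

lemma elementary_smooth_total_derivative:
  assumes "elementary_smooth f"
  shows "(f has_derivative frechet_derivative f (at x)) (at x)"
  using elementary_smooth_differentiable(1)[OF assms] by (simp add: frechet_derivative_works)

lemma partial_deriv_mult:
  assumes "elementary_smooth f" "elementary_smooth g"
  shows "partial_deriv i (\<lambda>x. f x * g x) x = f x * partial_deriv i g x + partial_deriv i f x * g x"
  using partial_deriv_eq[OF has_derivative_mult[OF elementary_smooth_total_derivative[OF assms(1), of x]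
      elementary_smooth_total_derivative[OF assms(2), of x]], of i]
  by (simp add: partial_deriv_def)

lemma norm_sq_has_derivative:
  "((\<lambda>x :: real ^ 'n. (norm x)\<^sup>2) has_derivative (\<lambda>v. 2 * (x \<bullet> v))) (at x)"
  unfolding power2_norm_eq_inner by (auto intro!: derivative_eq_intros simp: inner_commute)

text \<open>Multiplying by the square root of the density turns square integrability with respect to the Gauss measure into
  square integrability with respect to Lebesgue measure.\<close>

definition root_gauss :: "real ^ 'n \<Rightarrow> real" where
  "root_gauss x = 2 powr (real CARD('n) / 4) * exp (- pi * (norm x)\<^sup>2)"

lemma root_gauss_pos [simp]: "0 < root_gauss x"
  by (simp add: root_gauss_def)

lemma root_gauss_sq: "(root_gauss x)\<^sup>2 = gauss_density x"
proof -
  have "(2 powr (real CARD('a) / 4))\<^sup>2 = 2 powr (real CARD('a) / 2)"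
    by (simp add: power2_eq_square flip: powr_add)
  moreover have "(exp (- pi * (norm x)\<^sup>2))\<^sup>2 = exp (- 2 * pi * (norm x)\<^sup>2)"
    by (simp add: power2_eq_square flip: exp_add)
  ultimately show ?thesis
    by (simp add: root_gauss_def gauss_density_def power_mult_distrib)
qed

lemma elementary_smooth_root_gauss: "elementary_smooth root_gauss"
  unfolding root_gauss_def[abs_def]
  by (intro elementary_smooth.mult elementary_smooth.exp elementary_smooth.const elementary_smooth_norm_sq)

lemma partial_deriv_root_gauss: "partial_deriv i root_gauss x = - 2 * pi * x $ i * root_gauss x"
proof -
  have "(root_gauss has_derivative (\<lambda>v. - 2 * pi * (x \<bullet> v) * root_gauss x)) (at x)"
    unfolding root_gauss_def[abs_def]
    by (auto intro!: derivative_eq_intros norm_sq_has_derivative)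
  from partial_deriv_eq[OF this, of i] show ?thesis
    by (simp add: inner_axis)
qed

lemma square_integrable_localize:
  fixes u \<psi> :: "real ^ 'n \<Rightarrow> real"
  assumes u: "square_integrable gauss u"
    and smooth: "elementary_smooth \<psi>" and zero: "\<And>x. R \<le> norm x \<Longrightarrow> \<psi> x = 0"
  shows "square_integrable lborel (\<lambda>x. u x * \<psi> x)"
proof -
  have [measurable]: "u \<in> borel_measurable borel" and u2: "integrable lborel (\<lambda>x. gauss_density x * (u x)\<^sup>2)"
    using u by (auto simp: square_integrable_real integrable_gauss)
  have [measurable]: "\<psi> \<in> borel_measurable borel"
    by (intro elementary_smooth_measurable smooth)
  define q where "q x = exp (pi * (norm x)\<^sup>2) * \<psi> x" for x
  have "elementary_smooth q"
    unfolding q_def[abs_def]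
    by (intro elementary_smooth.mult elementary_smooth.exp elementary_smooth.const elementary_smooth_norm_sq smooth)
  moreover have "q x = 0" if "R \<le> norm x" for x
    using zero[OF that] by (simp add: q_def)
  ultimately obtain B where "0 \<le> B" and B: "\<And>x. \<bar>q x\<bar> \<le> B"
    using compactly_supported_bounded by metis
  have le: "(u x * \<psi> x)\<^sup>2 \<le> B\<^sup>2 * (gauss_density x * (u x)\<^sup>2)" for x
  proof -
    have "\<psi> x = exp (- pi * (norm x)\<^sup>2) * q x"
      by (simp add: q_def flip: exp_add mult.assoc)
    moreover have "exp (- pi * (norm x)\<^sup>2) \<le> root_gauss x"
      unfolding root_gauss_def by (simp add: ge_one_powr_ge_zero)
    ultimately have "\<bar>\<psi> x\<bar> \<le> root_gauss x * B"
      using mult_mono[OF _ B[of x], of "exp (- pi * (norm x)\<^sup>2)" "root_gauss x"]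
      by (simp add: abs_mult less_imp_le)
    then have "(\<psi> x)\<^sup>2 \<le> (root_gauss x * B)\<^sup>2"
      by (metis abs_le_square_iff abs_of_nonneg abs_ge_zero order_trans)
    then show ?thesis
      using mult_left_mono[of "(\<psi> x)\<^sup>2" "(root_gauss x * B)\<^sup>2" "(u x)\<^sup>2"]
      by (simp add: power_mult_distrib root_gauss_sq mult_ac)
  qed
  show ?thesis
    unfolding square_integrable_real
    by (intro conjI Bochner_Integration.integrable_bound[OF integrable_mult_right[OF u2, of "B\<^sup>2"]])
      (use le in auto)
qed

lemma weak_partial_localize:
  fixes u v \<sigma> :: "real ^ 'n \<Rightarrow> real"
  assumes u: "square_integrable gauss u" and v: "square_integrable gauss v" and weak: "weak_partial i u v"
    and \<sigma>: "elementary_smooth \<sigma>" and zero: "\<And>x. R \<le> norm x \<Longrightarrow> \<sigma> x = 0"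
  shows "weak_partial i (\<lambda>x. u x * \<sigma> x) (\<lambda>x. v x * \<sigma> x + u x * partial_deriv i \<sigma> x)"
  unfolding weak_partial_def
proof (intro allI impI)
  fix \<phi> :: "real ^ 'n \<Rightarrow> real" and S
  assume \<phi>: "elementary_smooth \<phi>" and \<phi>_zero: "\<forall>x. S \<le> norm x \<longrightarrow> \<phi> x = 0"
  have \<phi>2: "square_integrable lborel \<phi>"
    using square_integrable_compactly_supported_smooth[OF \<phi>] \<phi>_zero by blast
  have d\<sigma>: "partial_deriv i \<sigma> x = 0" if "R + 1 \<le> norm x" for x
    using that by (intro partial_deriv_zero_outside[OF \<sigma> zero]) auto
  have d\<phi>: "partial_deriv i \<phi> x = 0" if "S + 1 \<le> norm x" for x
    using that \<phi>_zero by (intro partial_deriv_zero_outside[OF \<phi>, of S]) auto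
  have d\<phi>2: "square_integrable lborel (partial_deriv i \<phi>)"
    using square_integrable_compactly_supported_smooth[OF elementary_smooth_differentiable(2)[OF \<phi>] d\<phi>] .
  note int1 = square_integrable_mult[OF square_integrable_localize[OF u \<sigma> zero] d\<phi>2]
  note int2 = square_integrable_mult[OF
      square_integrable_localize[OF u elementary_smooth_differentiable(2)[OF \<sigma>] d\<sigma>] \<phi>2]
  note int3 = square_integrable_mult[OF square_integrable_localize[OF v \<sigma> zero] \<phi>2]
  have "(LINT x|lborel. u x * partial_deriv i (\<lambda>x. \<sigma> x * \<phi> x) x) = - (LINT x|lborel. v x * (\<sigma> x * \<phi> x))"
    using weak[unfolded weak_partial_def, rule_format, OF elementary_smooth.mult[OF \<sigma> \<phi>], of R] zero by simp
  also have "(LINT x|lborel. u x * partial_deriv i (\<lambda>x. \<sigma> x * \<phi> x) x)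
      = (LINT x|lborel. u x * \<sigma> x * partial_deriv i \<phi> x + u x * partial_deriv i \<sigma> x * \<phi> x)"
    unfolding partial_deriv_mult[OF \<sigma> \<phi>] by (simp add: algebra_simps)
  also have "\<dots> = (LINT x|lborel. u x * \<sigma> x * partial_deriv i \<phi> x) + (LINT x|lborel. u x * partial_deriv i \<sigma> x * \<phi> x)"
    using int1 int2 by simp
  finally have "(LINT x|lborel. u x * \<sigma> x * partial_deriv i \<phi> x)
      = - ((LINT x|lborel. v x * \<sigma> x * \<phi> x) + (LINT x|lborel. u x * partial_deriv i \<sigma> x * \<phi> x))"
    by (simp add: mult.assoc)
  also have "\<dots> = - (LINT x|lborel. v x * \<sigma> x * \<phi> x + u x * partial_deriv i \<sigma> x * \<phi> x)"
    using int2 int3 by simp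
  finally show "(LINT x|lborel. u x * \<sigma> x * partial_deriv i \<phi> x)
      = - (LINT x|lborel. (v x * \<sigma> x + u x * partial_deriv i \<sigma> x) * \<phi> x)"
    by (simp add: algebra_simps)
qed

text \<open>The product rule for \<open>g = u \<eta> \<surd>\<gamma>\<close>, rewritten against the Gauss measure. The function \<open>p\<close> is the weak
  derivative of \<open>g\<close> divided by \<open>\<surd>\<gamma>\<close>. Its last term comes from the derivative of \<open>\<surd>\<gamma>\<close>.\<close>

lemma gauss_parts:
  fixes u v \<eta> T T' :: "real ^ 'n \<Rightarrow> real"
  assumes u: "square_integrable gauss u" and v: "square_integrable gauss v" and weak: "weak_partial i u v"
    and \<eta>: "elementary_smooth \<eta>" and zero: "\<forall>x. R \<le> norm x \<longrightarrow> \<eta> x = 0"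
    and T: "T \<in> borel_measurable borel" and T': "T' \<in> borel_measurable borel"
    and deriv: "\<And>x. ((\<lambda>s. T (x + axis i s)) has_real_derivative T' x) (at 0)"
    and bound: "\<And>R. \<exists>B. \<forall>x. norm x \<le> R \<longrightarrow> \<bar>T x\<bar> \<le> B \<and> \<bar>T' x\<bar> \<le> B"
  defines "p \<equiv> \<lambda>x. v x * \<eta> x + u x * partial_deriv i \<eta> x - 2 * pi * x $ i * (u x * \<eta> x)"
  shows "(LINT x|gauss. (u x * \<eta> x)\<^sup>2 * T' x) = - 2 * (LINT x|gauss. u x * \<eta> x * p x * T x)" (is ?eq)
    and "integrable gauss (\<lambda>x. (u x * \<eta> x)\<^sup>2)" (is ?i1)
    and "integrable gauss (\<lambda>x. (u x * \<eta> x)\<^sup>2 * T' x)" (is ?i2)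
    and "integrable gauss (\<lambda>x. u x * \<eta> x * p x * T x)" (is ?i3)
    and "integrable gauss (\<lambda>x. (p x)\<^sup>2)" (is ?i4)
    and "integrable gauss (\<lambda>x. (u x * \<eta> x * T x)\<^sup>2)" (is ?i5)
    and "p \<in> borel_measurable borel" (is ?m)
proof -
  note [measurable] = T T'
  have [measurable]: "u \<in> borel_measurable borel" "v \<in> borel_measurable borel"
    using u v by (auto simp: square_integrable_real)
  note d\<eta> = elementary_smooth_differentiable(2)[OF \<eta>]
  have [measurable]: "\<eta> \<in> borel_measurable borel" "partial_deriv i \<eta> \<in> borel_measurable borel"
    by (intro elementary_smooth_measurable \<eta> d\<eta>)+
  show p [measurable]: ?m
    unfolding p_def by measurable
  define \<sigma> where "\<sigma> x = \<eta> x * root_gauss x" for x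
  have \<sigma>: "elementary_smooth \<sigma>" and \<sigma>_zero: "\<And>x. R \<le> norm x \<Longrightarrow> \<sigma> x = 0"
    unfolding \<sigma>_def[abs_def] using zero by (auto intro: elementary_smooth.mult \<eta> elementary_smooth_root_gauss)
  have d\<sigma>: "partial_deriv i \<sigma> x = root_gauss x * (partial_deriv i \<eta> x - 2 * pi * x $ i * \<eta> x)" for x
    unfolding \<sigma>_def[abs_def] partial_deriv_mult[OF \<eta> elementary_smooth_root_gauss] partial_deriv_root_gauss
    by (simp add: algebra_simps)
  have d\<sigma>_zero: "partial_deriv i \<sigma> x = 0" if "R + 1 \<le> norm x" for x
    using that by (intro partial_deriv_zero_outside[OF \<sigma> \<sigma>_zero]) auto
  define g where "g x = u x * \<sigma> x" for x
  define w where "w x = v x * \<sigma> x + u x * partial_deriv i \<sigma> x" for x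
  have g: "square_integrable lborel g"
    unfolding g_def[abs_def] by (rule square_integrable_localize[OF u \<sigma> \<sigma>_zero])
  have w: "square_integrable lborel w"
    unfolding w_def[abs_def]
    by (intro square_integrable_add square_integrable_localize[OF v \<sigma> \<sigma>_zero]
        square_integrable_localize[OF u elementary_smooth_differentiable(2)[OF \<sigma>] d\<sigma>_zero])
  have gw: "weak_partial i g w"
    unfolding g_def[abs_def] w_def[abs_def] by (rule weak_partial_localize[OF u v weak \<sigma> \<sigma>_zero])
  have g_eq: "g x = root_gauss x * (u x * \<eta> x)" and w_eq: "w x = root_gauss x * p x" for x
    by (simp_all add: g_def w_def \<sigma>_def d\<sigma> p_def algebra_simps)
  have g_zero: "g x = 0" and w_zero: "w x = 0" if "R + 1 \<le> norm x" for x
    using that \<sigma>_zero[of x] d\<sigma>_zero[of x] by (auto simp: g_def w_def)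
  obtain B where B: "\<And>x. norm x \<le> R + 1 + 1 \<Longrightarrow> \<bar>T x\<bar> \<le> B" "\<And>x. norm x \<le> R + 1 + 1 \<Longrightarrow> \<bar>T' x\<bar> \<le> B"
    using bound[of "R + 1 + 1"] by blast
  have main: "(LINT x|lborel. (g x)\<^sup>2 * T' x) = - 2 * (LINT x|lborel. g x * w x * T x)"
    by (rule integral_sq_directional_derivative[OF g w gw g_zero w_zero T T' deriv B])
  have e1: "gauss_density x * (u x * \<eta> x)\<^sup>2 = (g x)\<^sup>2" and e2: "gauss_density x * ((u x * \<eta> x)\<^sup>2 * T' x) = (g x)\<^sup>2 * T' x"
    and e3: "gauss_density x * (u x * \<eta> x * p x * T x) = g x * w x * T x"
    and e4: "gauss_density x * (p x)\<^sup>2 = (w x)\<^sup>2" and e5: "gauss_density x * (u x * \<eta> x * T x)\<^sup>2 = (T x * g x)\<^sup>2" for x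
    by (simp_all add: g_eq w_eq power_mult_distrib power2_eq_square flip: root_gauss_sq)
  show ?eq
    using main by (simp add: integral_gauss e2 e3)
  have gT: "square_integrable lborel (\<lambda>x. T x * g x)" "square_integrable lborel (\<lambda>x. T' x * g x)"
    by (intro square_integrable_bounded_mult[where B=B] g; use B g_zero T T' in \<open>force simp: not_le[symmetric]\<close>)+
  show ?i1 ?i4 ?i5
    using g w gT by (simp_all add: integrable_gauss e1 e4 e5 square_integrable_real)
  show ?i2
  proof -
    have "(\<lambda>x. (g x)\<^sup>2 * T' x) = (\<lambda>x. g x * (T' x * g x))"
      by (simp add: power2_eq_square fun_eq_iff)
    then have "integrable lborel (\<lambda>x. (g x)\<^sup>2 * T' x)"
      using square_integrable_mult[OF g gT(2)] by (simp only:)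
    then show ?thesis
      by (simp add: integrable_gauss e2)
  qed
  show ?i3
  proof -
    have "(\<lambda>x. g x * w x * T x) = (\<lambda>x. w x * (T x * g x))"
      by (simp add: fun_eq_iff)
    then have "integrable lborel (\<lambda>x. g x * w x * T x)"
      using square_integrable_mult[OF w gT(1)] by (simp only:)
    then show ?thesis
      by (simp add: integrable_gauss e3)
  qed
qed

text \<open>The factor \<open>exp 1\<close> normalizes the value at the origin to \<open>1\<close>. The cutoff is not constant near the origin, but
  it tends to \<open>1\<close> pointwise and its gradient tends to \<open>0\<close> uniformly, which is all that the limits below use.\<close>

definition cutoff :: "nat \<Rightarrow> real ^ 'n \<Rightarrow> real" where
  "cutoff n x = exp 1 * bump 0 (1 - (norm x)\<^sup>2 * (1 / (real (n + 1))\<^sup>2))"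

lemma cutoff_smooth: "elementary_smooth (cutoff n)"
  unfolding cutoff_def[abs_def]
  by (intro elementary_smooth.mult elementary_smooth.bump elementary_smooth_diff elementary_smooth.const elementary_smooth_norm_sq)

lemma one_minus_ratio_sq_le: "0 < a \<Longrightarrow> a \<le> b \<Longrightarrow> 1 - b\<^sup>2 * (1 / a\<^sup>2) \<le> (0 :: real)"
  using power_mono[of 1 "b / a" 2] by (simp add: power_divide)

lemma cutoff_zero: "\<forall>x. real (n + 1) \<le> norm x \<longrightarrow> cutoff n x = 0"
proof (intro allI impI)
  fix x :: "real ^ 'n"
  assume "real (n + 1) \<le> norm x"
  then have "1 - (norm x)\<^sup>2 * (1 / (real (n + 1))\<^sup>2) \<le> 0"
    by (intro one_minus_ratio_sq_le) auto
  then show "cutoff n x = 0"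
    by (simp only: cutoff_def bump_eq_0 mult_zero_right)
qed

lemma cutoff_bounds: "0 \<le> cutoff n x" "cutoff n x \<le> 1"
proof -
  show "0 \<le> cutoff n x"
    by (simp add: cutoff_def bump_nonneg)
  have "bump 0 s \<le> exp (- 1)" if "s \<le> 1" for s
    using that by (simp add: bump_def)
  then have "exp 1 * bump 0 (1 - (norm x)\<^sup>2 * (1 / (real (n + 1))\<^sup>2)) \<le> exp 1 * exp (- 1)"
    by (intro mult_left_mono) auto
  then show "cutoff n x \<le> 1"
    by (simp add: cutoff_def flip: exp_add)
qed

lemma cutoff_tendsto: "(\<lambda>n. cutoff n x) \<longlonglongrightarrow> 1"
proof -
  have "(\<lambda>n. 1 / (real (n + 1))\<^sup>2) \<longlonglongrightarrow> 0"
    using tendsto_power[OF LIMSEQ_inverse_real_of_nat, of 2] by (simp add: inverse_eq_divide power_divide add.commute)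
  then have "(\<lambda>n. 1 - (norm x)\<^sup>2 * (1 / (real (n + 1))\<^sup>2)) \<longlonglongrightarrow> 1 - (norm x)\<^sup>2 * 0"
    by (intro tendsto_intros)
  then have "(\<lambda>n. cutoff n x) \<longlonglongrightarrow> exp 1 * bump 0 (1 - (norm x)\<^sup>2 * 0)"
    unfolding cutoff_def by (intro tendsto_mult tendsto_const isCont_tendsto_compose[OF DERIV_isCont[OF DERIV_bump]])
  then show ?thesis
    by (simp add: bump_def flip: exp_add)
qed

lemma partial_deriv_cutoff_le: "\<bar>partial_deriv i (cutoff n) x\<bar> \<le> 4 * exp 1 / real (n + 1)"
proof -
  let ?s = "1 - (norm x)\<^sup>2 * (1 / (real (n + 1))\<^sup>2)"
  have "((\<lambda>x. 1 - (norm x)\<^sup>2 * c) has_derivative (\<lambda>v. - (2 * (x \<bullet> v) * c))) (at x)" for c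
    by (auto intro!: derivative_eq_intros norm_sq_has_derivative)
  from has_derivative_mult_right[OF has_derivative_compose[OF this[of "1 / (real (n + 1))\<^sup>2"]
        DERIV_bump[of 0, unfolded has_field_derivative_def]], of "exp 1"]
  have "(cutoff n has_derivative (\<lambda>v. exp 1 * (bump 2 ?s * - (2 * (x \<bullet> v) * (1 / (real (n + 1))\<^sup>2))))) (at x)"
    by (simp add: cutoff_def[abs_def] numeral_2_eq_2)
  from partial_deriv_eq[OF this, of i]
  have eq: "partial_deriv i (cutoff n) x = - (exp 1 * bump 2 ?s * 2 * x $ i / (real (n + 1))\<^sup>2)"
    by (simp add: inner_axis)
  show ?thesis
  proof (cases "norm x < real (n + 1)")
    case True
    have "\<bar>exp 1 * bump 2 ?s * 2 * x $ i / (real (n + 1))\<^sup>2\<bar> = exp 1 * bump 2 ?s * 2 * \<bar>x $ i\<bar> / (real (n + 1))\<^sup>2"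
      by (simp add: abs_mult bump_nonneg)
    also have "\<dots> \<le> exp 1 * 2 * 2 * real (n + 1) / (real (n + 1))\<^sup>2"
      using bump_le[of 2 ?s] component_le_norm_cart[of x i] True
      by (intro divide_right_mono mult_mono) (auto simp: bump_nonneg fact_2)
    also have "\<dots> = 4 * exp 1 / real (n + 1)"
      by (simp add: power2_eq_square)
    finally show ?thesis
      by (simp add: eq)
  next
    case False
    then have "?s \<le> 0"
      by (intro one_minus_ratio_sq_le) auto
    then have "bump 2 ?s = 0"
      by (rule bump_eq_0)
    then show ?thesis
      by (simp add: eq)
  qed
qed

lemma partial_deriv_cutoff_tendsto: "(\<lambda>n. partial_deriv i (cutoff n) x) \<longlonglongrightarrow> 0"
proof (rule Lim_null_comparison)
  show "\<forall>\<^sub>F n in sequentially. norm (partial_deriv i (cutoff n) x) \<le> 4 * exp 1 * inverse (real (Suc n))"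
    using partial_deriv_cutoff_le[of i _ x] by (simp add: divide_inverse add.commute)
  show "(\<lambda>n. 4 * exp 1 * inverse (real (Suc n))) \<longlonglongrightarrow> 0"
    using LIMSEQ_inverse_real_of_nat by (rule tendsto_mult_right_zero)
qed

lemma partial_deriv_cutoff_bound: "\<bar>partial_deriv i (cutoff n) x\<bar> \<le> 4 * exp 1"
  using partial_deriv_cutoff_le[of i n x] frac_le[of "4 * exp 1" "4 * exp 1" 1 "real (n + 1)"] by simp

lemma cutoff_mult_sq_le: "(a * cutoff n x)\<^sup>2 \<le> a\<^sup>2" for a :: real
  using mult_left_mono[of "(cutoff n x)\<^sup>2" 1 "a\<^sup>2"] by (simp add: cutoff_bounds power_le_one power_mult_distrib)

lemma cutoff_mult_sq_tendsto: "(\<lambda>n. (a * cutoff n x)\<^sup>2) \<longlonglongrightarrow> a\<^sup>2" for a :: real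
  using tendsto_power[OF tendsto_mult[OF tendsto_const cutoff_tendsto], of a x 2] by simp

lemma partial_deriv_cutoff_mult_sq_le: "(a * partial_deriv i (cutoff n) x)\<^sup>2 \<le> (4 * exp 1)\<^sup>2 * a\<^sup>2" for a :: real
  using power_mono[OF partial_deriv_cutoff_bound[of i n x], of 2]
    mult_right_mono[of "(partial_deriv i (cutoff n) x)\<^sup>2" "(4 * exp 1)\<^sup>2" "a\<^sup>2"]
  by (simp add: power_mult_distrib mult.commute)

lemma cutoff_measurable [measurable]:
  "cutoff n \<in> borel_measurable borel" "partial_deriv i (cutoff n) \<in> borel_measurable borel"
  by (intro elementary_smooth_measurable cutoff_smooth
      elementary_smooth_differentiable(2)[OF cutoff_smooth])+

section \<open>The entropy inequality in one coordinate\<close>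

text \<open>Fatou's lemma, as a criterion for integrability.\<close>

lemma integrable_of_bounded_integrals:
  fixes f :: "nat \<Rightarrow> 'a \<Rightarrow> real"
  assumes int: "\<And>n. integrable M (f n)" and nonneg: "\<And>n x. 0 \<le> f n x"
    and lim: "\<And>x. (\<lambda>n. f n x) \<longlonglongrightarrow> g x" and bound: "\<And>n. (LINT x|M. f n x) \<le> C"
  shows "integrable M g"
proof (rule integrableI_nonneg)
  have [measurable]: "f n \<in> borel_measurable M" for n
    using int by auto
  show "g \<in> borel_measurable M"
    using lim by (rule borel_measurable_LIMSEQ_real) simp
  show "AE x in M. 0 \<le> g x"
    using LIMSEQ_le_const[OF lim] nonneg by auto
  have "(\<integral>\<^sup>+x. ennreal (g x) \<partial>M) = (\<integral>\<^sup>+x. liminf (\<lambda>n. ennreal (f n x)) \<partial>M)"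
    using lim by (intro nn_integral_cong lim_imp_Liminf[symmetric] tendsto_ennrealI) auto
  also have "\<dots> \<le> liminf (\<lambda>n. \<integral>\<^sup>+x. ennreal (f n x) \<partial>M)"
    by (rule nn_integral_liminf) simp
  also have "\<dots> \<le> liminf (\<lambda>n :: nat. ennreal C)"
  proof (intro Liminf_mono always_eventually allI)
    show "(\<integral>\<^sup>+x. ennreal (f n x) \<partial>M) \<le> ennreal C" for n
      using bound[of n] nonneg by (subst nn_integral_eq_integral[OF int]) (auto intro: ennreal_leI)
  qed
  also have "\<dots> < \<infinity>"
    by (simp add: Liminf_const)
  finally show "(\<integral>\<^sup>+x. ennreal (g x) \<partial>M) < \<infinity>" .
qed

lemma axis_coordinate_DERIV: "((\<lambda>s. (x + axis i s) $ i) has_real_derivative 1) (at 0)"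
  by (auto simp: axis_def intro!: derivative_eq_intros)

text \<open>Integration by parts with \<open>T = x\<^sub>i\<close> expresses the second moment of a localized function through the first
  derivative. The mixed term is absorbed into half of the second moment, which is therefore bounded uniformly in the
  cutoff and finite in the limit. The limit of the same identity computes the mixed term in the expansion of \<open>(v - 2\<pi>x\<^sub>iu)\<^sup>2\<close>.\<close>

lemma coordinate_second_moment:
  fixes u v :: "real ^ 'n \<Rightarrow> real"
  assumes u: "square_integrable gauss u" and v: "square_integrable gauss v" and weak: "weak_partial i u v"
  shows "square_integrable gauss (\<lambda>x. x $ i * u x)"
    and "(LINT x|gauss. (v x - 2 * pi * (x $ i * u x))\<^sup>2)
      = (LINT x|gauss. (v x)\<^sup>2) + 2 * pi * (LINT x|gauss. (u x)\<^sup>2) - 4 * pi\<^sup>2 * (LINT x|gauss. (x $ i * u x)\<^sup>2)"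
proof -
  let ?w = "\<lambda>x. 2 * (v x)\<^sup>2 + 2 * (4 * exp 1)\<^sup>2 * (u x)\<^sup>2"
  have [measurable]: "u \<in> borel_measurable borel" "v \<in> borel_measurable borel"
    and u2: "integrable gauss (\<lambda>x. (u x)\<^sup>2)" and v2: "integrable gauss (\<lambda>x. (v x)\<^sup>2)"
    using u v by (auto simp: square_integrable_real)
  let ?\<eta> = "cutoff :: nat \<Rightarrow> real ^ 'n \<Rightarrow> real"
  let ?d = "\<lambda>n. partial_deriv i (?\<eta> n)"
  define q where "q n x = v x * ?\<eta> n x + u x * ?d n x" for n x
  have [measurable]: "q n \<in> borel_measurable borel" for n
    unfolding q_def by measurable
  have bd: "\<exists>B. \<forall>x :: real ^ 'n. norm x \<le> R \<longrightarrow> \<bar>x $ i\<bar> \<le> B \<and> \<bar>1 :: real\<bar> \<le> B" for R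
    using component_le_norm_cart[of _ i] by (intro exI[of _ "max R 1"]) (auto intro: order_trans simp: le_max_iff_disj)
  note parts = gauss_parts[OF u v weak cutoff_smooth cutoff_zero measurable_vec_nth borel_measurable_const
      axis_coordinate_DERIV bd]
  have q_le: "(q n x)\<^sup>2 \<le> ?w x" for n x
  proof -
    note cutoff_mult_sq_le[of "v x" n x] partial_deriv_cutoff_mult_sq_le[of "u x" i n x]
    moreover have "(q n x)\<^sup>2 \<le> 2 * (v x * ?\<eta> n x)\<^sup>2 + 2 * (u x * ?d n x)\<^sup>2"
      unfolding q_def
      using sum_squares_bound[of "v x * ?\<eta> n x" "u x * ?d n x"]
        power2_sum[of "v x * ?\<eta> n x" "u x * ?d n x"] by linarith
    ultimately show ?thesis by (simp add: mult.assoc)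
  qed
  have q2: "integrable gauss (\<lambda>x. (q n x)\<^sup>2)" for n
    by (rule Bochner_Integration.integrable_bound[of _ "\<lambda>x. ?w x"])
      (use u2 v2 q_le in \<open>auto intro!: order_trans[OF _ abs_ge_self]\<close>)
  define Y where "Y n x = u x * ?\<eta> n x * x $ i" for n x
  have Y2: "integrable gauss (\<lambda>x. (Y n x)\<^sup>2)" for n
    using parts(6)[of n] by (simp add: Y_def)
  have [measurable]: "Y n \<in> borel_measurable borel" for n
    unfolding Y_def by measurable
  have YQ: "integrable gauss (\<lambda>x. Y n x * q n x)" for n
    using square_integrable_mult[of gauss "Y n" "q n"] Y2 q2 by (simp add: square_integrable_real)
  have u\<eta>2: "integrable gauss (\<lambda>x. (u x * ?\<eta> n x)\<^sup>2)" for n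
    using parts(2)[of n] .
  have id: "(LINT x|gauss. (u x * ?\<eta> n x)\<^sup>2) = - 2 * (LINT x|gauss. Y n x * q n x) + 4 * pi * (LINT x|gauss. (Y n x)\<^sup>2)" for n
  proof -
    have "(LINT x|gauss. (u x * ?\<eta> n x)\<^sup>2) = - 2 * (LINT x|gauss. Y n x * q n x - 2 * pi * (Y n x)\<^sup>2)"
      using parts(1)[of n] by (simp add: q_def Y_def power2_eq_square algebra_simps)
    also have "(LINT x|gauss. Y n x * q n x - 2 * pi * (Y n x)\<^sup>2)
        = (LINT x|gauss. Y n x * q n x) - 2 * pi * (LINT x|gauss. (Y n x)\<^sup>2)"
      using YQ Y2 by simp
    finally show ?thesis by simp
  qed
  define A where "A = (LINT x|gauss. (u x)\<^sup>2)"
  define C where "C = (LINT x|gauss. ?w x)"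
  have Y_bound: "(LINT x|gauss. (Y n x)\<^sup>2) \<le> (A + C / (2 * pi)) / (2 * pi)" for n
  proof -
    have "2 * (LINT x|gauss. Y n x * q n x) = (LINT x|gauss. 2 * (Y n x * q n x))"
      by simp
    also have "\<dots> \<le> (LINT x|gauss. 2 * pi * (Y n x)\<^sup>2 + 1 / (2 * pi) * (q n x)\<^sup>2)"
    proof (rule integral_mono)
      fix x
      have "0 \<le> (2 * pi * Y n x - q n x)\<^sup>2 / (2 * pi)" by simp
      also have "\<dots> = 2 * pi * (Y n x)\<^sup>2 + 1 / (2 * pi) * (q n x)\<^sup>2 - 2 * (Y n x * q n x)"
        by (simp add: power2_eq_square field_simps)
      finally show "2 * (Y n x * q n x) \<le> 2 * pi * (Y n x)\<^sup>2 + 1 / (2 * pi) * (q n x)\<^sup>2" by simp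
    qed (use YQ Y2 q2 in auto)
    also have "\<dots> = 2 * pi * (LINT x|gauss. (Y n x)\<^sup>2) + 1 / (2 * pi) * (LINT x|gauss. (q n x)\<^sup>2)"
      using Y2 q2 by simp
    finally have "2 * pi * (LINT x|gauss. (Y n x)\<^sup>2) \<le> (LINT x|gauss. (u x * ?\<eta> n x)\<^sup>2) + 1 / (2 * pi) * (LINT x|gauss. (q n x)\<^sup>2)"
      using id[of n] by simp
    also have "(LINT x|gauss. (u x * ?\<eta> n x)\<^sup>2) \<le> A"
      unfolding A_def using u2 u\<eta>2 cutoff_mult_sq_le by (intro integral_mono) auto
    also have "(LINT x|gauss. (q n x)\<^sup>2) \<le> C"
      unfolding C_def using u2 v2 q2 q_le by (intro integral_mono) auto
    finally show ?thesis
      by (simp add: field_simps)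
  qed
  have \<eta>_lim: "(\<lambda>n. ?\<eta> n x) \<longlonglongrightarrow> 1" for x
    by (rule cutoff_tendsto)
  have Y_lim: "(\<lambda>n. Y n x) \<longlonglongrightarrow> x $ i * u x" for x
    unfolding Y_def using tendsto_mult[OF tendsto_mult[OF tendsto_const[of "u x"] \<eta>_lim[of x]] tendsto_const[of "x $ i"]]
    by (simp add: mult.commute)
  have q_lim: "(\<lambda>n. q n x) \<longlonglongrightarrow> v x" for x
    unfolding q_def using tendsto_add[OF tendsto_mult[OF tendsto_const[of "v x"] \<eta>_lim[of x]]
        tendsto_mult[OF tendsto_const[of "u x"] partial_deriv_cutoff_tendsto[of i x]]] by simp
  have X2: "integrable gauss (\<lambda>x. (x $ i * u x)\<^sup>2)"
    by (rule integrable_of_bounded_integrals[OF Y2 _ tendsto_power[OF Y_lim] Y_bound]) simp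
  then show X: "square_integrable gauss (\<lambda>x. x $ i * u x)"
    by (simp add: square_integrable_real)
  have Y_le: "(Y n x)\<^sup>2 \<le> (x $ i * u x)\<^sup>2" for n x
    using cutoff_mult_sq_le[of "x $ i * u x" n x] by (simp add: Y_def mult_ac)
  have lim1: "(\<lambda>n. LINT x|gauss. (u x * ?\<eta> n x)\<^sup>2) \<longlonglongrightarrow> (LINT x|gauss. (u x)\<^sup>2)"
    by (rule integral_dominated_convergence[where w="\<lambda>x. (u x)\<^sup>2"])
      (use u2 in \<open>auto intro!: AE_I2 cutoff_mult_sq_le cutoff_mult_sq_tendsto\<close>)
  have lim2: "(\<lambda>n. LINT x|gauss. (Y n x)\<^sup>2) \<longlonglongrightarrow> (LINT x|gauss. (x $ i * u x)\<^sup>2)"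
    by (rule integral_dominated_convergence[where w="\<lambda>x. (x $ i * u x)\<^sup>2"])
      (use X2 Y_le tendsto_power[OF Y_lim] in auto)
  have lim3: "(\<lambda>n. LINT x|gauss. Y n x * q n x) \<longlonglongrightarrow> (LINT x|gauss. x $ i * u x * v x)"
  proof (rule integral_dominated_convergence[where
        w="\<lambda>x. (x $ i * u x)\<^sup>2 + ?w x"])
    show "AE x in gauss. norm (Y n x * q n x) \<le> (x $ i * u x)\<^sup>2 + ?w x" for n
    proof (rule AE_I2)
      fix x
      show "norm (Y n x * q n x) \<le> (x $ i * u x)\<^sup>2 + ?w x"
        using abs_mult_le_sum_squares[of "Y n x" "q n x"] Y_le[of n x] q_le[of n x]
        unfolding real_norm_def by linarith
    qed
  qed (use X2 u2 v2 tendsto_mult[OF Y_lim q_lim] in auto)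
  have "(\<lambda>n. LINT x|gauss. (u x * ?\<eta> n x)\<^sup>2)
      \<longlonglongrightarrow> - 2 * (LINT x|gauss. x $ i * u x * v x) + 4 * pi * (LINT x|gauss. (x $ i * u x)\<^sup>2)"
    unfolding id by (intro tendsto_intros lim2 lim3)
  then have fin: "(LINT x|gauss. (u x)\<^sup>2) = - 2 * (LINT x|gauss. x $ i * u x * v x) + 4 * pi * (LINT x|gauss. (x $ i * u x)\<^sup>2)"
    using lim1 LIMSEQ_unique by blast
  have XV: "integrable gauss (\<lambda>x. x $ i * u x * v x)"
    using square_integrable_mult[OF X v] .
  have "(LINT x|gauss. (v x - 2 * pi * (x $ i * u x))\<^sup>2)
      = (LINT x|gauss. (v x)\<^sup>2 - 4 * pi * (x $ i * u x * v x) + 4 * pi\<^sup>2 * (x $ i * u x)\<^sup>2)"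
    by (intro Bochner_Integration.integral_cong) (auto simp: power2_eq_square algebra_simps)
  also have "\<dots> = (LINT x|gauss. (v x)\<^sup>2) - 4 * pi * (LINT x|gauss. x $ i * u x * v x) + 4 * pi\<^sup>2 * (LINT x|gauss. (x $ i * u x)\<^sup>2)"
    using v2 XV X2 by simp
  also have "\<dots> = (LINT x|gauss. (v x)\<^sup>2) + 2 * pi * (LINT x|gauss. (u x)\<^sup>2) - 4 * pi\<^sup>2 * (LINT x|gauss. (x $ i * u x)\<^sup>2)"
    unfolding fin by (simp add: power2_eq_square algebra_simps)
  finally show "(LINT x|gauss. (v x - 2 * pi * (x $ i * u x))\<^sup>2)
      = (LINT x|gauss. (v x)\<^sup>2) + 2 * pi * (LINT x|gauss. (u x)\<^sup>2) - 4 * pi\<^sup>2 * (LINT x|gauss. (x $ i * u x)\<^sup>2)" .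
qed

text \<open>With \<open>g = u \<eta>\<close>, the equation for \<open>ln r\<close> and \<open>ln (\<kappa> T') \<le> \<kappa> T' - 1\<close> bound
  \<open>g\<^sup>2 ln r\<close> by an expression in which \<open>T\<close> occurs as \<open>\<kappa> g\<^sup>2 T' - 2\<pi> (g T)\<^sup>2\<close>. Integration by parts replaces the first
  term by \<open>- 2\<kappa> g p T\<close>, and completing the square leaves \<open>\<kappa>\<^sup>2 / (2\<pi>) \<cdot> p\<^sup>2\<close>. The cutoff is
  removed only afterwards, when \<open>T\<close> has disappeared and its growth at infinity cannot interfere.\<close>

lemma conditional_entropy_bound:
  fixes u v r :: "real ^ 'n \<Rightarrow> real"
  assumes u: "square_integrable gauss u" and v: "square_integrable gauss v" and weak: "weak_partial i u v"
    and cont: "continuous_on UNIV r" and "0 < c" and c: "\<And>x. c \<le> r x" and C: "\<And>x. r x \<le> C"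
    and avg: "\<And>x. average i r x = 1" and "0 < \<kappa>"
  shows "(LINT x|gauss. (u x)\<^sup>2 * ln (r x)) \<le> 2 * pi * (LINT x|gauss. (x $ i * u x)\<^sup>2)
      - (1 + ln \<kappa>) * (LINT x|gauss. (u x)\<^sup>2)
      + \<kappa>\<^sup>2 / (2 * pi) * (LINT x|gauss. (v x - 2 * pi * (x $ i * u x))\<^sup>2)"
proof -
  let ?a = "\<lambda>x. 2 * pi * (x $ i)\<^sup>2 - (1 + ln \<kappa>)" and ?z = "\<lambda>x. v x - 2 * pi * (x $ i * u x)"
  have [measurable]: "u \<in> borel_measurable borel" "v \<in> borel_measurable borel"
    and u2: "integrable gauss (\<lambda>x. (u x)\<^sup>2)" and v2: "integrable gauss (\<lambda>x. (v x)\<^sup>2)"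
    using u v by (auto simp: square_integrable_real)
  have [measurable]: "r \<in> borel_measurable borel"
    by (intro borel_measurable_continuous_onI cont)
  note X = coordinate_second_moment(1)[OF u v weak]
  then have X2: "integrable gauss (\<lambda>x. (x $ i * u x)\<^sup>2)"
    by (simp add: square_integrable_real)
  obtain T T' where T: "T \<in> borel_measurable borel" and T': "T' \<in> borel_measurable borel"
    and deriv: "\<And>x. ((\<lambda>s. T (x + axis i s)) has_real_derivative T' x) (at 0)" and T'_pos: "\<And>x. 0 < T' x"
    and log: "\<And>x. ln (r x) = 2 * pi * ((x $ i)\<^sup>2 - (T x)\<^sup>2) + ln (T' x)"
    and bound: "\<And>R. \<exists>B. \<forall>x. norm x \<le> R \<longrightarrow> \<bar>T x\<bar> \<le> B \<and> \<bar>T' x\<bar> \<le> B"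
    using conditional_transport[OF cont \<open>0 < c\<close> c C avg] by metis
  let ?\<eta> = "cutoff :: nat \<Rightarrow> real ^ 'n \<Rightarrow> real"
  let ?d = "\<lambda>n. partial_deriv i (?\<eta> n)"
  define p where "p n x = v x * ?\<eta> n x + u x * ?d n x - 2 * pi * x $ i * (u x * ?\<eta> n x)" for n x
  note parts = gauss_parts[OF u v weak cutoff_smooth cutoff_zero T T' deriv bound, folded p_def]
  note [measurable] = parts(7)
  define L where "L = max \<bar>ln c\<bar> \<bar>ln C\<bar>"
  have ln_r: "\<bar>ln (r x)\<bar> \<le> L" for x
  proof -
    have "ln c \<le> ln (r x)" "ln (r x) \<le> ln C"
      using \<open>0 < c\<close> c[of x] C[of x] by simp_all
    then show ?thesis by (auto simp: L_def)
  qed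
  have int_ln: "integrable gauss (\<lambda>x. (u x * ?\<eta> n x)\<^sup>2 * ln (r x))" for n
  proof (rule Bochner_Integration.integrable_bound[OF integrable_mult_left[OF parts(2)[of n], of L]])
    show "AE x in gauss. norm ((u x * ?\<eta> n x)\<^sup>2 * ln (r x)) \<le> norm ((u x * ?\<eta> n x)\<^sup>2 * L)"
      using ln_r by (intro AE_I2) (auto simp: abs_mult intro!: mult_left_mono intro: order_trans[OF _ abs_ge_self])
  qed simp
  define W where "W n x = (u x * ?\<eta> n x)\<^sup>2 * ?a x + \<kappa>\<^sup>2 / (2 * pi) * (p n x)\<^sup>2" for n x
  have a_int: "integrable gauss (\<lambda>x. 2 * pi * (x $ i * u x)\<^sup>2 + \<bar>1 + ln \<kappa>\<bar> * (u x)\<^sup>2)"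
    using u2 X2 by simp
  have a_le: "norm ((u x * ?\<eta> n x)\<^sup>2 * ?a x)
      \<le> 2 * pi * (x $ i * u x)\<^sup>2 + \<bar>1 + ln \<kappa>\<bar> * (u x)\<^sup>2" for n x
  proof -
    have "\<bar>2 * pi * (x $ i)\<^sup>2 - (1 + ln \<kappa>)\<bar> \<le> 2 * pi * (x $ i)\<^sup>2 + \<bar>1 + ln \<kappa>\<bar>"
      by (rule order_trans[OF abs_triangle_ineq4]) simp
    from mult_mono[OF cutoff_mult_sq_le[of "u x" n x] this] show ?thesis
      unfolding real_norm_def abs_mult by (simp add: power_mult_distrib algebra_simps)
  qed
  have Y2: "integrable gauss (\<lambda>x. (u x * ?\<eta> n x)\<^sup>2 * ?a x)" for n
    by (rule Bochner_Integration.integrable_bound[OF a_int]) (use order_trans[OF a_le abs_ge_self] in auto)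
  have W_int: "integrable gauss (W n)" for n
    unfolding W_def using Y2 parts(5) by simp
  have step: "(LINT x|gauss. (u x * ?\<eta> n x)\<^sup>2 * ln (r x)) \<le> (LINT x|gauss. W n x)" for n
  proof -
    let ?g = "\<lambda>x. u x * ?\<eta> n x"
    \<comment> \<open>the multiple of \<open>\<kappa>\<close> that is added on the right has integral zero, by integration by parts\<close>
    have "(LINT x|gauss. (?g x)\<^sup>2 * ln (r x))
        \<le> (LINT x|gauss. W n x + \<kappa> * ((?g x)\<^sup>2 * T' x + 2 * (?g x * p n x * T x)))"
    proof (rule integral_mono)
      fix x
      have "ln (\<kappa> * T' x) \<le> \<kappa> * T' x - 1"
        using \<open>0 < \<kappa>\<close> T'_pos[of x] by (intro ln_le_minus_one) simp
      then have "ln (T' x) \<le> \<kappa> * T' x - 1 - ln \<kappa>"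
        using \<open>0 < \<kappa>\<close> T'_pos[of x] by (simp add: ln_mult)
      then have "ln (r x) \<le> 2 * pi * ((x $ i)\<^sup>2 - (T x)\<^sup>2) + (\<kappa> * T' x - 1 - ln \<kappa>)"
        by (simp add: log)
      then have "(?g x)\<^sup>2 * ln (r x) \<le> (?g x)\<^sup>2 * (2 * pi * ((x $ i)\<^sup>2 - (T x)\<^sup>2) + (\<kappa> * T' x - 1 - ln \<kappa>))"
        by (rule mult_left_mono) simp
      also have "\<dots> = (?g x)\<^sup>2 * ?a x + \<kappa> * ((?g x)\<^sup>2 * T' x) - 2 * pi * (?g x * T x)\<^sup>2"
        by (simp add: power_mult_distrib algebra_simps)
      also have "\<dots> \<le> W n x + \<kappa> * ((?g x)\<^sup>2 * T' x + 2 * (?g x * p n x * T x))"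
      proof -
        have "0 \<le> (2 * pi * (?g x * T x) + \<kappa> * p n x)\<^sup>2 / (2 * pi)" by simp
        also have "\<dots> = 2 * pi * (?g x * T x)\<^sup>2 + 2 * \<kappa> * (?g x * p n x * T x) + \<kappa>\<^sup>2 / (2 * pi) * (p n x)\<^sup>2"
          by (simp add: power2_eq_square field_simps)
        finally show ?thesis
          by (simp add: W_def distrib_left mult.assoc mult.left_commute)
      qed
      finally show "(?g x)\<^sup>2 * ln (r x) \<le> W n x + \<kappa> * ((?g x)\<^sup>2 * T' x + 2 * (?g x * p n x * T x))" .
    qed (use int_ln W_int parts(3,4)[of n] in auto)
    also have "\<dots> = (LINT x|gauss. W n x)"
      using W_int parts(3,4)[of n] parts(1)[of n] by simp
    finally show ?thesis .
  qed
  have \<eta>_lim: "(\<lambda>n. ?\<eta> n x) \<longlonglongrightarrow> 1" for x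
    by (rule cutoff_tendsto)
  have p_lim: "(\<lambda>n. p n x) \<longlonglongrightarrow> v x - 2 * pi * (x $ i * u x)" for x
  proof -
    have "(\<lambda>n. p n x) \<longlonglongrightarrow> v x * 1 + u x * 0 - 2 * pi * x $ i * (u x * 1)"
      unfolding p_def by (intro tendsto_intros \<eta>_lim partial_deriv_cutoff_tendsto)
    then show ?thesis by (simp add: mult.assoc)
  qed
  have p_le: "(p n x)\<^sup>2 \<le> 3 * ((v x)\<^sup>2 + (4 * exp 1)\<^sup>2 * (u x)\<^sup>2 + 4 * pi\<^sup>2 * (x $ i * u x)\<^sup>2)" for n x
  proof -
    have three: "(a + b - d)\<^sup>2 \<le> 3 * (a\<^sup>2 + b\<^sup>2 + d\<^sup>2)" for a b d :: real
    proof -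
      have "3 * (a\<^sup>2 + b\<^sup>2 + d\<^sup>2) - (a + b - d)\<^sup>2 = (a - b)\<^sup>2 + (a + d)\<^sup>2 + (b + d)\<^sup>2"
        by (simp add: power2_eq_square algebra_simps)
      moreover have "0 \<le> (a - b)\<^sup>2 + (a + d)\<^sup>2 + (b + d)\<^sup>2"
        by simp
      ultimately show ?thesis by linarith
    qed
    have "(2 * pi * x $ i * (u x * ?\<eta> n x))\<^sup>2 \<le> 4 * pi\<^sup>2 * (x $ i * u x)\<^sup>2"
      using cutoff_mult_sq_le[of "2 * pi * x $ i * u x" n x] by (simp add: power_mult_distrib mult_ac)
    moreover note cutoff_mult_sq_le[of "v x" n x] partial_deriv_cutoff_mult_sq_le[of "u x" i n x]
    ultimately have "3 * ((v x * ?\<eta> n x)\<^sup>2 + (u x * ?d n x)\<^sup>2 + (2 * pi * x $ i * (u x * ?\<eta> n x))\<^sup>2)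
        \<le> 3 * ((v x)\<^sup>2 + (4 * exp 1)\<^sup>2 * (u x)\<^sup>2 + 4 * pi\<^sup>2 * (x $ i * u x)\<^sup>2)"
      by (intro mult_left_mono add_mono) auto
    then show ?thesis
      unfolding p_def by (rule order_trans[OF three])
  qed
  have lim_l: "(\<lambda>n. LINT x|gauss. (u x * ?\<eta> n x)\<^sup>2 * ln (r x)) \<longlonglongrightarrow> (LINT x|gauss. (u x)\<^sup>2 * ln (r x))"
  proof (rule integral_dominated_convergence[where w="\<lambda>x. L * (u x)\<^sup>2"])
    show "AE x in gauss. (\<lambda>n. (u x * ?\<eta> n x)\<^sup>2 * ln (r x)) \<longlonglongrightarrow> (u x)\<^sup>2 * ln (r x)"
      by (intro AE_I2 tendsto_mult cutoff_mult_sq_tendsto tendsto_const)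
    show "AE x in gauss. norm ((u x * ?\<eta> n x)\<^sup>2 * ln (r x)) \<le> L * (u x)\<^sup>2" for n
    proof (rule AE_I2)
      fix x
      show "norm ((u x * ?\<eta> n x)\<^sup>2 * ln (r x)) \<le> L * (u x)\<^sup>2"
        using mult_mono[OF cutoff_mult_sq_le[of "u x" n x] ln_r[of x]] by (simp add: abs_mult mult.commute)
    qed
  qed (use u2 in auto)
  have lim_a: "(\<lambda>n. LINT x|gauss. (u x * ?\<eta> n x)\<^sup>2 * ?a x)
      \<longlonglongrightarrow> (LINT x|gauss. (u x)\<^sup>2 * ?a x)"
    by (rule integral_dominated_convergence[OF _ _ a_int])
      (use a_le in \<open>auto intro!: AE_I2 tendsto_mult cutoff_mult_sq_tendsto\<close>)
  have lim_p: "(\<lambda>n. LINT x|gauss. (p n x)\<^sup>2) \<longlonglongrightarrow> (LINT x|gauss. (?z x)\<^sup>2)"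
    by (rule integral_dominated_convergence[where
          w="\<lambda>x. 3 * ((v x)\<^sup>2 + (4 * exp 1)\<^sup>2 * (u x)\<^sup>2 + 4 * pi\<^sup>2 * (x $ i * u x)\<^sup>2)"])
      (use u2 v2 X2 p_le tendsto_power[OF p_lim] in auto)
  have W_eq: "(LINT x|gauss. W n x) = (LINT x|gauss. (u x * ?\<eta> n x)\<^sup>2 * ?a x)
      + \<kappa>\<^sup>2 / (2 * pi) * (LINT x|gauss. (p n x)\<^sup>2)" for n
    unfolding W_def using Y2 parts(5) by simp
  have "(\<lambda>n. LINT x|gauss. W n x) \<longlonglongrightarrow> (LINT x|gauss. (u x)\<^sup>2 * ?a x)
      + \<kappa>\<^sup>2 / (2 * pi) * (LINT x|gauss. (?z x)\<^sup>2)"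
    unfolding W_eq by (intro tendsto_intros lim_a lim_p)
  then have "(LINT x|gauss. (u x)\<^sup>2 * ln (r x)) \<le> (LINT x|gauss. (u x)\<^sup>2 * ?a x)
      + \<kappa>\<^sup>2 / (2 * pi) * (LINT x|gauss. (?z x)\<^sup>2)"
    using LIMSEQ_le[OF lim_l] step by blast
  also have "(LINT x|gauss. (u x)\<^sup>2 * ?a x)
      = (LINT x|gauss. 2 * pi * (x $ i * u x)\<^sup>2 - (1 + ln \<kappa>) * (u x)\<^sup>2)"
    by (simp add: power_mult_distrib algebra_simps)
  also have "\<dots> = 2 * pi * (LINT x|gauss. (x $ i * u x)\<^sup>2) - (1 + ln \<kappa>) * (LINT x|gauss. (u x)\<^sup>2)"
    using u2 X2 by simp
  finally show ?thesis by simp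
qed

section \<open>Iterated averages\<close>

lemma integrable_gauss1_bounded:
  assumes "k \<in> borel_measurable borel" "\<And>s. \<bar>k s\<bar> \<le> B"
  shows "integrable gauss1 (k :: real \<Rightarrow> real)"
proof -
  interpret G1: prob_space gauss1 by (rule prob_space_gauss1)
  have "k \<in> borel_measurable gauss1"
    using assms(1) by simp
  then show ?thesis
    by (rule G1.integrable_const_bound[where B=B, rotated]) (use assms(2) in auto)
qed

lemma average_upd [simp]: "average i h (upd i x s) = average i h x"
  by (simp add: average_def)

context
  fixes h :: "real ^ 'n \<Rightarrow> real" and c C
  assumes cont: "continuous_on UNIV h" and c: "\<And>x. c \<le> h x" and C: "\<And>x. h x \<le> C"
begin

lemma average_slice: "(\<lambda>s. h (upd i x s)) \<in> borel_measurable borel" "integrable gauss1 (\<lambda>s. h (upd i x s))"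
proof -
  have [measurable]: "h \<in> borel_measurable borel"
    by (intro borel_measurable_continuous_onI cont)
  show m: "(\<lambda>s. h (upd i x s)) \<in> borel_measurable borel"
    by measurable
  have "\<bar>h x\<bar> \<le> \<bar>c\<bar> + \<bar>C\<bar>" for x
    using c[of x] C[of x] by linarith
  then show "integrable gauss1 (\<lambda>s. h (upd i x s))"
    by (rule integrable_gauss1_bounded[OF m])
qed

lemma average_bounds: "c \<le> average i h x" "average i h x \<le> C"
proof -
  interpret G1: prob_space gauss1 by (rule prob_space_gauss1)
  show "c \<le> average i h x"
    unfolding average_def using c by (intro G1.integral_ge_const average_slice) auto
  show "average i h x \<le> C"
    unfolding average_def using C by (intro G1.integral_le_const average_slice) auto
qed

lemma average_continuous: "continuous_on UNIV (average i h)"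
proof (intro continuous_at_imp_continuous_on ballI)
  fix x
  interpret G1: prob_space gauss1 by (rule prob_space_gauss1)
  show "isCont (average i h) x"
    unfolding continuous_at_sequentially comp_def
  proof (intro allI impI)
    fix y :: "nat \<Rightarrow> real ^ 'n"
    assume y: "y \<longlonglongrightarrow> x"
    show "(\<lambda>n. average i h (y n)) \<longlonglongrightarrow> average i h x"
      unfolding average_def
    proof (rule integral_dominated_convergence[where w="\<lambda>_. \<bar>c\<bar> + \<bar>C\<bar>"])
      show "AE s in gauss1. (\<lambda>n. h (upd i (y n) s)) \<longlonglongrightarrow> h (upd i x s)"
      proof (rule AE_I2)
        fix s
        have "(\<lambda>n. upd i (y n) s) \<longlonglongrightarrow> upd i x s"
        proof (rule vec_tendstoI)
          show "(\<lambda>n. upd i (y n) s $ j) \<longlonglongrightarrow> upd i x s $ j" for j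
            using tendsto_vec_nth[OF y, of j] by simp
        qed
        then show "(\<lambda>n. h (upd i (y n) s)) \<longlonglongrightarrow> h (upd i x s)"
          by (rule continuous_on_tendsto_compose[OF cont]) auto
      qed
      show "AE s in gauss1. norm (h (upd i (y n) s)) \<le> \<bar>c\<bar> + \<bar>C\<bar>" for n
      proof (rule AE_I2)
        fix s
        show "norm (h (upd i (y n) s)) \<le> \<bar>c\<bar> + \<bar>C\<bar>"
          using c[of "upd i (y n) s"] C[of "upd i (y n) s"] unfolding real_norm_def by linarith
      qed
    qed (use average_slice(1) in auto)
  qed
qed

end

lemma average_invariant:
  assumes "\<And>x s. h (upd j x s) = h x"
  shows "average i h (upd j x s) = average i h x"
proof (cases "i = j")
  case False
  then show ?thesis
    using assms by (simp add: average_def upd_commute[OF False])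
qed simp

lemma fold_average_invariant:
  "(j \<in> set L \<or> (\<forall>x s. h (upd j x s) = h x)) \<Longrightarrow> fold average L h (upd j x s) = fold average L h x"
proof (induction L arbitrary: h)
  case (Cons i L)
  have "j \<in> set L \<or> (\<forall>x s. average i h (upd j x s) = average i h x)"
    using Cons.prems average_invariant[of h j i] by auto
  then show ?case
    using Cons.IH by simp
qed simp

lemma fold_average:
  assumes "continuous_on UNIV h" "\<And>x. c \<le> h x" "\<And>x. h x \<le> C"
  shows "continuous_on UNIV (fold average L h) \<and> (\<forall>x. c \<le> fold average L h x) \<and> (\<forall>x. fold average L h x \<le> C)
    \<and> (LINT x|gauss. fold average L h x) = (LINT x|gauss. h x)"
  using assms
proof (induction L arbitrary: h)
  case (Cons i L)
  have "\<bar>h x\<bar> \<le> \<bar>c\<bar> + \<bar>C\<bar>" for x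
    using Cons.prems(2,3)[of x] by linarith
  then have "(LINT x|gauss. average i h x) = (LINT x|gauss. h x)"
    by (intro integral_average borel_measurable_continuous_onI Cons.prems(1))
  then show ?case
    using Cons.IH[of "average i h"] average_continuous[OF Cons.prems] average_bounds[OF Cons.prems] by simp
qed simp

text \<open>Change the coordinates of \<open>x\<close> into those of \<open>y\<close> one by one.\<close>

lemma upd_invariant_imp_constant:
  fixes h :: "real ^ 'n \<Rightarrow> 'a"
  assumes "\<And>j x s. h (upd j x s) = h x"
  shows "h x = h y"
proof -
  have "h (\<chi> j. if j \<in> S then y $ j else x $ j) = h x" if "finite S" for S
    using that
  proof (induction S)
    case (insert j S)
    have "(\<chi> k. if k \<in> insert j S then y $ k else x $ k) = upd j (\<chi> k. if k \<in> S then y $ k else x $ k) (y $ j)"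
      by (simp add: vec_eq_iff)
    then show ?case
      using assms insert.IH by simp
  qed simp
  from this[of UNIV] show ?thesis by simp
qed

text \<open>The minimum over \<open>\<kappa>\<close> is attained at \<open>\<kappa>\<^sup>2 = 1 / (1 + 2y/n)\<close>, where \<open>y\<close> is the left side of the
  conclusion. With \<open>L = ln (1 + 2y/n)\<close> this is \<open>\<kappa> = exp (- L / 2)\<close>, and \<open>\<delta> \<ge> y - n/2 \<cdot> L \<ge> n L\<^sup>2 / 4\<close>. Hence
  \<open>y \<le> \<delta> + n/2 \<cdot> L\<close> and \<open>L \<le> 2 \<surd>(\<delta> / n)\<close>. For negative \<open>y\<close>, the case \<open>\<kappa> = 1\<close> suffices.\<close>

lemma log_sobolev_numerical:
  fixes n X I H :: real
  assumes "0 < n"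
    and key: "\<And>\<kappa>. 0 < \<kappa> \<Longrightarrow> H \<le> 2 * pi * X - n * (1 + ln \<kappa>) + \<kappa>\<^sup>2 / (2 * pi) * (I + 2 * pi * n - 4 * pi\<^sup>2 * X)"
  defines "\<delta> \<equiv> 1 / (2 * pi) * I - H"
  shows "n / 2 - 2 * pi * X + 1 / (2 * pi) * I \<le> 2 * sqrt (pi * n) * sqrt \<delta> + \<delta>"
proof -
  define y where "y = n / 2 - 2 * pi * X + 1 / (2 * pi) * I"
  have \<delta>: "y + n / 2 + n * ln \<kappa> - \<kappa>\<^sup>2 * (y + n / 2) \<le> \<delta>" if "0 < \<kappa>" for \<kappa>
  proof -
    define Q where "Q = \<kappa>\<^sup>2 * (y + n / 2)"
    have "(I + 2 * pi * n - 4 * pi\<^sup>2 * X) / (2 * pi) = y + n / 2"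
      by (simp add: y_def field_simps power2_eq_square)
    then have "\<kappa>\<^sup>2 / (2 * pi) * (I + 2 * pi * n - 4 * pi\<^sup>2 * X) = Q"
      unfolding Q_def by (metis times_divide_eq_left times_divide_eq_right)
    moreover have "n * (1 + ln \<kappa>) = n + n * ln \<kappa>"
      by (simp add: distrib_left)
    ultimately have "H \<le> 2 * pi * X - (n + n * ln \<kappa>) + Q"
      using key[OF that] by simp
    then have "y + n / 2 + n * ln \<kappa> - Q \<le> \<delta>"
      unfolding \<delta>_def y_def by linarith
    then show ?thesis
      by (simp add: Q_def)
  qed
  have "0 \<le> \<delta>"
    using \<delta>[of 1] by simp
  show ?thesis
  proof (cases "y \<le> 0")
    case True
    have "0 \<le> 2 * sqrt (pi * n) * sqrt \<delta>"
      using \<open>0 < n\<close> \<open>0 \<le> \<delta>\<close> by simp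
    then show ?thesis
      using True \<open>0 \<le> \<delta>\<close> unfolding y_def[symmetric] by linarith
  next
    case False
    define L where "L = ln (1 + 2 * y / n)"
    have "0 < 2 * y / n"
      using False \<open>0 < n\<close> by simp
    then have "0 \<le> L" and exp_L: "exp L = 1 + 2 * y / n"
      by (simp_all add: L_def)
    have y: "y = n / 2 * (exp L - 1)"
      using \<open>0 < n\<close> by (simp add: exp_L)
    have "(exp (- L / 2))\<^sup>2 * (y + n / 2) = n / 2"
    proof -
      have "(exp (- L / 2))\<^sup>2 = exp (- L)"
        by (simp add: power2_eq_square flip: exp_add)
      then show ?thesis
        by (simp add: y exp_minus field_simps)
    qed
    then have lower: "y - n / 2 * L \<le> \<delta>"
      using \<delta>[of "exp (- L / 2)"] by simp
    have "1 + L + L\<^sup>2 / 2 \<le> exp L"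
      using \<open>0 \<le> L\<close> by (rule exp_lower_Taylor_quadratic)
    then have "n / 2 * (L\<^sup>2 / 2) \<le> n / 2 * (exp L - 1 - L)"
      using \<open>0 < n\<close> by (intro mult_left_mono) auto
    also have "\<dots> = y - n / 2 * L"
      by (simp add: y algebra_simps)
    also note lower
    finally have "n * L\<^sup>2 / 4 \<le> \<delta>"
      by simp
    then have "sqrt (n * L\<^sup>2 / 4) \<le> sqrt \<delta>"
      by (rule real_sqrt_le_mono)
    then have s: "sqrt n * L / 2 \<le> sqrt \<delta>"
      using \<open>0 \<le> L\<close> by (simp add: real_sqrt_mult real_sqrt_divide)
    have "1 \<le> sqrt pi"
      using pi_ge_two by simp
    then have "1 / 2 \<le> sqrt pi"
      by linarith
    then have "1 / 2 * (n * L) \<le> sqrt pi * (n * L)"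
      by (rule mult_right_mono) (use \<open>0 < n\<close> \<open>0 \<le> L\<close> in simp)
    then have "n / 2 * L \<le> sqrt pi * (n * L)"
      by simp
    also have "\<dots> = 2 * sqrt (pi * n) * (sqrt n * L / 2)"
      using \<open>0 < n\<close> by (simp add: real_sqrt_mult)
    also have "\<dots> \<le> 2 * sqrt (pi * n) * sqrt \<delta>"
      using s \<open>0 < n\<close> by (intro mult_left_mono) auto
    finally show ?thesis
      using lower unfolding y_def[symmetric] by linarith
  qed
qed

lemma locally_integrable_times_smooth:
  fixes F :: "real ^ 'n \<Rightarrow> complex" and H :: "real ^ 'n \<Rightarrow> 'b :: {banach, second_countable_topology}"
  assumes H: "locally_integrable H" and F: "F \<in> borel_measurable borel" and le: "\<And>x. norm (F x) \<le> norm (H x)"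
    and \<psi>: "elementary_smooth \<psi>" and zero: "\<And>x. R \<le> norm x \<Longrightarrow> \<psi> x = 0"
  shows "Re (LINT x|lborel. F x * complex_of_real (\<psi> x)) = (LINT x|lborel. Re (F x) * \<psi> x)"
    and "Im (LINT x|lborel. F x * complex_of_real (\<psi> x)) = (LINT x|lborel. Im (F x) * \<psi> x)"
proof -
  obtain B where "0 \<le> B" and B: "\<And>x. \<bar>\<psi> x\<bar> \<le> B"
    using compactly_supported_bounded[OF \<psi> zero] by metis
  have [measurable]: "\<psi> \<in> borel_measurable borel" "F \<in> borel_measurable borel"
    by (intro elementary_smooth_measurable \<psi> F)+
  have "set_integrable lborel (cball 0 R) H"
    using H by (simp add: locally_integrable_def)
  then have "integrable lborel (\<lambda>x. B *\<^sub>R (indicator (cball 0 R) x *\<^sub>R H x))"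
    by (intro integrable_scaleR_right) (simp only: set_integrable_def)
  then have int: "integrable lborel (\<lambda>x. F x * complex_of_real (\<psi> x))"
  proof (rule Bochner_Integration.integrable_bound)
    show "AE x in lborel. norm (F x * complex_of_real (\<psi> x)) \<le> norm (B *\<^sub>R (indicator (cball 0 R) x *\<^sub>R H x))"
    proof (rule AE_I2)
      fix x
      show "norm (F x * complex_of_real (\<psi> x)) \<le> norm (B *\<^sub>R (indicator (cball 0 R) x *\<^sub>R H x))"
        using mult_mono[OF le[of x] B[of x]] zero[of x] \<open>0 \<le> B\<close>
        by (cases "norm x \<le> R") (auto simp: norm_mult mult.commute)
    qed
  qed simp
  show "Re (LINT x|lborel. F x * complex_of_real (\<psi> x)) = (LINT x|lborel. Re (F x) * \<psi> x)"
    using integral_bounded_linear[OF bounded_linear_Re int] by simp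
  show "Im (LINT x|lborel. F x * complex_of_real (\<psi> x)) = (LINT x|lborel. Im (F x) * \<psi> x)"
    using integral_bounded_linear[OF bounded_linear_Im int] by simp
qed

text \<open>Test functions are real, so the real and imaginary parts of the defining identity separate.\<close>

lemma has_weak_gradient_weak_partial:
  fixes f :: "real ^ 'n \<Rightarrow> complex"
  assumes grad: "has_weak_gradient f G" and f: "f \<in> borel_measurable borel" and G: "G \<in> borel_measurable borel"
  shows "weak_partial i (\<lambda>x. Re (f x)) (\<lambda>x. Re (G x $ i))" "weak_partial i (\<lambda>x. Im (f x)) (\<lambda>x. Im (G x $ i))"
proof -
  have loc: "locally_integrable f" "locally_integrable G"
    using grad by (auto simp: has_weak_gradient_def)
  have Gi: "(\<lambda>x. G x $ i) \<in> borel_measurable borel"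
    using measurable_compose[OF G measurable_vec_nth] by simp
  have "(LINT x|lborel. Re (f x) * partial_deriv i \<phi> x) = - (LINT x|lborel. Re (G x $ i) * \<phi> x) \<and>
      (LINT x|lborel. Im (f x) * partial_deriv i \<phi> x) = - (LINT x|lborel. Im (G x $ i) * \<phi> x)"
    if \<phi>: "elementary_smooth \<phi>" and zero: "\<forall>x. R \<le> norm x \<longrightarrow> \<phi> x = 0" for \<phi> R
  proof -
    note z = zero[rule_format]
    have "test_function \<phi>"
      by (rule test_functionI[OF \<phi> z])
    then have eq: "(LINT x|lborel. f x * complex_of_real (partial_deriv i \<phi> x)) = - (LINT x|lborel. G x $ i * complex_of_real (\<phi> x))"
      using grad by (simp add: has_weak_gradient_def)
    have dz: "partial_deriv i \<phi> x = 0" if "R + 1 \<le> norm x" for x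
      using that by (intro partial_deriv_zero_outside[OF \<phi> z]) auto
    note 1 = locally_integrable_times_smooth[OF loc(1) f order_refl elementary_smooth_differentiable(2)[OF \<phi>] dz]
    note 2 = locally_integrable_times_smooth[OF loc(2) Gi Finite_Cartesian_Product.norm_nth_le \<phi> z]
    show ?thesis
      using arg_cong[OF eq, of Re] arg_cong[OF eq, of Im] by (simp add: 1 2)
  qed
  then show "weak_partial i (\<lambda>x. Re (f x)) (\<lambda>x. Re (G x $ i))" "weak_partial i (\<lambda>x. Im (f x)) (\<lambda>x. Im (G x $ i))"
    unfolding weak_partial_def by blast+
qed

section \<open>Entropy and deficit of a normalized function\<close>

locale normalized_function =
  fixes f :: "real ^ 'n \<Rightarrow> complex" and G :: "real ^ 'n \<Rightarrow> complex ^ 'n"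
  assumes f_sq: "square_integrable gauss f" and grad: "has_weak_gradient f G"
    and G_sq: "square_integrable gauss G" and norm_f: "(LINT x|gauss. (norm (f x))\<^sup>2) = 1"
begin

definition F :: "real ^ 'n \<Rightarrow> real" where "F x = (norm (f x))\<^sup>2"

definition moment :: "'n \<Rightarrow> real" where "moment i = (LINT x|gauss. (x $ i)\<^sup>2 * F x)"

definition energy :: "'n \<Rightarrow> real" where "energy i = (LINT x|gauss. (norm (G x $ i))\<^sup>2)"

text \<open>The contribution of the i-th coordinate to the right side of the logarithmic Sobolev inequality.\<close>

definition entropy_bound :: "real \<Rightarrow> 'n \<Rightarrow> real" where
  "entropy_bound \<kappa> i = 2 * pi * moment i - (1 + ln \<kappa>) + \<kappa>\<^sup>2 / (2 * pi) * (energy i + 2 * pi - 4 * pi\<^sup>2 * moment i)"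

lemma f_meas [measurable]: "f \<in> borel_measurable borel" and G_meas [measurable]: "G \<in> borel_measurable borel"
  using f_sq G_sq by (auto simp: square_integrable_def measurable_cong_sets[OF sets_gauss refl])

lemma G_nth_meas [measurable]: "(\<lambda>x. G x $ i) \<in> borel_measurable borel"
  using measurable_compose[OF G_meas measurable_vec_nth] by simp

lemma F_nonneg [simp]: "0 \<le> F x"
  by (simp add: F_def)

lemma F_meas [measurable]: "F \<in> borel_measurable borel"
  unfolding F_def[abs_def] by measurable

lemma F_int: "integrable gauss F" and F_total: "(LINT x|gauss. F x) = 1"
  using f_sq norm_f by (simp_all add: square_integrable_def F_def[abs_def])

lemma parts:
  assumes "\<rho> = Re \<or> \<rho> = Im"
  shows "square_integrable gauss (\<lambda>x. \<rho> (f x))" "square_integrable gauss (\<lambda>x. \<rho> (G x $ i))"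
    "weak_partial i (\<lambda>x. \<rho> (f x)) (\<lambda>x. \<rho> (G x $ i))"
proof -
  have le: "\<bar>\<rho> z\<bar> \<le> norm z" for z
    using assms abs_Re_le_cmod abs_Im_le_cmod by auto
  have [measurable]: "\<rho> \<in> borel_measurable borel"
    using assms by auto
  have "(\<rho> z)\<^sup>2 \<le> (norm z)\<^sup>2" for z
    using power_mono[OF le[of z], of 2] by simp
  moreover have "(\<rho> (G x $ i))\<^sup>2 \<le> (norm (G x))\<^sup>2" for x
    using power_mono[OF order_trans[OF le Finite_Cartesian_Product.norm_nth_le[of "G x" i]], of 2] by simp
  ultimately show "square_integrable gauss (\<lambda>x. \<rho> (f x))" "square_integrable gauss (\<lambda>x. \<rho> (G x $ i))"
    using f_sq G_sq unfolding square_integrable_real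
    by (auto simp: square_integrable_def intro: Bochner_Integration.integrable_bound)
  show "weak_partial i (\<lambda>x. \<rho> (f x)) (\<lambda>x. \<rho> (G x $ i))"
    using has_weak_gradient_weak_partial[OF grad f_meas G_meas] assms by auto
qed

lemma F_parts: "F x = (Re (f x))\<^sup>2 + (Im (f x))\<^sup>2"
  by (simp add: F_def cmod_power2)

lemma moment_int: "integrable gauss (\<lambda>x. (x $ i)\<^sup>2 * F x)"
  and conditional_step:
    "\<lbrakk>continuous_on UNIV r; 0 < c; \<And>x. c \<le> r x; \<And>x. r x \<le> C; \<And>x. average i r x = 1; 0 < \<kappa>\<rbrakk>
      \<Longrightarrow> (LINT x|gauss. F x * ln (r x)) \<le> entropy_bound \<kappa> i"
proof -
  note R = parts[of Re, OF disjI1[OF refl]] and I = parts[of Im, OF disjI2[OF refl]]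
  have ints: "integrable gauss (\<lambda>x. (x $ i * Re (f x))\<^sup>2)" "integrable gauss (\<lambda>x. (x $ i * Im (f x))\<^sup>2)"
    using coordinate_second_moment(1)[OF R] coordinate_second_moment(1)[OF I] by (auto simp: square_integrable_real)
  have m: "(x $ i)\<^sup>2 * F x = (x $ i * Re (f x))\<^sup>2 + (x $ i * Im (f x))\<^sup>2" for x
    by (simp add: F_parts power_mult_distrib distrib_left)
  show "integrable gauss (\<lambda>x. (x $ i)\<^sup>2 * F x)"
    using ints by (simp add: m)
  have moment: "moment i = (LINT x|gauss. (x $ i * Re (f x))\<^sup>2) + (LINT x|gauss. (x $ i * Im (f x))\<^sup>2)"
    using ints by (simp add: moment_def m)
  have total: "1 = (LINT x|gauss. (Re (f x))\<^sup>2) + (LINT x|gauss. (Im (f x))\<^sup>2)"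
    using R(1) I(1) F_total by (simp add: F_parts square_integrable_real)
  have energy: "energy i = (LINT x|gauss. (Re (G x $ i))\<^sup>2) + (LINT x|gauss. (Im (G x $ i))\<^sup>2)"
    using R(2)[of i] I(2)[of i] by (simp add: energy_def cmod_power2 square_integrable_real)
  assume r: "continuous_on UNIV r" "0 < c" "\<And>x. c \<le> r x" "\<And>x. r x \<le> C" "\<And>x. average i r x = 1" and \<kappa>: "0 < \<kappa>"
  have [measurable]: "r \<in> borel_measurable borel"
    by (intro borel_measurable_continuous_onI r)
  have ln_r: "\<bar>ln (r x)\<bar> \<le> \<bar>ln c\<bar> + \<bar>ln C\<bar>" for x
  proof -
    have "ln c \<le> ln (r x)" "ln (r x) \<le> ln C"
      using r(2) r(3,4)[of x] by simp_all
    then show ?thesis by linarith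
  qed
  have li: "integrable gauss (\<lambda>x. (u x)\<^sup>2 * ln (r x))" if "square_integrable gauss u" for u
  proof (rule Bochner_Integration.integrable_bound)
    show "integrable gauss (\<lambda>x. (\<bar>ln c\<bar> + \<bar>ln C\<bar>) * (u x)\<^sup>2)"
      using that by (simp add: square_integrable_real)
    show "(\<lambda>x. (u x)\<^sup>2 * ln (r x)) \<in> borel_measurable gauss"
      using that by (auto simp: square_integrable_real)
    show "AE x in gauss. norm ((u x)\<^sup>2 * ln (r x)) \<le> norm ((\<bar>ln c\<bar> + \<bar>ln C\<bar>) * (u x)\<^sup>2)"
      using ln_r mult_left_mono[OF ln_r, of "(u _)\<^sup>2"] by (intro AE_I2) (simp add: abs_mult mult.commute)
  qed
  have combine: "a1 + a2 \<le> 2 * pi * (m1 + m2) - (1 + l) + k * ((e1 + e2) + 2 * pi - 4 * pi\<^sup>2 * (m1 + m2))"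
    if "a1 \<le> 2 * pi * m1 - (1 + l) * n1 + k * (e1 + 2 * pi * n1 - 4 * pi\<^sup>2 * m1)"
      "a2 \<le> 2 * pi * m2 - (1 + l) * n2 + k * (e2 + 2 * pi * n2 - 4 * pi\<^sup>2 * m2)" "1 = n1 + n2"
    for a1 a2 m1 m2 n1 n2 e1 e2 k l :: real
  proof -
    have "n2 = 1 - n1"
      using that(3) by simp
    with add_mono[OF that(1,2)] show ?thesis
      by (simp add: algebra_simps)
  qed
  have "(LINT x|gauss. F x * ln (r x)) = (LINT x|gauss. (Re (f x))\<^sup>2 * ln (r x)) + (LINT x|gauss. (Im (f x))\<^sup>2 * ln (r x))"
    using li[OF R(1)] li[OF I(1)] by (simp add: F_parts distrib_right)
  also have "\<dots> \<le> entropy_bound \<kappa> i"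
    unfolding entropy_bound_def moment energy
    by (rule combine[OF conditional_entropy_bound[OF R r \<kappa>, unfolded coordinate_second_moment(2)[OF R]]
          conditional_entropy_bound[OF I r \<kappa>, unfolded coordinate_second_moment(2)[OF I]] total])
  finally show "(LINT x|gauss. F x * ln (r x)) \<le> entropy_bound \<kappa> i" .
qed

lemma F_ln_integrable:
  assumes [measurable]: "h \<in> borel_measurable borel" and "0 < c" "\<And>x. c \<le> h x" "\<And>x. h x \<le> C"
  shows "integrable gauss (\<lambda>x. F x * ln (h x))" and "\<bar>ln (h x)\<bar> \<le> \<bar>ln c\<bar> + \<bar>ln C\<bar>"
proof -
  have ln_h: "\<bar>ln (h x)\<bar> \<le> \<bar>ln c\<bar> + \<bar>ln C\<bar>" for x
  proof -
    have "ln c \<le> ln (h x)" "ln (h x) \<le> ln C"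
      using assms(2) assms(3,4)[of x] by simp_all
    then show ?thesis by linarith
  qed
  then show "\<bar>ln (h x)\<bar> \<le> \<bar>ln c\<bar> + \<bar>ln C\<bar>" .
  show "integrable gauss (\<lambda>x. F x * ln (h x))"
  proof (rule Bochner_Integration.integrable_bound)
    show "integrable gauss (\<lambda>x. (\<bar>ln c\<bar> + \<bar>ln C\<bar>) * F x)"
      using F_int by simp
    show "AE x in gauss. norm (F x * ln (h x)) \<le> norm ((\<bar>ln c\<bar> + \<bar>ln C\<bar>) * F x)"
      using mult_left_mono[OF ln_h F_nonneg] by (intro AE_I2) (simp add: abs_mult mult.commute)
  qed simp
qed

text \<open>Write \<open>h\<close> as the product of \<open>r\<close> and its average over the coordinate \<open>i\<close>, so that \<open>ln h\<close> splits. The one-coordinate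
  bound handles \<open>r\<close>, and the average is treated next.\<close>

lemma telescope:
  assumes "0 < \<kappa>" "continuous_on UNIV h" "0 < c" "\<And>x. c \<le> h x" "\<And>x. h x \<le> C"
  shows "(LINT x|gauss. F x * ln (h x)) \<le> (LINT x|gauss. F x * ln (fold average L h x)) + (\<Sum>i\<leftarrow>L. entropy_bound \<kappa> i)"
  using assms(2,4,5)
proof (induction L arbitrary: h)
  case (Cons i L)
  let ?a = "average i h" and ?r = "\<lambda>x. h x / average i h x"
  note cont = Cons.prems(1) and c = Cons.prems(2) and C = Cons.prems(3)
  note a = average_continuous[OF Cons.prems] average_bounds[OF Cons.prems]
  have "0 < C"
    using \<open>0 < c\<close> c[of undefined] C[of undefined] by linarith
  have pos: "0 < h x" "0 < ?a x" for x
    using \<open>0 < c\<close> c[of x] a(2)[of i x] by linarith+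
  have r_cont: "continuous_on UNIV ?r"
    using pos by (intro continuous_on_divide cont a(1)) (auto simp: less_imp_neq[symmetric])
  have r_bounds: "c / C \<le> ?r x" "?r x \<le> C / c" for x
    using pos[of x] \<open>0 < c\<close> \<open>0 < C\<close> c[of x] C[of x] a(2,3)[of i x] by (auto intro!: frac_le)
  have r_avg: "average i ?r x = 1" for x
  proof -
    have "average i ?r x = (LINT s|gauss1. h (upd i x s) / ?a x)"
      by (simp add: average_def[of i ?r])
    also have "\<dots> = ?a x / ?a x"
      by (simp add: average_def[of i h])
    finally show ?thesis
      using pos[of x] by simp
  qed
  have meas: "?r \<in> borel_measurable borel" "?a \<in> borel_measurable borel"
    by (intro borel_measurable_continuous_onI r_cont a(1))+
  have "(LINT x|gauss. F x * ln (h x)) = (LINT x|gauss. F x * ln (?r x) + F x * ln (?a x))"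
  proof (intro Bochner_Integration.integral_cong refl)
    fix x
    have "ln (h x) = ln (?r x) + ln (?a x)"
      using pos[of x] by (simp add: ln_div)
    then show "F x * ln (h x) = F x * ln (?r x) + F x * ln (?a x)"
      by (simp add: distrib_left)
  qed
  also have "\<dots> = (LINT x|gauss. F x * ln (?r x)) + (LINT x|gauss. F x * ln (?a x))"
    using F_ln_integrable(1)[OF meas(1) divide_pos_pos[OF \<open>0 < c\<close> \<open>0 < C\<close>] r_bounds]
      F_ln_integrable(1)[OF meas(2) \<open>0 < c\<close> a(2,3)]
    by (rule Bochner_Integration.integral_add)
  also have "(LINT x|gauss. F x * ln (?r x)) \<le> entropy_bound \<kappa> i"
    by (rule conditional_step[OF r_cont divide_pos_pos[OF \<open>0 < c\<close> \<open>0 < C\<close>] r_bounds r_avg \<open>0 < \<kappa>\<close>])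
  also have "(LINT x|gauss. F x * ln (?a x)) \<le> (LINT x|gauss. F x * ln (fold average L ?a x)) + (\<Sum>i\<leftarrow>L. entropy_bound \<kappa> i)"
    by (rule Cons.IH[OF a])
  finally show ?case by simp
qed simp

lemma entropy_continuous:
  assumes "0 < \<kappa>" "continuous_on UNIV h" "0 < c" "\<And>x. c \<le> h x" "\<And>x. h x \<le> C"
  shows "(LINT x|gauss. F x * ln (h x)) \<le> ln (LINT x|gauss. h x) + (\<Sum>i\<in>UNIV. entropy_bound \<kappa> i)"
proof -
  interpret G: prob_space "gauss :: (real ^ 'n) measure" by (rule prob_space_gauss)
  obtain L :: "'n list" where L: "set L = UNIV" "distinct L"
    using finite_distinct_list[OF finite[of "UNIV :: 'n set"]] by auto
  have const: "fold average L h x = fold average L h 0" for x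
    by (rule upd_invariant_imp_constant) (simp add: fold_average_invariant L)
  have "(LINT x|gauss. h x) = (LINT x|gauss. fold average L h x)"
    using fold_average[OF assms(2,4,5), of L] by simp
  also have "\<dots> = (LINT x|(gauss :: (real ^ 'n) measure). fold average L h 0)"
    by (subst const) simp
  also have "\<dots> = fold average L h 0"
    using G.prob_space by simp
  finally have mean: "fold average L h x = (LINT x|gauss. h x)" for x
    using const[of x] by simp
  have "(\<Sum>i\<leftarrow>L. entropy_bound \<kappa> i) = (\<Sum>i\<in>UNIV. entropy_bound \<kappa> i)"
    using L by (metis sum_list_distinct_conv_sum_set)
  then show ?thesis
    using telescope[OF assms, of L] F_total by (simp add: mean)
qed

lemma entropy_measurable:
  assumes "0 < \<kappa>" and h [measurable]: "h \<in> borel_measurable borel" and "0 < c" and c: "\<And>x. c \<le> h x" and C: "\<And>x. h x \<le> C"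
  shows "(LINT x|gauss. F x * ln (h x)) \<le> ln (LINT x|gauss. h x) + (\<Sum>i\<in>UNIV. entropy_bound \<kappa> i)"
proof -
  interpret G: prob_space "gauss :: (real ^ 'n) measure" by (rule prob_space_gauss)
  have "c \<le> C"
    using c[of undefined] C[of undefined] by linarith
  obtain g where g: "\<And>n. continuous_on UNIV (g n)" and "AE x in lborel. (\<lambda>n. g n x) \<longlonglongrightarrow> h x"
    using AE_limit_of_continuous[OF h] by blast
  then have lim: "AE x in gauss. (\<lambda>n. g n x) \<longlonglongrightarrow> h x"
    unfolding gauss_eq by (subst AE_density) (auto elim: eventually_mono)
  define k where "k n x = max c (min C (g n x))" for n x
  have k_cont: "continuous_on UNIV (k n)" for n
    unfolding k_def by (intro continuous_intros g)
  have [measurable]: "k n \<in> borel_measurable borel" for n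
    by (intro borel_measurable_continuous_onI k_cont)
  have k_bounds: "c \<le> k n x" "k n x \<le> C" for n x
    using \<open>c \<le> C\<close> by (auto simp: k_def)
  have k_lim: "AE x in gauss. (\<lambda>n. k n x) \<longlonglongrightarrow> h x"
    using lim
  proof eventually_elim
    fix x assume "(\<lambda>n. g n x) \<longlonglongrightarrow> h x"
    then have "(\<lambda>n. k n x) \<longlonglongrightarrow> max c (min C (h x))"
      unfolding k_def by (intro tendsto_intros)
    then show "(\<lambda>n. k n x) \<longlonglongrightarrow> h x"
      using c[of x] C[of x] by (simp add: max_absorb2 min_absorb2)
  qed
  have 1: "(\<lambda>n. LINT x|gauss. F x * ln (k n x)) \<longlonglongrightarrow> (LINT x|gauss. F x * ln (h x))"
  proof (rule integral_dominated_convergence[where w="\<lambda>x. F x * (\<bar>ln c\<bar> + \<bar>ln C\<bar>)"])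
    show "AE x in gauss. (\<lambda>n. F x * ln (k n x)) \<longlonglongrightarrow> F x * ln (h x)"
      using k_lim
    proof eventually_elim
      fix x assume "(\<lambda>n. k n x) \<longlonglongrightarrow> h x"
      then show "(\<lambda>n. F x * ln (k n x)) \<longlonglongrightarrow> F x * ln (h x)"
        using c[of x] \<open>0 < c\<close> by (intro tendsto_intros) auto
    qed
    show "AE x in gauss. norm (F x * ln (k n x)) \<le> F x * (\<bar>ln c\<bar> + \<bar>ln C\<bar>)" for n
    proof (rule AE_I2)
      fix x
      have "\<bar>ln (k n x)\<bar> \<le> \<bar>ln c\<bar> + \<bar>ln C\<bar>"
        by (rule F_ln_integrable(2)[OF _ \<open>0 < c\<close> k_bounds]) simp
      then show "norm (F x * ln (k n x)) \<le> F x * (\<bar>ln c\<bar> + \<bar>ln C\<bar>)"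
        using F_nonneg[of x] by (simp add: abs_mult mult_left_mono)
    qed
  qed (use F_int in auto)
  have 2: "(\<lambda>n. LINT x|gauss. k n x) \<longlonglongrightarrow> (LINT x|gauss. h x)"
  proof (rule integral_dominated_convergence[where w="\<lambda>x. C"])
    show "AE x in gauss. norm (k n x) \<le> C" for n
      using k_bounds[of n] \<open>0 < c\<close> by (intro AE_I2) (simp add: order_trans[OF less_imp_le])
  qed (use k_lim in auto)
  have "integrable gauss h"
    by (rule G.integrable_const_bound[where B=C])
      (use c C \<open>0 < c\<close> in \<open>auto simp: order_trans[OF less_imp_le]\<close>)
  then have "c \<le> (LINT x|gauss. h x)"
    by (rule G.integral_ge_const) (use c in simp)
  then have "(\<lambda>n. ln (LINT x|gauss. k n x) + (\<Sum>i\<in>UNIV. entropy_bound \<kappa> i))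
      \<longlonglongrightarrow> ln (LINT x|gauss. h x) + (\<Sum>i\<in>UNIV. entropy_bound \<kappa> i)"
    using \<open>0 < c\<close> by (intro tendsto_intros 2) auto
  from LIMSEQ_le[OF 1 this] show ?thesis
    using entropy_continuous[OF \<open>0 < \<kappa>\<close> k_cont \<open>0 < c\<close> k_bounds] by blast
qed

text \<open>Insert \<open>F\<close>, cut off from above and away from zero. Its Gaussian mean exceeds \<open>1\<close> by at most the lower cutoff level,
  so the logarithm of the mean disappears in the limit. Since \<open>t ln t \<ge> -1\<close>, the integrands are bounded below, and the
  uniform upper bound makes \<open>F ln F\<close> integrable. This is essential, as the integral in the deficit would otherwise be
  zero by convention.\<close>

lemma entropy_le:
  assumes "0 < \<kappa>"
  shows "(LINT x|gauss. F x * ln (F x)) \<le> (\<Sum>i\<in>UNIV. entropy_bound \<kappa> i)" (is "_ \<le> ?S")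
proof -
  interpret G: prob_space "gauss :: (real ^ 'n) measure" by (rule prob_space_gauss)
  define h where "h n x = max (1 / real (n + 1)) (min (real (n + 1)) (F x))" for n x
  have [measurable]: "h n \<in> borel_measurable borel" for n
    unfolding h_def[abs_def] by measurable
  have N: "0 < 1 / real (n + 1)" "1 / real (n + 1) \<le> 1" "1 \<le> real (n + 1)" for n
    by auto
  have h_bounds: "1 / real (n + 1) \<le> h n x" "h n x \<le> real (n + 1)" for n x
    using order_trans[OF N(2)[of n] N(3)[of n]] by (auto simp: h_def max_def min_def)
  have h_pos: "0 < h n x" for n x
    using less_le_trans[OF N(1) h_bounds(1)] .
  note Fln = F_ln_integrable(1)[OF _ N(1) h_bounds]
  have h_int: "(LINT x|gauss. h n x) \<le> 1 + 1 / real (n + 1)" and h_int_pos: "0 < (LINT x|gauss. h n x)" for n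
  proof -
    have ih: "integrable gauss (h n)"
      by (rule G.integrable_const_bound[where B="real (n + 1)"])
        (use h_pos[of n] h_bounds(2)[of n] in \<open>auto simp: abs_of_pos\<close>)
    have clip: "max a (min b t) \<le> t + a" if "0 < a" "0 \<le> t" for a b t :: real
      using that by (auto simp: max_def min_def)
    have "(LINT x|gauss. h n x) \<le> (LINT x|gauss. F x + 1 / real (n + 1))"
    proof (rule integral_mono[OF ih])
      show "h n x \<le> F x + 1 / real (n + 1)" for x
        unfolding h_def by (rule clip[OF N(1) F_nonneg])
    qed (use F_int in auto)
    also have "\<dots> = 1 + 1 / real (n + 1)"
      using F_int F_total G.prob_space by simp
    finally show "(LINT x|gauss. h n x) \<le> 1 + 1 / real (n + 1)" .
    show "0 < (LINT x|gauss. h n x)"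
      by (rule less_le_trans[OF N(1)[of n]], rule G.integral_ge_const[OF ih]) (use h_bounds(1)[of n] in simp)
  qed
  have upper: "(LINT x|gauss. F x * ln (h n x)) \<le> ln (1 + 1 / real (n + 1)) + ?S" for n
  proof -
    have "(LINT x|gauss. F x * ln (h n x)) \<le> ln (LINT x|gauss. h n x) + ?S"
      by (rule entropy_measurable[OF \<open>0 < \<kappa>\<close> _ N(1) h_bounds]) simp
    also have "ln (LINT x|gauss. h n x) \<le> ln (1 + 1 / real (n + 1))"
      using h_int h_int_pos by (intro ln_mono) (auto intro: less_le_trans)
    finally show ?thesis by simp
  qed
  have h_lim: "(\<lambda>n. F x * ln (h n x)) \<longlonglongrightarrow> F x * ln (F x)" for x
  proof (cases "F x = 0")
    case False
    then have "0 < F x"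
      using F_nonneg[of x] by linarith
    obtain m :: nat where m: "max (F x) (1 / F x) < real m"
      using reals_Archimedean2 by blast
    have "h n x = F x" if "m \<le> n" for n
    proof -
      have "F x < real (n + 1)" "1 / F x < real (n + 1)"
        using m that by auto
      moreover from this(2) have "1 / real (n + 1) < F x"
        using \<open>0 < F x\<close> by (simp add: field_simps)
      ultimately show ?thesis
        by (simp add: h_def)
    qed
    then show ?thesis
      by (intro tendsto_eventually eventually_sequentiallyI[of m]) simp
  qed simp
  have h_less: "F x \<le> h n x \<and> h n x \<le> 1" if "F x \<le> 1" for n x
  proof -
    have "t \<le> max a (min b t) \<and> max a (min b t) \<le> 1" if "t \<le> 1" "a \<le> 1" "1 \<le> b" for a b t :: real
      using that by (auto simp: max_def min_def)
    from this[OF that N(2,3)] show ?thesis unfolding h_def .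
  qed
  have h_greater: "1 \<le> h n x \<and> h n x \<le> F x" if "1 \<le> F x" for n x
  proof -
    have "1 \<le> max a (min b t) \<and> max a (min b t) \<le> t" if "1 \<le> t" "a \<le> 1" "1 \<le> b" for a b t :: real
      using that by (auto simp: max_def min_def)
    from this[OF that N(2,3)] show ?thesis unfolding h_def .
  qed
  have between: "\<bar>F x * ln (h n x)\<bar> \<le> \<bar>F x * ln (F x)\<bar> \<and> - 1 \<le> F x * ln (h n x)" for n x
  proof (cases "F x = 0")
    case False
    then have pos: "0 < F x"
      using F_nonneg[of x] by linarith
    show ?thesis
    proof (cases "F x \<le> 1")
      case True
      have "ln (F x) \<le> ln (h n x)" "ln (h n x) \<le> 0"
        using h_less[OF True, of n] pos h_pos[of n x] by (simp_all add: ln_le_zero_iff)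
      moreover have "- 1 \<le> F x * ln (F x)"
      proof -
        have "ln (1 / F x) \<le> 1 / F x - 1"
          using pos by (intro ln_le_minus_one) simp
        then have "F x * - ln (F x) \<le> F x * (1 / F x - 1)"
          using pos by (intro mult_left_mono) (simp_all add: ln_div)
        then show ?thesis
          using pos by (simp add: right_diff_distrib)
      qed
      ultimately show ?thesis
        using mult_left_mono[of "ln (F x)" "ln (h n x)" "F x"] mult_nonneg_nonpos[of "F x" "ln (h n x)"]
          F_nonneg[of x] by linarith
    next
      case False
      then have "0 \<le> ln (h n x)" "ln (h n x) \<le> ln (F x)"
        using h_greater[of x n] pos h_pos[of n x] by simp_all
      then show ?thesis
        using mult_left_mono[of "ln (h n x)" "ln (F x)" "F x"] mult_nonneg_nonneg[of "F x" "ln (h n x)"]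
          F_nonneg[of x] by linarith
    qed
  qed simp
  have "integrable gauss (\<lambda>x. F x * ln (F x) + 1)"
  proof (rule integrable_of_bounded_integrals)
    show "integrable gauss (\<lambda>x. F x * ln (h n x) + 1)" for n
      using Fln by simp
    show "0 \<le> F x * ln (h n x) + 1" for n x
      using between[of x n] by linarith
    show "(\<lambda>n. F x * ln (h n x) + 1) \<longlonglongrightarrow> F x * ln (F x) + 1" for x
      by (intro tendsto_intros h_lim)
    show "(LINT x|gauss. F x * ln (h n x) + 1) \<le> 1 + ?S + 1" for n
    proof -
      have "ln (1 + 1 / real (n + 1)) \<le> 1 / real (n + 1)"
        by (intro ln_add_one_self_le_self) simp
      then have "(LINT x|gauss. F x * ln (h n x)) \<le> 1 + ?S"
        using upper[of n] N(2)[of n] by linarith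
      then show ?thesis
        using Fln G.prob_space by simp
    qed
  qed
  from Bochner_Integration.integrable_diff[OF this G.integrable_const[of 1]]
  have FlnF: "integrable gauss (\<lambda>x. F x * ln (F x))"
    by simp
  have "(\<lambda>n. LINT x|gauss. F x * ln (h n x)) \<longlonglongrightarrow> (LINT x|gauss. F x * ln (F x))"
    by (rule integral_dominated_convergence[where w="\<lambda>x. \<bar>F x * ln (F x)\<bar>"])
      (use FlnF h_lim between in auto)
  moreover have "(\<lambda>n. ln (1 + 1 / real (n + 1)) + ?S) \<longlonglongrightarrow> ln (1 + 0) + ?S"
    using LIMSEQ_ignore_initial_segment[OF lim_1_over_n, of 1] by (intro tendsto_intros) auto
  ultimately have "(LINT x|gauss. F x * ln (F x)) \<le> ln (1 + 0) + ?S"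
    by (rule LIMSEQ_le) (use upper in blast)
  then show ?thesis by simp
qed

lemma deficit_bound:
  "2 * pi * (LINT x|(gauss :: (real ^ 'n) measure). (norm x)\<^sup>2)
     - 2 * pi * (LINT x|gauss. (norm x)\<^sup>2 * (norm (f x))\<^sup>2)
     + 1 / (2 * pi) * (LINT x|gauss. (norm (G x))\<^sup>2)
   \<le> 2 * sqrt (pi * real CARD('n)) * sqrt (deficit f G) + deficit f G"
proof -
  define X where "X = (LINT x|gauss. (norm x)\<^sup>2 * (norm (f x))\<^sup>2)"
  define I where "I = (LINT x|gauss. (norm (G x))\<^sup>2)"
  define H where "H = (LINT x|gauss. F x * ln (F x))"
  have X: "X = (\<Sum>i\<in>UNIV. moment i)"
    unfolding X_def moment_def F_def[symmetric] norm_sq_vec sum_distrib_right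
    by (rule Bochner_Integration.integral_sum) (rule moment_int)
  have G_nth: "integrable gauss (\<lambda>x. (norm (G x $ i))\<^sup>2)" for i
    using parts(2)[of Re i] parts(2)[of Im i] by (simp add: cmod_power2 square_integrable_real)
  have norm_G: "(norm (G x))\<^sup>2 = (\<Sum>i\<in>UNIV. (norm (G x $ i))\<^sup>2)" for x
    by (simp add: norm_vec_def L2_set_def sum_nonneg)
  have I: "I = (\<Sum>i\<in>UNIV. energy i)"
    unfolding I_def energy_def norm_G by (rule Bochner_Integration.integral_sum) (rule G_nth)
  have M: "(LINT x|(gauss :: (real ^ 'n) measure). (norm x)\<^sup>2) = real CARD('n) / (4 * pi)"
    unfolding norm_sq_vec by (subst Bochner_Integration.integral_sum) (simp_all add: gauss_coordinate_moment)
  have "H \<le> 2 * pi * X - real CARD('n) * (1 + ln \<kappa>)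
      + \<kappa>\<^sup>2 / (2 * pi) * (I + 2 * pi * real CARD('n) - 4 * pi\<^sup>2 * X)" if "0 < \<kappa>" for \<kappa>
  proof -
    define k where "k = \<kappa>\<^sup>2 / (2 * pi)"
    have "(\<Sum>i\<in>UNIV. 2 * pi * moment i) = 2 * pi * X" "(\<Sum>i\<in>UNIV. 4 * pi\<^sup>2 * moment i) = 4 * pi\<^sup>2 * X"
      by (simp_all add: X sum_distrib_left)
    then have "(\<Sum>i\<in>UNIV. entropy_bound \<kappa> i)
        = 2 * pi * X - real CARD('n) * (1 + ln \<kappa>) + k * (I + real CARD('n) * (2 * pi) - 4 * pi\<^sup>2 * X)"
      unfolding entropy_bound_def I k_def[symmetric] sum.distrib sum_subtractf sum_distrib_left[of k, symmetric]
      by (simp add: distrib_left)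
    then have "(\<Sum>i\<in>UNIV. entropy_bound \<kappa> i) = 2 * pi * X - real CARD('n) * (1 + ln \<kappa>)
        + \<kappa>\<^sup>2 / (2 * pi) * (I + 2 * pi * real CARD('n) - 4 * pi\<^sup>2 * X)"
      by (simp only: k_def mult.commute[of "real CARD('n)" "2 * pi"])
    then show ?thesis
      using entropy_le[OF that] by (simp add: H_def)
  qed
  from log_sobolev_numerical[OF _ this]
  have "real CARD('n) / 2 - 2 * pi * X + 1 / (2 * pi) * I
      \<le> 2 * sqrt (pi * real CARD('n)) * sqrt (1 / (2 * pi) * I - H) + (1 / (2 * pi) * I - H)"
    by simp
  moreover have "2 * pi * (LINT x|(gauss :: (real ^ 'n) measure). (norm x)\<^sup>2) = real CARD('n) / 2"
    by (simp add: M)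
  moreover have "deficit f G = 1 / (2 * pi) * I - H"
    by (simp add: deficit_def I_def H_def F_def)
  ultimately show ?thesis
    by (simp only: X_def I_def)
qed

end

theorem theorem1p13:
  fixes f :: "real ^ 'n \<Rightarrow> complex" and G :: "real ^ 'n \<Rightarrow> complex ^ 'n"
  assumes "square_integrable gauss f"
    and "has_weak_gradient f G"
    and "square_integrable gauss G"
    and "(LINT x|gauss. (norm (f x))\<^sup>2) = 1"
  shows "2 * pi * (LINT x|(gauss :: (real ^ 'n) measure). (norm x)\<^sup>2)
           - 2 * pi * (LINT x|gauss. (norm x)\<^sup>2 * (norm (f x))\<^sup>2)
           + 1 / (2 * pi) * (LINT x|gauss. (norm (G x))\<^sup>2)
         \<le> 2 * sqrt (pi * real CARD('n)) * sqrt (deficit f G) + deficit f G"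
proof -
  interpret normalized_function f G
    using assms by unfold_locales
  show ?thesis
    by (rule deficit_bound)
qed

end
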